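(* Let $\varphi:[0,\infty[\to[0,\infty[$ be a locally Lipschitz nondecreasing function with $\varphi(0)=0$, not identically zero. Let $r>0$ and let $B_r$ be the open ball of $\mathbb{R}^d$ of center $0$ and radius $r$. Then the problem $$\Delta_ku=\varphi(u)\ \text{ in } B_r,\qquad u=\infty\ \text{ on }\partial B_r,$$ admits a positive solution if and only if there exists a constant $a>0$ such that $$\int_a^\infty\frac{dt}{\sqrt{\int_0^t\varphi(s)\,ds}}<\infty .$$
   Context: Dunkl setting. $\langle\cdot,\cdot\rangle$ is the Euclidean inner product on $\mathbb{R}^d$, $|\cdot|$ its norm. For $\alpha\in\mathbb{R}^d\setminus\{0\}$, $\sigma_\alpha(x)=x-2\frac{\langle\alpha,x\rangle}{|\alpha|^2}\alpha$. $R$ is a fixed root system: a finite subset of $\mathbb{R}^d\setminus\{0\}$ with $R\cap\mathbb{R}\alpha=\{\pm\alpha\}$ and $\sigma_\alpha(R)=R$ for all $\alpha\in R$. $k:R\to]0,\infty[$ is a fixed (strictly positive) multiplicity function, i.e. $k(\sigma_\alpha\beta)=k(\beta)$ for all $\alpha,\beta\in R$. Assume $m:=d+\sum_{\alpha\in R}k(\alpha)>2$. Put $w_k(x)=\prod_{\alpha\in R}|\langle x,\alpha\rangle|^{k(\alpha)}$. The Dunkl Laplacian is, for $u\in C^2$, $\Delta_ku(x)=\Delta u(x)+\sum_{\alpha\in R}k(\alpha)\left(\frac{\langle\nabla u(x),\alpha\rangle}{\langle\alpha,x\rangle}-\frac{|\alpha|^2}{2}\frac{u(x)-u(\sigma_\alpha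 x)}{\langle\alpha,x\rangle^2}\right)$ (extended by continuity where $\langle\alpha,x\rangle=0$). A positive solution of the problem is a function $u\in C(B_r)$, $u>0$, such that $\int_{B_r}u\,\Delta_k\psi\,w_k\,dx=\int_{B_r}\varphi(u)\,\psi\,w_k\,dx$ for every $\psi\in C_c^\infty(B_r)$, and $\lim_{x\to z}u(x)=\infty$ for every $z\in\partial B_r$. In the integral condition, $1/\sqrt{0}$ is read as $\infty$. *)

theory Defs
  imports "HOL-Analysis.Analysis"
begin

definition reflection :: "'a::euclidean_space \<Rightarrow> 'a \<Rightarrow> 'a" where
  "reflection \<alpha> x = x - (2 * (\<alpha> \<bullet> x) / (norm \<alpha>)\<^sup>2) *\<^sub>R \<alpha>"

definition root_system :: "'a::euclidean_space set \<Rightarrow> bool" where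
  "root_system R \<longleftrightarrow>
     finite R \<and> 0 \<notin> R \<and>
     (\<forall>\<alpha>\<in>R. R \<inter> range (\<lambda>c::real. c *\<^sub>R \<alpha>) = {\<alpha>, -\<alpha>} \<and> reflection \<alpha> ` R = R)"

definition positive_multiplicity :: "'a::euclidean_space set \<Rightarrow> ('a \<Rightarrow> real) \<Rightarrow> bool" where
  "positive_multiplicity R k \<longleftrightarrow>
     (\<forall>\<alpha>\<in>R. k \<alpha> > 0) \<and> (\<forall>\<alpha>\<in>R. \<forall>\<beta>\<in>R. k (reflection \<alpha> \<beta>) = k \<beta>)"

definition dunkl_weight :: "'a::euclidean_space set \<Rightarrow> ('a \<Rightarrow> real) \<Rightarrow> 'a \<Rightarrow> real" where
  "dunkl_weight R k x = (\<Prod>\<alpha>\<in>R. \<bar>x \<bullet> \<alpha>\<bar> powr k \<alpha>)"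

definition partial_deriv :: "'a::euclidean_space \<Rightarrow> ('a \<Rightarrow> real) \<Rightarrow> 'a \<Rightarrow> real" where
  "partial_deriv b f x = frechet_derivative f (at x) b"

definition grad :: "('a::euclidean_space \<Rightarrow> real) \<Rightarrow> 'a \<Rightarrow> 'a" where
  "grad f x = (\<Sum>b\<in>Basis. partial_deriv b f x *\<^sub>R b)"

definition laplacian :: "('a::euclidean_space \<Rightarrow> real) \<Rightarrow> 'a \<Rightarrow> real" where
  "laplacian f x = (\<Sum>b\<in>Basis. partial_deriv b (partial_deriv b f) x)"

definition off_hyperplanes :: "'a::euclidean_space set \<Rightarrow> 'a set" where
  "off_hyperplanes R = {x. \<forall>\<alpha>\<in>R. \<alpha> \<bullet> x \<noteq> 0}"

definition dunkl_laplacian_regular ::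
    "'a::euclidean_space set \<Rightarrow> ('a \<Rightarrow> real) \<Rightarrow> ('a \<Rightarrow> real) \<Rightarrow> 'a \<Rightarrow> real" where
  "dunkl_laplacian_regular R k u x =
     laplacian u x +
     (\<Sum>\<alpha>\<in>R. k \<alpha> * ((grad u x \<bullet> \<alpha>) / (\<alpha> \<bullet> x)
        - (norm \<alpha>)\<^sup>2 / 2 * ((u x - u (reflection \<alpha> x)) / (\<alpha> \<bullet> x)\<^sup>2)))"

(* The formula is only meaningful off the reflecting hyperplanes. Their complement is open and
   dense, and for u of class C^2 the limit below exists; it is the extension by continuity. *)
definition dunkl_laplacian ::
    "'a::euclidean_space set \<Rightarrow> ('a \<Rightarrow> real) \<Rightarrow> ('a \<Rightarrow> real) \<Rightarrow> 'a \<Rightarrow> real" where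
  "dunkl_laplacian R k u x =
     (if x \<in> off_hyperplanes R then dunkl_laplacian_regular R k u x
      else Lim (at x within off_hyperplanes R) (dunkl_laplacian_regular R k u))"

primrec Ck :: "nat \<Rightarrow> ('a::euclidean_space \<Rightarrow> real) \<Rightarrow> bool" where
  "Ck 0 f \<longleftrightarrow> continuous_on UNIV f"
| "Ck (Suc n) f \<longleftrightarrow> f differentiable_on UNIV \<and> (\<forall>b\<in>Basis. Ck n (partial_deriv b f))"

(* Elements of C_c^infinity(U), identified with their extensions by zero to the whole space. *)
definition test_function :: "'a::euclidean_space set \<Rightarrow> ('a \<Rightarrow> real) \<Rightarrow> bool" where
  "test_function U \<psi> \<longleftrightarrow>
     (\<forall>n. Ck n \<psi>) \<and> compact (closure {x. \<psi> x \<noteq> 0}) \<and> closure {x. \<psi> x \<noteq> 0} \<subseteq> U"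

(* The values of u outside the ball are irrelevant. *)
definition positive_blowup_solution ::
    "'a::euclidean_space set \<Rightarrow> ('a \<Rightarrow> real) \<Rightarrow> (real \<Rightarrow> real) \<Rightarrow> real \<Rightarrow> ('a \<Rightarrow> real) \<Rightarrow> bool" where
  "positive_blowup_solution R k \<phi> r u \<longleftrightarrow>
     continuous_on (ball 0 r) u \<and>
     (\<forall>x\<in>ball 0 r. u x > 0) \<and>
     (\<forall>\<psi>. test_function (ball 0 r) \<psi> \<longrightarrow>
        (LINT x:ball 0 r|lborel. u x * dunkl_laplacian R k \<psi> x * dunkl_weight R k x)
          = (LINT x:ball 0 r|lborel. \<phi> (u x) * \<psi> x * dunkl_weight R k x)) \<and>
     (\<forall>z\<in>sphere 0 r. filterlim u at_top (at z within ball 0 r))"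

definition locally_lipschitz_on :: "real set \<Rightarrow> (real \<Rightarrow> real) \<Rightarrow> bool" where
  "locally_lipschitz_on X f \<longleftrightarrow> (\<forall>x\<in>X. \<exists>e>0. \<exists>L. L-lipschitz_on (cball x e \<inter> X) f)"

(* Taken in ennreal, where 1 / 0 is infinite. *)
definition keller_osserman_integral :: "(real \<Rightarrow> real) \<Rightarrow> real \<Rightarrow> ennreal" where
  "keller_osserman_integral \<phi> a =
     (\<integral>\<^sup>+ t\<in>{a..}. 1 / ennreal (sqrt (LBINT s:{0..t}. \<phi> s)) \<partial>lborel)"

end

theory Submission
  imports Defs
begin

text \<open>For radial functions the Dunkl Laplacian is the radial Laplacian in the dimension \<open>m\<close>, so a radial
  solution comes from \<open>v'' + (m - 1) / s * v' = \<phi> (v)\<close>. The energy inequalities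
  \<open>2 / m * (\<Phi> (v s) - \<Phi> (v s\<^sub>0)) \<le> v'(s)\<^sup>2 \<le> 2 * \<Phi> (v s)\<close> compare \<open>v'\<close> with the square root of \<open>\<Phi>\<close>. If the
  integral converges, the solutions that survive on \<open>[0, r]\<close> are bounded on smaller intervals independently of
  their initial value, and the one with the critical initial value explodes exactly at \<open>r\<close>. If the integral
  diverges, every radial solution is global.

  Conversely a solution \<open>u\<close> on the ball, not assumed radial, dominates every bounded radial solution \<open>V\<close>, so
  that \<open>u 0\<close> would exceed every \<open>V 0\<close> if the integral diverged. For the comparison, let
  \<open>V + \<eta> * |x|\<^sup>2 - u\<close> have a positive maximum at \<open>z\<close>. About \<open>z\<close> the reflections fixing \<open>z\<close> act on radial functions
  like extra dimensions, and the remaining ones contribute a bounded drift and a jump term of good sign. Testing the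
  weak equation with smooth bumps about \<open>z\<close> of width \<open>\<tau>\<close> therefore yields a differential inequality in \<open>\<tau>\<close> for
  the averages of the distance to the maximum, which is incompatible with their vanishing as \<open>\<tau>\<close> tends to 0.\<close>

text \<open>The function compared with the radial solution is merely continuous and satisfies the
  equation only against test functions, so nothing can be differentiated at the maximum point
  \<open>z\<close>. What makes averages work instead is an identity of bumps: up to a positive
  factor, the derivative in \<open>\<tau>\<close> of
  \<open>\<tau> powr (- d) * bump z \<tau> 2\<close>, with \<open>d\<close> the local dimension, is
  the main part of the Dunkl Laplacian of \<open>\<tau>\<^sup>2 * bump z \<tau> 0\<close>. This is a
  mean value property in differential form; the drift disturbs it by an error of relative size
  \<open>\<tau>\<close>, which an integrating factor removes. The normalisation also fits the
  weight, whose mass on a ball about \<open>z\<close> is at most of order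
  \<open>\<tau> powr d\<close>. The quadratic term \<open>\<eta> * |x|^2\<close> supplies
  strictness, since \<phi> is only nondecreasing. On the radial side every solution is the limit of
  a monotone iteration from its initial value, and surviving up to \<open>r\<close> means that the
  iterates are bounded at \<open>r\<close>. This property persists under a small increase of the
  initial value; therefore the solution with the critical value cannot be bounded.\<close>

section \<open>Differentiation under the integral sign and smooth bumps\<close>

text \<open>Dominated convergence for the difference quotients: the mean value inequality on
  \<open>{a<..<b}\<close> turns the bound on \<open>f'\<close> into a majorant. Measurability of
  \<open>f' t\<close> is obtained on the way, as a limit of measurable quotients.\<close>

lemma has_real_derivative_integral_param:
  fixes f :: "real \<Rightarrow> 'a::euclidean_space \<Rightarrow> real"
  assumes S: "a < t" "t < b"
    and int: "\<And>\<tau>. a < \<tau> \<Longrightarrow> \<tau> < b \<Longrightarrow> integrable lborel (f \<tau>)"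
    and der: "\<And>\<tau> x. a < \<tau> \<Longrightarrow> \<tau> < b \<Longrightarrow> ((\<lambda>\<tau>. f \<tau> x) has_real_derivative f' \<tau> x) (at \<tau>)"
    and bd: "\<And>\<tau> x. a < \<tau> \<Longrightarrow> \<tau> < b \<Longrightarrow> \<bar>f' \<tau> x\<bar> \<le> B * indicator A x"
    and A: "A \<in> sets lborel" "emeasure lborel A < \<infinity>"
  shows "((\<lambda>\<tau>. \<integral>x. f \<tau> x \<partial>lborel) has_real_derivative (\<integral>x. f' t x \<partial>lborel)) (at t)"
    and "integrable lborel (f' t)"
proof -
  have intA: "integrable lborel (\<lambda>x. B * indicator A x)"
    using A by (intro integrable_mult_right) (simp add: integrable_indicator_iff)
  have *: "((\<lambda>n. \<integral>x. (f (X n) x - f t x) / (X n - t) \<partial>lborel) \<longlonglongrightarrow> (\<integral>x. f' t x \<partial>lborel)) \<and> integrable lborel (f' t)"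
    if X: "\<And>n. X n \<noteq> t" "\<And>n. a < X n" "\<And>n. X n < b" "X \<longlonglongrightarrow> t" for X
  proof -
    have lim: "(\<lambda>n. (f (X n) x - f t x) / (X n - t)) \<longlonglongrightarrow> f' t x" for x
    proof -
      have "((\<lambda>y. (f y x - f t x) / (y - t)) \<longlongrightarrow> f' t x) (at t)"
        using der[OF S] by (simp add: has_field_derivative_iff)
      then show ?thesis using X
        unfolding tendsto_at_iff_sequentially comp_def by auto
    qed
    have meas: "(\<lambda>x. (f (X n) x - f t x) / (X n - t)) \<in> borel_measurable lborel" for n
      using int[OF S] int[OF X(2,3)] by (intro borel_measurable_divide borel_measurable_diff) auto
    have bnd: "norm ((f (X n) x - f t x) / (X n - t)) \<le> B * indicator A x" for n x
    proof -
      have "norm (f (X n) x - f t x) \<le> (B * indicator A x) * norm (X n - t)"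
      proof (rule field_differentiable_bound[where S="{a<..<b}"])
        show "convex {a<..<b}" by simp
        show "((\<lambda>\<tau>. f \<tau> x) has_field_derivative f' z x) (at z within {a<..<b})" if "z \<in> {a<..<b}" for z
          using der that by (auto intro: has_field_derivative_at_within)
      qed (use bd S X in auto)
      then show ?thesis using X(1)[of n] by (simp add: norm_divide divide_le_eq)
    qed
    have m2: "f' t \<in> borel_measurable lborel"
      by (rule borel_measurable_LIMSEQ_metric[OF meas lim])
    have i: "integrable lborel (f' t)"
      by (rule Bochner_Integration.integrable_bound[OF intA m2]) (use bd S in \<open>auto intro: order_trans[OF _ abs_ge_self]\<close>)
    have "(\<lambda>n. \<integral>x. (f (X n) x - f t x) / (X n - t) \<partial>lborel) \<longlonglongrightarrow> (\<integral>x. f' t x \<partial>lborel)"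
      by (rule integral_dominated_convergence[OF m2 meas intA]) (use lim bnd in auto)
    then show ?thesis using i by auto
  qed
  \<comment> \<open>Integrability of \<open>f' t\<close> comes with the limit along any admissible
    sequence, so one has to be exhibited.\<close>
  obtain X0 where X0: "\<And>n. X0 n \<noteq> t" "\<And>n. a < X0 n" "\<And>n. X0 n < b" "X0 \<longlonglongrightarrow> t"
  proof -
    have "(\<lambda>n::nat. t + (b - t) / (real n + 2)) \<longlonglongrightarrow> t" by real_asymp
    moreover have "t < t + (b - t) / (real n + 2)" "t + (b - t) / (real n + 2) < b" for n
    proof -
      have "(b - t) / (real n + 2) < b - t"
        using S by (subst divide_less_eq) (auto simp: mult_less_cancel_left)
      then show "t < t + (b - t) / (real n + 2)" "t + (b - t) / (real n + 2) < b" using S by auto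
    qed
    ultimately show ?thesis using S by (intro that[of "\<lambda>n. t + (b - t) / (real n + 2)"]) (auto simp: less_imp_neq[symmetric] intro: less_trans)
  qed
  show "integrable lborel (f' t)" using *[OF X0] by blast
  show "((\<lambda>\<tau>. \<integral>x. f \<tau> x \<partial>lborel) has_real_derivative (\<integral>x. f' t x \<partial>lborel)) (at t)"
  proof -
    have "((\<lambda>y. ((\<integral>x. f y x \<partial>lborel) - (\<integral>x. f t x \<partial>lborel)) / (y - t)) \<longlongrightarrow> (\<integral>x. f' t x \<partial>lborel)) (at t within {a<..<b})"
      unfolding tendsto_at_iff_sequentially comp_def
    proof (intro allI impI)
      fix X assume X: "\<forall>i. X i \<in> {a<..<b} - {t}" "X \<longlonglongrightarrow> t"
      have "((\<lambda>n. \<integral>x. (f (X n) x - f t x) / (X n - t) \<partial>lborel) \<longlonglongrightarrow> (\<integral>x. f' t x \<partial>lborel))"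
        using *[of X] X by auto
      moreover have "(\<integral>x. (f (X n) x - f t x) / (X n - t) \<partial>lborel) =
          ((\<integral>x. f (X n) x \<partial>lborel) - (\<integral>x. f t x \<partial>lborel)) / (X n - t)" for n
        using int[OF S] int[of "X n"] X by simp
      ultimately show "(\<lambda>n. ((\<integral>x. f (X n) x \<partial>lborel) - (\<integral>x. f t x \<partial>lborel)) / (X n - t)) \<longlonglongrightarrow> (\<integral>x. f' t x \<partial>lborel)"
        by (simp only:)
    qed
    moreover have "at t within {a<..<b} = at t" using S by (intro at_within_open) auto
    ultimately show ?thesis by (simp only: has_field_derivative_iff)
  qed
qed

lemma integrable_bounded_cball:
  fixes f :: "'a::euclidean_space \<Rightarrow> real"
  assumes "f \<in> borel_measurable borel" "\<And>x. x \<in> cball z \<rho> \<Longrightarrow> \<bar>f x\<bar> \<le> B" "\<And>x. x \<notin> cball z \<rho> \<Longrightarrow> f x = 0"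
  shows "integrable lborel f"
proof (rule integrableI_bounded_set[where A="cball z \<rho>" and B=B])
  show "emeasure lborel (cball z \<rho>) < \<infinity>"
    using emeasure_bounded_finite[of "cball z \<rho>"] by simp
qed (use assms in auto)

text \<open>By translation invariance the integral of \<open>f (x + t *\<^sub>R b)\<close> does not
  depend on \<open>t\<close>, and its derivative at 0 is the integral of \<open>D\<close>. Only
  pointwise derivatives along \<open>b\<close> enter, so a divergence can be integrated without
  checking that it is continuous.\<close>

lemma integral_directional_derivative_zero:
  fixes f D :: "'a::euclidean_space \<Rightarrow> real" and b :: 'a
  assumes der: "\<And>x. ((\<lambda>t. f (x + t *\<^sub>R b)) has_real_derivative D x) (at 0)"
    and bd: "\<And>x. \<bar>D x\<bar> \<le> B"
    and supp: "\<And>x. norm x > \<rho> \<Longrightarrow> D x = 0"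
    and f: "integrable lborel f"
  shows "(\<integral>x. D x \<partial>lborel) = 0" "integrable lborel D"
proof -
  \<comment> \<open>Shifts by \<open>t *\<^sub>R b\<close> with \<open>\<bar>t\<bar> < 1\<close>
    move the support of \<open>D\<close> by at most \<open>norm b\<close>.\<close>
  define A where "A = cball (0::'a) (\<rho> + norm b)"
  have der': "((\<lambda>s. f (x + s *\<^sub>R b)) has_real_derivative D (x + t *\<^sub>R b)) (at t)" for x t
  proof -
    have "((\<lambda>s. f ((x + t *\<^sub>R b) + (s + (- t)) *\<^sub>R b)) has_real_derivative D (x + t *\<^sub>R b)) (at t)"
      using der[of "x + t *\<^sub>R b"] DERIV_shift[where f="\<lambda>s. f ((x + t *\<^sub>R b) + s *\<^sub>R b)" and x=t and z="- t"] by simp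
    then show ?thesis by (simp add: algebra_simps)
  qed
  have int: "integrable lborel (\<lambda>x. f (x + t *\<^sub>R b))" for t
  proof -
    have "integrable (distr lborel borel ((+) (t *\<^sub>R b))) f"
      using f by (simp add: lborel_distr_plus)
    then have "integrable lborel (\<lambda>x. f (t *\<^sub>R b + x))"
      by (rule integrable_distr[rotated]) simp
    then show ?thesis by (simp add: add.commute)
  qed
  have eq: "(\<integral>x. f (x + t *\<^sub>R b) \<partial>lborel) = (\<integral>x. f x \<partial>lborel)" for t
  proof -
    have "(\<integral>x. f x \<partial>lborel) = (\<integral>x. f x \<partial>distr lborel borel ((+) (t *\<^sub>R b)))"
      by (simp add: lborel_distr_plus)
    also have "\<dots> = (\<integral>x. f (t *\<^sub>R b + x) \<partial>lborel)"
      using f by (intro integral_distr) auto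
    finally show ?thesis by (simp add: add.commute)
  qed
  have bd': "\<bar>D (x + t *\<^sub>R b)\<bar> \<le> \<bar>B\<bar> * indicator A x" if "-1 < t" "t < 1" for x t
  proof (cases "x \<in> A")
    case True then show ?thesis using bd[of "x + t *\<^sub>R b"] by simp
  next
    case False
    have "norm (t *\<^sub>R b) \<le> norm b" using that by (simp add: mult_left_le_one_le abs_le_iff)
    then have "norm (x + t *\<^sub>R b) > \<rho>"
      using False norm_triangle_ineq4[of "x + t *\<^sub>R b" "t *\<^sub>R b"] by (simp add: A_def)
    then show ?thesis using supp by simp
  qed
  have fin: "A \<in> sets lborel" "emeasure lborel A < \<infinity>"
    unfolding A_def using emeasure_bounded_finite[of "cball (0::'a) (\<rho> + norm b)"] by auto
  note T = has_real_derivative_integral_param[where f="\<lambda>t x. f (x + t *\<^sub>R b)" and a="-1" and b=1 and t=0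
      and f'="\<lambda>t x. D (x + t *\<^sub>R b)", OF _ _ int der' bd' fin]
  have "((\<lambda>t. \<integral>x. f x \<partial>lborel) has_real_derivative (\<integral>x. D x \<partial>lborel)) (at (0::real))"
    using T(1) by (simp add: eq)
  then show "(\<integral>x. D x \<partial>lborel) = 0" using DERIV_unique[OF _ DERIV_const] by blast
  show "integrable lborel D" using T(2) by simp
qed

text \<open>The index makes the family closed under differentiation up to linear combinations, so
  smoothness follows by induction on the order for all \<open>j\<close> at once.\<close>

definition flat_exp :: "nat \<Rightarrow> real \<Rightarrow> real" where
  "flat_exp j t = (if t > 0 then exp (- 1 / t) / t ^ j else 0)"

lemma flat_exp_nonneg: "0 \<le> flat_exp j t" and flat_exp_pos: "t > 0 \<Longrightarrow> 0 < flat_exp j t"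
  and flat_exp_eq_0: "t \<le> 0 \<Longrightarrow> flat_exp j t = 0"
  by (auto simp: flat_exp_def)

lemma flat_exp_at_right_0: "(flat_exp j \<longlongrightarrow> 0) (at_right 0)"
proof -
  have "((\<lambda>t::real. inverse t ^ j / exp (inverse t)) \<longlongrightarrow> 0) (at_right 0)"
    by (rule filterlim_compose[OF tendsto_power_div_exp_0 filterlim_inverse_at_top_right])
  moreover have "\<forall>\<^sub>F t::real in at_right 0. inverse t ^ j / exp (inverse t) = flat_exp j t"
    by (rule eventually_at_right_less[THEN eventually_mono])
      (simp add: flat_exp_def exp_minus field_simps)
  ultimately show ?thesis by (rule Lim_transform_eventually)
qed

text \<open>At 0 the difference quotient from the right is \<open>flat_exp (Suc j)\<close>, which
  tends to 0 like every member of the family.\<close>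

lemma has_real_derivative_flat_exp:
  "(flat_exp j has_real_derivative flat_exp (j + 2) t - real j * flat_exp (j + 1) t) (at t)"
proof -
  consider "t > 0" | "t < 0" | "t = 0" by linarith
  then show ?thesis
  proof cases
    case 1
    have "((\<lambda>t. exp (- 1 / t) / t ^ j) has_real_derivative flat_exp (j + 2) t - real j * flat_exp (j + 1) t) (at t)"
    proof -
      \<comment> \<open>The power rule yields \<open>t ^ (j - 1)\<close> with subtraction on
        naturals, hence the separate small exponents.\<close>
      consider "j = 0" | "j = 1" | i where "j = Suc (Suc i)" by (metis One_nat_def not0_implies_Suc)
      then show ?thesis
        using 1 by cases (auto intro!: derivative_eq_intros simp: flat_exp_def divide_simps, auto simp: algebra_simps power_eq_if)
    qed
    then show ?thesis
      by (rule has_field_derivative_transform_within_open[where S="{0<..}"]) (use 1 in \<open>auto simp: flat_exp_def\<close>)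
  next
    case 2
    have "((\<lambda>t. 0) has_real_derivative flat_exp (j + 2) t - real j * flat_exp (j + 1) t) (at t)"
      using 2 by (simp add: flat_exp_def)
    then show ?thesis
      by (rule has_field_derivative_transform_within_open[where S="{..<0}"]) (use 2 in \<open>auto simp: flat_exp_def\<close>)
  next
    case 3
    have "((\<lambda>y. flat_exp j y / y) \<longlongrightarrow> 0) (at 0)"
    proof (rule filterlim_split_at)
      have "\<forall>\<^sub>F t::real in at_right 0. flat_exp (Suc j) t = flat_exp j t / t"
        by (rule eventually_at_right_less[THEN eventually_mono]) (simp add: flat_exp_def field_simps)
      then show "((\<lambda>y. flat_exp j y / y) \<longlongrightarrow> 0) (at_right 0)"
        by (rule Lim_transform_eventually[OF flat_exp_at_right_0])
      have "\<forall>\<^sub>F t::real in at_left 0. 0 = flat_exp j t / t"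
        by (simp add: eventually_at_filter flat_exp_def)
      then show "((\<lambda>y. flat_exp j y / y) \<longlongrightarrow> 0) (at_left 0)"
        by (rule Lim_transform_eventually[OF tendsto_const])
    qed
    then show ?thesis using 3 by (simp add: has_field_derivative_iff flat_exp_def)
  qed
qed

section \<open>Calculus of the classes \<open>Ck\<close>\<close>

lemma partial_deriv_eq: "(f has_derivative f') (at x) \<Longrightarrow> partial_deriv b f x = f' b"
  unfolding partial_deriv_def using frechet_derivative_at[of f f' x] by simp

lemma Ck_SucD: "Ck (Suc n) f \<Longrightarrow> Ck n f"
proof (induction n arbitrary: f)
  case 0 then show ?case by (auto intro: differentiable_imp_continuous_on)
qed simp

lemma Ck_const: "Ck n (\<lambda>x. c)"
proof (induction n arbitrary: c)
  case (Suc n)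
  have "partial_deriv b (\<lambda>x::'a. c) = (\<lambda>x. 0)" for b
    by (rule ext, subst partial_deriv_eq[where f'="\<lambda>_. 0"]) auto
  then show ?case using Suc by (simp add: differentiable_on_def)
qed simp

lemma partial_deriv_affine: "partial_deriv b (\<lambda>x. (x - z) \<bullet> a) = (\<lambda>x. b \<bullet> a)"
proof (rule ext)
  fix x
  have "((\<lambda>x. (x - z) \<bullet> a) has_derivative (\<lambda>v. v \<bullet> a)) (at x)"
    by (auto intro!: derivative_eq_intros)
  then show "partial_deriv b (\<lambda>x. (x - z) \<bullet> a) x = b \<bullet> a" by (rule partial_deriv_eq)
qed

lemma Ck_affine: "Ck n (\<lambda>x. (x - z) \<bullet> a)"
proof (cases n)
  case 0 then show ?thesis by (auto intro!: continuous_intros)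
next
  case (Suc n)
  have "(\<lambda>x. (x - z) \<bullet> a) differentiable_on UNIV"
    unfolding differentiable_on_def differentiable_def
    by (auto intro!: exI[of _ "\<lambda>v. v \<bullet> a"] derivative_eq_intros)
  then show ?thesis using Suc by (simp add: partial_deriv_affine Ck_const)
qed

text \<open>Sums and products share one induction, because the product rule turns a derivative of a
  product into a sum of products of lower order.\<close>

lemma Ck_add_mult:
  assumes "Ck n f" "Ck n g"
  shows "Ck n (\<lambda>x. f x + g x)" "Ck n (\<lambda>x. f x * g x)"
proof -
  have "Ck n (\<lambda>x. f x + g x) \<and> Ck n (\<lambda>x. f x * g x)"
    using assms
  proof (induction n arbitrary: f g)
    case 0 then show ?case by (auto intro!: continuous_intros)
  next
    case (Suc n)
    have d: "(f has_derivative frechet_derivative f (at x)) (at x)" "(g has_derivative frechet_derivative g (at x)) (at x)" for x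
      using Suc.prems by (auto simp: differentiable_on_def frechet_derivative_works)
    have 1: "partial_deriv b (\<lambda>x. f x + g x) = (\<lambda>x. partial_deriv b f x + partial_deriv b g x)" for b
      by (rule ext, subst partial_deriv_eq[OF has_derivative_add[OF d]]) (simp add: partial_deriv_def)
    have 2: "partial_deriv b (\<lambda>x. f x * g x) = (\<lambda>x. f x * partial_deriv b g x + partial_deriv b f x * g x)" for b
      by (rule ext, subst partial_deriv_eq[OF has_derivative_mult[OF d]]) (simp add: partial_deriv_def)
    show ?case
      using Suc.IH Suc.prems Ck_SucD[OF Suc.prems(1)] Ck_SucD[OF Suc.prems(2)]
      by (auto simp: 1 2 differentiable_on_def simp del: Ck.simps(1) intro!: differentiable_add differentiable_mult)
  qed
  then show "Ck n (\<lambda>x. f x + g x)" "Ck n (\<lambda>x. f x * g x)" by auto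
qed

text \<open>The squared norm keeps the composition smooth at the centre. The index is that of
  \<open>flat_exp\<close>, so derivatives of bumps are again combinations of bumps with affine
  factors.\<close>

definition bump :: "'a::euclidean_space \<Rightarrow> real \<Rightarrow> nat \<Rightarrow> 'a \<Rightarrow> real" where
  "bump z \<tau> j x = flat_exp j (1 - (norm (x - z))\<^sup>2 / \<tau>\<^sup>2)"

lemma has_derivative_bump:
  "(bump z \<tau> j has_derivative (\<lambda>v. (bump z \<tau> (j + 2) x - real j * bump z \<tau> (j + 1) x) * (- 2 * ((x - z) \<bullet> v) / \<tau>\<^sup>2))) (at x)"
proof -
  have "((\<lambda>x. 1 - inverse (\<tau>\<^sup>2) * ((x - z) \<bullet> (x - z))) has_derivative (\<lambda>v. - (inverse (\<tau>\<^sup>2) * (2 * ((x - z) \<bullet> v))))) (at x)"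
    by (auto intro!: derivative_eq_intros simp: inner_commute)
  from has_derivative_compose[OF this has_real_derivative_flat_exp[of j, unfolded has_field_derivative_def]]
  have "((\<lambda>x. flat_exp j (1 - inverse (\<tau>\<^sup>2) * ((x - z) \<bullet> (x - z)))) has_derivative
      (\<lambda>v. (bump z \<tau> (j + 2) x - real j * bump z \<tau> (j + 1) x) * (- (inverse (\<tau>\<^sup>2) * (2 * ((x - z) \<bullet> v)))))) (at x)"
    by (simp only: bump_def power2_norm_eq_inner divide_inverse mult.commute)
  moreover have "bump z \<tau> j = (\<lambda>x. flat_exp j (1 - inverse (\<tau>\<^sup>2) * ((x - z) \<bullet> (x - z))))"
    by (rule ext) (simp only: bump_def power2_norm_eq_inner divide_inverse mult.commute)
  ultimately show ?thesis by (simp add: divide_inverse mult_ac)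
qed

lemma partial_deriv_bump:
  "partial_deriv b (bump z \<tau> j) = (\<lambda>x. (bump z \<tau> (j + 2) x + (- real j) * bump z \<tau> (j + 1) x) * ((- 2 / \<tau>\<^sup>2) * ((x - z) \<bullet> b)))"
  by (rule ext) (simp add: partial_deriv_eq[OF has_derivative_bump])

lemma Ck_bump: "Ck n (bump z \<tau> j)"
proof (induction n arbitrary: j)
  case 0
  have "bump z \<tau> j differentiable_on UNIV"
    using has_derivative_bump unfolding differentiable_on_def differentiable_def by blast
  then show ?case by (simp add: differentiable_imp_continuous_on)
next
  case (Suc n)
  have "bump z \<tau> j differentiable_on UNIV"
    using has_derivative_bump unfolding differentiable_on_def differentiable_def by blast
  moreover have "Ck n (partial_deriv b (bump z \<tau> j))" for b
    unfolding partial_deriv_bump by (intro Ck_add_mult Ck_const Ck_affine Suc)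
  ultimately show ?case by simp
qed

lemma bump_nonneg: "0 \<le> bump z \<tau> j x" by (simp add: bump_def flat_exp_nonneg)

lemma bump_eq_0:
  assumes "\<tau> > 0" "x \<notin> ball z \<tau>"
  shows "bump z \<tau> j x = 0"
proof -
  have "\<tau>\<^sup>2 \<le> (norm (x - z))\<^sup>2"
    using assms by (intro power_mono) (auto simp: dist_norm norm_minus_commute)
  then show ?thesis using assms unfolding bump_def by (intro flat_exp_eq_0) simp
qed

lemma bump_pos:
  assumes "x \<in> ball z \<tau>"
  shows "0 < bump z \<tau> j x"
proof -
  have "norm (x - z) < \<tau>" using assms by (simp add: dist_norm norm_minus_commute)
  moreover from this have "0 < \<tau>" using norm_ge_zero[of "x - z"] by linarith
  ultimately have "(norm (x - z))\<^sup>2 / \<tau>\<^sup>2 < 1" using power_strict_mono[of "norm (x - z)" \<tau> 2] by simp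
  then show ?thesis unfolding bump_def by (intro flat_exp_pos) simp
qed

lemma test_function_bump:
  assumes "\<tau> > 0" "cball z \<tau> \<subseteq> U"
  shows "test_function U (\<lambda>x. c * bump z \<tau> j x)"
proof -
  have "{x. c * bump z \<tau> j x \<noteq> 0} \<subseteq> cball z \<tau>"
    using bump_eq_0[OF assms(1), of _ z j] ball_subset_cball[of z \<tau>] by fastforce
  then have cl: "closure {x. c * bump z \<tau> j x \<noteq> 0} \<subseteq> cball z \<tau>"
    by (simp add: closure_minimal)
  then have "compact (closure {x. c * bump z \<tau> j x \<noteq> 0})"
    using bounded_subset[OF bounded_cball cl] by (simp add: compact_eq_bounded_closed)
  then show ?thesis
    unfolding test_function_def using cl assms(2) by (intro conjI allI Ck_add_mult Ck_const Ck_bump) auto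
qed

section \<open>Reflections and test functions\<close>

lemma reflection_inner: "a \<bullet> reflection b x = reflection b a \<bullet> x"
  by (simp add: reflection_def inner_simps inner_commute)

lemma reflection_add: "reflection b (x + y) = reflection b x + reflection b y"
  by (simp add: reflection_def inner_add_right distrib_left add_divide_distrib scaleR_add_left)

lemma reflection_involution: "reflection b (reflection b x) = x"
proof (cases "b = 0")
  case False
  then show ?thesis
    by (simp add: reflection_def inner_simps power2_norm_eq_inner field_simps)
qed (simp add: reflection_def)

lemma norm_reflection: "norm (reflection b x) = norm x"
  by (simp add: norm_eq_sqrt_inner reflection_inner reflection_involution)

lemma reflection_self_inner: "b \<bullet> reflection b x = - (b \<bullet> x)"
  by (cases "b = 0") (simp_all add: reflection_def inner_simps power2_norm_eq_inner)

lemma reflection_fixed: "b \<bullet> x = 0 \<Longrightarrow> reflection b x = x"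
  by (simp add: reflection_def)

lemma continuous_on_reflection: "continuous_on S (reflection b)"
  unfolding reflection_def by (cases "b = 0") (auto intro!: continuous_intros)

lemma borel_measurable_reflection[measurable]: "reflection b \<in> borel_measurable borel"
  by (rule borel_measurable_continuous_onI[OF continuous_on_reflection])

lemma nn_integral_lborel_shift:
  fixes f :: "'a::euclidean_space \<Rightarrow> ennreal"
  assumes "f \<in> borel_measurable borel"
  shows "(\<integral>\<^sup>+x. f (x + t) \<partial>lborel) = (\<integral>\<^sup>+x. f x \<partial>lborel)"
proof -
  have "(\<integral>\<^sup>+x. f x \<partial>lborel) = (\<integral>\<^sup>+x. f x \<partial>distr lborel borel ((+) t))"
    by (simp add: lborel_distr_plus)
  also have "\<dots> = (\<integral>\<^sup>+x. f (t + x) \<partial>lborel)"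
    using assms by (intro nn_integral_distr) auto
  finally show ?thesis by (simp add: add.commute)
qed

text \<open>A convolution with the indicator of the unit ball, which is invariant under \<open>- reflection b\<close>,
  avoids both determinants and the uniqueness of Haar measure.\<close>

lemma lborel_distr_reflection:
  "distr lborel borel (reflection b) = (lborel :: 'a::euclidean_space measure)"
proof (rule measure_eqI)
  fix A assume "A \<in> sets (distr lborel borel (reflection b))"
  then have A[measurable]: "A \<in> sets borel" by simp
  let ?\<sigma> = "reflection b"
  define f :: "'a \<Rightarrow> ennreal" where "f = indicator A"
  define g :: "'a \<Rightarrow> ennreal" where "g = indicator (ball 0 1)"
  have [measurable]: "f \<in> borel_measurable borel" "g \<in> borel_measurable borel"
    by (simp_all add: f_def g_def borel_measurable_indicator)
  define N where "N = (\<integral>\<^sup>+y. g y \<partial>lborel)"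
  have N: "N = emeasure lborel (ball (0::'a) 1)" by (simp add: N_def g_def)
  have sym: "g (- ?\<sigma> x) = g x" for x by (simp add: g_def indicator_def norm_reflection)
  have neg: "?\<sigma> (x + ?\<sigma> y) = ?\<sigma> x + y" for x y by (simp add: reflection_add reflection_involution)
  \<comment> \<open>The chain shifts \<open>x\<close> by \<open>?\<sigma> y\<close>, then
    \<open>y\<close> by \<open>- ?\<sigma> x\<close>, and finally \<open>x\<close> by
    \<open>?\<sigma> y\<close> again, after which \<open>g\<close> no longer involves
    \<open>y\<close>. Only translation invariance is used; the finite nonzero factor
    \<open>N\<close> is cancelled at the end.\<close>
  have "(\<integral>\<^sup>+x. f (?\<sigma> x) \<partial>lborel) * N = (\<integral>\<^sup>+x. \<integral>\<^sup>+y. f (?\<sigma> x) * g y \<partial>lborel \<partial>lborel)"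
    unfolding N_def by (simp add: nn_integral_cmult nn_integral_multc)
  also have "\<dots> = (\<integral>\<^sup>+y. \<integral>\<^sup>+x. f (?\<sigma> x) * g y \<partial>lborel \<partial>lborel)"
    by (rule lborel_pair.Fubini') simp
  also have "\<dots> = (\<integral>\<^sup>+y. \<integral>\<^sup>+x. f (?\<sigma> x + y) * g y \<partial>lborel \<partial>lborel)"
    using nn_integral_lborel_shift[of "\<lambda>x. f (?\<sigma> x) * g y" "?\<sigma> y" for y] by (simp add: neg)
  also have "\<dots> = (\<integral>\<^sup>+x. \<integral>\<^sup>+y. f (?\<sigma> x + y) * g y \<partial>lborel \<partial>lborel)"
    by (rule lborel_pair.Fubini'[symmetric]) simp
  also have "\<dots> = (\<integral>\<^sup>+x. \<integral>\<^sup>+y. f y * g (y - ?\<sigma> x) \<partial>lborel \<partial>lborel)"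
    using nn_integral_lborel_shift[of "\<lambda>y. f (?\<sigma> x + y) * g y" "- ?\<sigma> x" for x] by simp
  also have "\<dots> = (\<integral>\<^sup>+y. \<integral>\<^sup>+x. f y * g (y - ?\<sigma> x) \<partial>lborel \<partial>lborel)"
    by (rule lborel_pair.Fubini'[symmetric]) simp
  also have "\<dots> = (\<integral>\<^sup>+y. f y * N \<partial>lborel)"
  proof (rule nn_integral_cong)
    fix y
    have "(\<integral>\<^sup>+x. f y * g (y - ?\<sigma> x) \<partial>lborel) = f y * (\<integral>\<^sup>+x. g (y - ?\<sigma> x) \<partial>lborel)"
      by (rule nn_integral_cmult) simp
    also have "(\<integral>\<^sup>+x. g (y - ?\<sigma> x) \<partial>lborel) = N"
      using nn_integral_lborel_shift[of "\<lambda>x. g (y - ?\<sigma> x)" "?\<sigma> y"] by (simp add: neg sym N_def)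
    finally show "(\<integral>\<^sup>+x. f y * g (y - ?\<sigma> x) \<partial>lborel) = f y * N" .
  qed
  also have "\<dots> = (\<integral>\<^sup>+y. f y \<partial>lborel) * N" by (simp add: nn_integral_multc)
  finally have "(\<integral>\<^sup>+x. f (?\<sigma> x) \<partial>lborel) * N = (\<integral>\<^sup>+y. f y \<partial>lborel) * N" .
  moreover have "N < \<infinity>" unfolding N by (rule emeasure_bounded_finite) simp
  moreover have "N \<noteq> 0"
    unfolding N using open_not_negligible[of "ball (0::'a) 1"]
    by (auto simp: negligible_iff_null_sets null_sets_def)
  ultimately have "(\<integral>\<^sup>+x. f (?\<sigma> x) \<partial>lborel) = (\<integral>\<^sup>+y. f y \<partial>lborel)"
    by (auto simp: ennreal_mult_cancel_left mult.commute[of _ N])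
  moreover have "(\<integral>\<^sup>+x. f (?\<sigma> x) \<partial>lborel) = (\<integral>\<^sup>+x. f x \<partial>distr lborel borel ?\<sigma>)"
    by (rule nn_integral_distr[symmetric]) auto
  ultimately show "emeasure (distr lborel borel ?\<sigma>) A = emeasure lborel A" by (simp add: f_def)
qed simp

lemma integral_antisymmetric_zero:
  fixes J :: "'a::euclidean_space \<Rightarrow> real"
  assumes "J \<in> borel_measurable borel" "\<And>x. J (reflection b x) = - J x"
  shows "(\<integral>x. J x \<partial>lborel) = 0"
proof -
  have "(\<integral>x. J x \<partial>lborel) = (\<integral>x. J x \<partial>distr lborel borel (reflection b))"
    by (simp add: lborel_distr_reflection)
  also have "\<dots> = (\<integral>x. J (reflection b x) \<partial>lborel)"
    using assms(1) by (intro integral_distr) auto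
  also have "\<dots> = - (\<integral>x. J x \<partial>lborel)" by (simp add: assms(2))
  finally show ?thesis by simp
qed

lemma AE_off_hyperplanes:
  assumes "finite R" "0 \<notin> R"
  shows "AE x in lborel. x \<in> off_hyperplanes R"
proof -
  have "AE x in lborel. \<forall>\<alpha>\<in>R. \<alpha> \<bullet> x \<noteq> 0"
  proof (subst AE_finite_all[OF assms(1)], intro ballI)
    fix \<alpha> assume "\<alpha> \<in> R"
    then have "negligible {x. \<alpha> \<bullet> x = 0}" using assms(2) by (intro negligible_hyperplane) auto
    then have "{x. \<alpha> \<bullet> x = 0} \<in> null_sets lborel"
      using closed_hyperplane[of \<alpha> 0] by (auto simp: negligible_iff_null_sets null_sets_def)
    from AE_not_in[OF this] show "AE x in lborel. \<alpha> \<bullet> x \<noteq> 0" by simp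
  qed
  then show ?thesis by (simp add: off_hyperplanes_def)
qed

lemma has_real_derivative_directional:
  assumes "f differentiable (at (x + t *\<^sub>R v))"
  shows "((\<lambda>t. f (x + t *\<^sub>R v)) has_real_derivative partial_deriv v f (x + t *\<^sub>R v)) (at t)"
proof -
  have "((\<lambda>t. x + t *\<^sub>R v) has_derivative (\<lambda>s. s *\<^sub>R v)) (at t)"
    by (auto intro!: derivative_eq_intros)
  from has_derivative_compose[OF this assms[unfolded frechet_derivative_works]]
  have "((\<lambda>t. f (x + t *\<^sub>R v)) has_derivative (\<lambda>s. frechet_derivative f (at (x + t *\<^sub>R v)) (s *\<^sub>R v))) (at t)" .
  moreover have "frechet_derivative f (at (x + t *\<^sub>R v)) (s *\<^sub>R v) = partial_deriv v f (x + t *\<^sub>R v) * s" for s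
    using linear_scale[OF linear_frechet_derivative[OF assms], of s v] by (simp add: partial_deriv_def mult.commute)
  ultimately show ?thesis by (simp add: has_field_derivative_def mult_commute_abs)
qed

lemma partial_deriv_grad:
  assumes "f differentiable (at x)"
  shows "partial_deriv v f x = grad f x \<bullet> v"
proof -
  have "partial_deriv v f x = frechet_derivative f (at x) (\<Sum>b\<in>Basis. (v \<bullet> b) *\<^sub>R b)"
    by (simp add: partial_deriv_def euclidean_representation)
  also have "\<dots> = (\<Sum>b\<in>Basis. (v \<bullet> b) * partial_deriv b f x)"
    by (simp add: partial_deriv_def linear_sum[OF linear_frechet_derivative[OF assms]]
        linear_scale[OF linear_frechet_derivative[OF assms]] o_def)
  finally show ?thesis by (simp add: grad_def inner_sum_left inner_sum_right inner_commute mult.commute)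
qed

lemma partial_deriv_zero_open:
  assumes "open S" "x \<in> S" "\<And>y. y \<in> S \<Longrightarrow> f y = 0"
  shows "partial_deriv b f x = 0"
proof (rule partial_deriv_eq[where f'="\<lambda>_. 0"])
  show "(f has_derivative (\<lambda>_. 0)) (at x)"
    by (rule has_derivative_transform_within_open[OF has_derivative_const[of 0] assms(1,2)]) (use assms(3) in auto)
qed

text \<open>Compactness leaves a gap between the support and the sphere. All integrals can thus be
  confined to a ball of radius \<open>\<rho> < r\<close>, on which profiles that are continuous on
  \<open>{0..<r}\<close> are bounded.\<close>

lemma test_functionE:
  assumes "test_function (ball 0 r) \<psi>" "r > 0"
  obtains \<rho> where "0 \<le> \<rho>" "\<rho> < r" "\<And>x. norm x > \<rho> \<Longrightarrow> \<psi> x = 0"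
    "\<And>x b. norm x > \<rho> \<Longrightarrow> partial_deriv b \<psi> x = 0"
    "\<And>x b c. norm x > \<rho> \<Longrightarrow> partial_deriv c (partial_deriv b \<psi>) x = 0"
proof -
  let ?S = "closure {x. \<psi> x \<noteq> 0}"
  have S: "compact ?S" "?S \<subseteq> ball 0 r" using assms(1) by (auto simp: test_function_def)
  obtain \<rho> where \<rho>: "0 \<le> \<rho>" "\<rho> < r" "\<And>x. x \<in> ?S \<Longrightarrow> norm x \<le> \<rho>"
  proof (cases "?S = {}")
    case True then show ?thesis using that[of 0] assms(2) by auto
  next
    case False
    obtain y where "y \<in> ?S" "\<And>x. x \<in> ?S \<Longrightarrow> norm x \<le> norm y"
      using continuous_attains_sup[OF S(1) False continuous_on_norm_id] by auto
    then show ?thesis using S(2) that[of "norm y"] by auto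
  qed
  have op: "open {x. norm (x::'a) > \<rho>}"
    by (intro open_Collect_less continuous_intros)
  have z: "\<psi> x = 0" if "norm x > \<rho>" for x
    using \<rho>(3)[of x] that closure_subset[of "{x. \<psi> x \<noteq> 0}"] by force
  have z1: "partial_deriv b \<psi> x = 0" if "norm x > \<rho>" for x b
    by (rule partial_deriv_zero_open[OF op]) (use that z in auto)
  have z2: "partial_deriv c (partial_deriv b \<psi>) x = 0" if "norm x > \<rho>" for x b c
    by (rule partial_deriv_zero_open[OF op]) (use that z1 in auto)
  show ?thesis using that \<rho>(1,2) z z1 z2 by blast
qed

lemma bounded_continuous_support:
  fixes f :: "'a::euclidean_space \<Rightarrow> real"
  assumes "continuous_on UNIV f" "\<And>x. norm x > \<rho> \<Longrightarrow> f x = 0"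
  obtains B where "0 \<le> B" "\<And>x. \<bar>f x\<bar> \<le> B"
proof -
  have "compact (f ` cball 0 \<rho>)"
    by (rule compact_continuous_image) (auto intro: continuous_on_subset[OF assms(1)])
  then have "\<exists>B. \<forall>x\<in>cball 0 \<rho>. \<bar>f x\<bar> \<le> B"
    using compact_imp_bounded[of "f ` cball 0 \<rho>"] unfolding bounded_iff by auto
  then obtain B where B: "\<And>x. x \<in> cball 0 \<rho> \<Longrightarrow> \<bar>f x\<bar> \<le> B" by blast
  show ?thesis
  proof (rule that[of "\<bar>B\<bar>"])
    show "\<bar>f x\<bar> \<le> \<bar>B\<bar>" for x using B[of x] assms(2)[of x] by (cases "norm x > \<rho>") auto
  qed simp
qed

lemma Ck_differentiable: "Ck (Suc n) f \<Longrightarrow> f differentiable (at x)"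
  by (simp add: differentiable_on_def)

lemma Ck_continuous: "Ck n f \<Longrightarrow> continuous_on UNIV f"
  by (induction n) (auto intro: differentiable_imp_continuous_on)

section \<open>Bounded functions and radial derivatives\<close>

text \<open>Introduced for its closure rules, which reduce the boundedness of the long integrands
  below to that of their factors.\<close>

definition bdd_fun_on :: "'a set \<Rightarrow> ('a \<Rightarrow> real) \<Rightarrow> bool" where
  "bdd_fun_on S f \<longleftrightarrow> (\<exists>B. \<forall>x\<in>S. \<bar>f x\<bar> \<le> B)"

lemma bdd_fun_onI: "(\<And>x. x \<in> S \<Longrightarrow> \<bar>f x\<bar> \<le> B) \<Longrightarrow> bdd_fun_on S f"
  by (auto simp: bdd_fun_on_def)

lemma bdd_fun_on_const: "bdd_fun_on S (\<lambda>x. c)" by (auto simp: bdd_fun_on_def)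

lemma bdd_fun_on_add: "bdd_fun_on S f \<Longrightarrow> bdd_fun_on S g \<Longrightarrow> bdd_fun_on S (\<lambda>x. f x + g x)"
proof -
  assume "bdd_fun_on S f" "bdd_fun_on S g"
  then obtain A B where "\<forall>x\<in>S. \<bar>f x\<bar> \<le> A" "\<forall>x\<in>S. \<bar>g x\<bar> \<le> B"
    unfolding bdd_fun_on_def by blast
  then have "\<bar>f x + g x\<bar> \<le> A + B" if "x \<in> S" for x
    using that abs_triangle_ineq[of "f x" "g x"] by force
  then show ?thesis by (rule bdd_fun_onI)
qed

lemma bdd_fun_on_mult: "bdd_fun_on S f \<Longrightarrow> bdd_fun_on S g \<Longrightarrow> bdd_fun_on S (\<lambda>x. f x * g x)"
proof -
  assume "bdd_fun_on S f" "bdd_fun_on S g"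
  then obtain A B where *: "\<forall>x\<in>S. \<bar>f x\<bar> \<le> A" "\<forall>x\<in>S. \<bar>g x\<bar> \<le> B"
    unfolding bdd_fun_on_def by blast
  have "\<bar>f x * g x\<bar> \<le> A * B" if "x \<in> S" for x
    unfolding abs_mult using *[rule_format, OF that] by (intro mult_mono) auto
  then show ?thesis by (rule bdd_fun_onI)
qed

lemma bdd_fun_on_minus: "bdd_fun_on S f \<Longrightarrow> bdd_fun_on S (\<lambda>x. - f x)"
  by (auto simp: bdd_fun_on_def)

lemma bdd_fun_on_diff: "bdd_fun_on S f \<Longrightarrow> bdd_fun_on S g \<Longrightarrow> bdd_fun_on S (\<lambda>x. f x - g x)"
  using bdd_fun_on_add[OF _ bdd_fun_on_minus, of S f g] by simp

lemma bdd_fun_on_sum: "(\<And>i. i \<in> I \<Longrightarrow> bdd_fun_on S (f i)) \<Longrightarrow> bdd_fun_on S (\<lambda>x. \<Sum>i\<in>I. f i x)"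
proof (induction I rule: infinite_finite_induct)
  case (insert i I) then show ?case using bdd_fun_on_add[of S "f i" "\<lambda>x. \<Sum>i\<in>I. f i x"] by simp
qed (simp_all add: bdd_fun_on_const)

lemma bdd_fun_on_compact:
  assumes "compact S" "continuous_on S f"
  shows "bdd_fun_on S f"
proof -
  have "bounded (f ` S)" using assms by (intro compact_imp_bounded compact_continuous_image)
  then show ?thesis by (auto simp: bdd_fun_on_def bounded_iff)
qed

lemma bdd_fun_on_abs_le:
  assumes "bdd_fun_on S g" "\<And>x. x \<in> S \<Longrightarrow> \<bar>f x\<bar> \<le> g x"
  shows "bdd_fun_on S f"
proof -
  obtain B where "\<forall>x\<in>S. \<bar>g x\<bar> \<le> B" using assms(1) unfolding bdd_fun_on_def ..
  then have "\<bar>f x\<bar> \<le> B" if "x \<in> S" for x using assms(2)[OF that] that by force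
  then show ?thesis by (rule bdd_fun_onI)
qed

lemma bdd_fun_on_radial:
  assumes "continuous_on {0..<r} V" "\<rho> < r"
  shows "bdd_fun_on (cball 0 \<rho>) (\<lambda>x::'a::euclidean_space. V (norm x))"
  by (rule bdd_fun_on_compact, simp, rule continuous_on_compose2[OF assms(1)])
    (use assms(2) in \<open>auto intro!: continuous_intros\<close>)

lemmas bdd_fun_on_intros = bdd_fun_on_const bdd_fun_on_add bdd_fun_on_mult bdd_fun_on_minus
  bdd_fun_on_diff bdd_fun_on_sum

lemma integrable_bdd_fun_on:
  fixes f :: "'a::euclidean_space \<Rightarrow> real"
  assumes "f \<in> borel_measurable borel" "bdd_fun_on (cball 0 \<rho>) f" "\<And>x. norm x > \<rho> \<Longrightarrow> f x = 0"
  shows "integrable lborel f"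
proof -
  obtain B where "\<forall>x\<in>cball 0 \<rho>. \<bar>f x\<bar> \<le> B" using assms(2) unfolding bdd_fun_on_def ..
  then show ?thesis using assms(1,3) by (intro integrable_bounded_cball[of f 0 \<rho>]) auto
qed

text \<open>Two applications of the mean value inequality, which give \<open>K\<close> in place of
  Taylor's \<open>K / 2\<close>.\<close>

lemma second_order_bound:
  fixes g :: "real \<Rightarrow> real"
  assumes g: "\<And>t. (g has_real_derivative g' t) (at t)" and g': "\<And>t. (g' has_real_derivative g'' t) (at t)"
    and K: "\<And>t. \<bar>g'' t\<bar> \<le> K"
  shows "\<bar>g h - g 0 - h * g' 0\<bar> \<le> K * h\<^sup>2"
proof -
  have K0: "K \<ge> 0" using K[of 0] by linarith
  have 1: "\<bar>g' t - g' 0\<bar> \<le> K * \<bar>t\<bar>" for t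
    using field_differentiable_bound[of UNIV g' g'' K t 0] g' K by simp
  have "norm ((g h - h * g' 0) - (g 0 - 0 * g' 0)) \<le> (K * \<bar>h\<bar>) * norm (h - 0)"
  proof (rule field_differentiable_bound[where S="cball 0 \<bar>h\<bar>" and f="\<lambda>t. g t - t * g' 0" and f'="\<lambda>t. g' t - g' 0"])
    show "((\<lambda>t. g t - t * g' 0) has_real_derivative g' t - g' 0) (at t within cball 0 \<bar>h\<bar>)" for t
      by (rule has_field_derivative_at_within) (auto intro!: derivative_eq_intros g)
    show "norm (g' t - g' 0) \<le> K * \<bar>h\<bar>" if "t \<in> cball 0 \<bar>h\<bar>" for t
      using 1[of t] that K0 by (auto simp: dist_norm intro: order_trans mult_left_mono)
  qed auto
  then show ?thesis by (simp add: power2_eq_square abs_mult_self_eq mult.assoc algebra_simps)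
qed

text \<open>The contribution of one root, without its multiplicity. On the hyperplane of \<alpha>
  division by zero makes it 0.\<close>

definition dunkl_part :: "('a::euclidean_space \<Rightarrow> real) \<Rightarrow> 'a \<Rightarrow> 'a \<Rightarrow> real" where
  "dunkl_part u \<alpha> x = (grad u x \<bullet> \<alpha>) / (\<alpha> \<bullet> x)
        - (norm \<alpha>)\<^sup>2 / 2 * ((u x - u (reflection \<alpha> x)) / (\<alpha> \<bullet> x)\<^sup>2)"

text \<open>Each of the two quotients is singular at the hyperplane. But with
  \<open>s = \<alpha> \<bullet> x\<close> the reflected point is
  \<open>x - h *\<^sub>R \<alpha>\<close>, where \<open>h = 2 * s / (norm \<alpha>)\<^sup>2\<close>,
  and the difference of the quotients is \<open>(norm \<alpha>)\<^sup>2 / (2 * s\<^sup>2)\<close>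
  times the second-order Taylor remainder of \<psi> along this segment. The remainder is at most
  \<open>K * h\<^sup>2\<close>, which cancels the square of \<open>s\<close>.\<close>

lemma dunkl_part_bounded:
  fixes \<psi> :: "'a::euclidean_space \<Rightarrow> real"
  assumes C2: "Ck (Suc (Suc 0)) \<psi>" and B: "\<And>b c x. b \<in> Basis \<Longrightarrow> c \<in> Basis \<Longrightarrow> \<bar>partial_deriv c (partial_deriv b \<psi>) x\<bar> \<le> B"
    and \<alpha>: "\<alpha> \<noteq> 0"
  obtains M where "\<And>x. \<bar>dunkl_part \<psi> \<alpha> x\<bar> \<le> M"
proof -
  define K where "K = (\<Sum>b\<in>Basis. \<Sum>c\<in>Basis. \<bar>\<alpha> \<bullet> b\<bar> * (\<bar>\<alpha> \<bullet> c\<bar> * B))"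
  have d0: "\<psi> differentiable (at y)" for y using C2 by (rule Ck_differentiable)
  have d1: "partial_deriv b \<psi> differentiable (at y)" if "b \<in> Basis" for b y
    using C2 that by (intro Ck_differentiable[of 0]) simp
  have "\<bar>dunkl_part \<psi> \<alpha> x\<bar> \<le> 2 * K / (norm \<alpha>)\<^sup>2" for x
  proof (cases "\<alpha> \<bullet> x = 0")
    case True
    have "0 \<le> B" using B[of "SOME b. b \<in> Basis" "SOME b. b \<in> Basis" 0] nonempty_Basis
      by (metis abs_ge_zero order_trans some_in_eq)
    then have "0 \<le> K" unfolding K_def by (intro sum_nonneg mult_nonneg_nonneg) auto
    then show ?thesis using True by (simp add: dunkl_part_def)
  next
    case False
    define s where "s = \<alpha> \<bullet> x"
    define h where "h = 2 * s / (norm \<alpha>)\<^sup>2"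
    define g where "g = (\<lambda>t. \<psi> (x + t *\<^sub>R (- \<alpha>)))"
    define g' where "g' = (\<lambda>t. - (\<Sum>b\<in>Basis. (\<alpha> \<bullet> b) * partial_deriv b \<psi> (x + t *\<^sub>R (- \<alpha>))))"
    define g'' where "g'' = (\<lambda>t. - (\<Sum>b\<in>Basis. (\<alpha> \<bullet> b) * partial_deriv (- \<alpha>) (partial_deriv b \<psi>) (x + t *\<^sub>R (- \<alpha>))))"
    have pd: "partial_deriv (- \<alpha>) F y = - (\<Sum>c\<in>Basis. (\<alpha> \<bullet> c) * partial_deriv c F y)"
      if "F differentiable (at y)" for F y
    proof -
      have "grad F y \<bullet> (- \<alpha>) = - (\<Sum>c\<in>Basis. (\<alpha> \<bullet> c) * partial_deriv c F y)"
        by (simp add: grad_def inner_sum_left, simp add: inner_commute mult.commute)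
      then show ?thesis by (simp only: partial_deriv_grad[OF that])
    qed
    have "partial_deriv (- \<alpha>) \<psi> (x + t *\<^sub>R (- \<alpha>)) = g' t" for t
      by (simp only: pd[OF d0] g'_def)
    then have dg: "(g has_real_derivative g' t) (at t)" for t
      using has_real_derivative_directional[where x=x and t=t and v="- \<alpha>", OF d0] by (simp add: g_def)
    have dg': "(g' has_real_derivative g'' t) (at t)" for t
      unfolding g'_def g''_def
      by (intro DERIV_minus DERIV_sum DERIV_cmult has_real_derivative_directional d1)
    have "\<bar>g'' t\<bar> \<le> K" for t
    proof -
      have g2: "g'' t = (\<Sum>b\<in>Basis. \<Sum>c\<in>Basis. (\<alpha> \<bullet> b) * ((\<alpha> \<bullet> c) * partial_deriv c (partial_deriv b \<psi>) (x + t *\<^sub>R (- \<alpha>))))"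
        unfolding g''_def sum_negf[symmetric] by (rule sum.cong) (simp_all only: pd[OF d1] sum_distrib_left mult_minus_right minus_minus)
      have "\<bar>g'' t\<bar> \<le> (\<Sum>b\<in>Basis. \<bar>\<Sum>c\<in>Basis. (\<alpha> \<bullet> b) * ((\<alpha> \<bullet> c) * partial_deriv c (partial_deriv b \<psi>) (x + t *\<^sub>R (- \<alpha>)))\<bar>)"
        unfolding g2 by (rule sum_abs)
      also have "\<dots> \<le> K" unfolding K_def
      proof (rule sum_mono)
        fix b :: 'a assume b: "b \<in> Basis"
        show "\<bar>\<Sum>c\<in>Basis. (\<alpha> \<bullet> b) * ((\<alpha> \<bullet> c) * partial_deriv c (partial_deriv b \<psi>) (x + t *\<^sub>R (- \<alpha>)))\<bar>
           \<le> (\<Sum>c\<in>Basis. \<bar>\<alpha> \<bullet> b\<bar> * (\<bar>\<alpha> \<bullet> c\<bar> * B))"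
        proof (rule order_trans[OF sum_abs sum_mono])
          fix c :: 'a assume c: "c \<in> Basis"
          show "\<bar>(\<alpha> \<bullet> b) * ((\<alpha> \<bullet> c) * partial_deriv c (partial_deriv b \<psi>) (x + t *\<^sub>R (- \<alpha>)))\<bar> \<le> \<bar>\<alpha> \<bullet> b\<bar> * (\<bar>\<alpha> \<bullet> c\<bar> * B)"
            unfolding abs_mult by (intro mult_left_mono abs_ge_zero B b c)
        qed
      qed
      finally show ?thesis .
    qed
    from second_order_bound[OF dg dg' this] have e: "\<bar>g h - g 0 - h * g' 0\<bar> \<le> K * h\<^sup>2" .
    have gh: "g h = \<psi> (reflection \<alpha> x)" by (simp add: g_def reflection_def h_def s_def)
    have g0: "g 0 = \<psi> x" by (simp add: g_def)
    have g'0: "g' 0 = - (grad \<psi> x \<bullet> \<alpha>)"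
      by (simp add: g'_def grad_def inner_sum_left, simp add: inner_commute mult.commute)
    have s: "s \<noteq> 0" using False by (simp add: s_def)
    have n: "(norm \<alpha>)\<^sup>2 > 0" using \<alpha> by simp
    have eq: "dunkl_part \<psi> \<alpha> x = (norm \<alpha>)\<^sup>2 / (2 * s\<^sup>2) * (g h - g 0 - h * g' 0)"
    proof -
      have "(norm \<alpha>)\<^sup>2 / (2 * s\<^sup>2) * (h * g' 0) = g' 0 / s"
        using s \<alpha> by (simp add: h_def power2_eq_square)
      moreover have "(norm \<alpha>)\<^sup>2 / (2 * s\<^sup>2) * (g h - g 0 - h * g' 0)
          = (norm \<alpha>)\<^sup>2 / (2 * s\<^sup>2) * (g h - g 0) - (norm \<alpha>)\<^sup>2 / (2 * s\<^sup>2) * (h * g' 0)"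
        by (rule right_diff_distrib)
      moreover have "(norm \<alpha>)\<^sup>2 / 2 * ((g 0 - g h) / s\<^sup>2) = - ((norm \<alpha>)\<^sup>2 / (2 * s\<^sup>2) * (g h - g 0))"
        by (simp add: diff_divide_distrib right_diff_distrib left_diff_distrib)
      ultimately show ?thesis
        unfolding dunkl_part_def s_def[symmetric] gh[symmetric] g0[symmetric] using g'0 by simp
    qed
    have "\<bar>dunkl_part \<psi> \<alpha> x\<bar> \<le> (norm \<alpha>)\<^sup>2 / (2 * s\<^sup>2) * (K * h\<^sup>2)"
      unfolding eq abs_mult using e by (intro mult_mono) auto
    also have "\<dots> = 2 * K / (norm \<alpha>)\<^sup>2"
      using s \<alpha> by (simp add: h_def power2_eq_square)
    finally show ?thesis .
  qed
  then show ?thesis by (rule that)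
qed

text \<open>On a line through the origin a radial function depends on the absolute value of the
  parameter; this filter turns one-sided limits at 0 into two-sided ones.\<close>

lemma filterlim_abs_at_0:
  assumes "0 < r"
  shows "filterlim (\<lambda>t::real. \<bar>t\<bar>) (at 0 within {0..<r}) (at 0)"
  unfolding filterlim_at
proof
  show "\<forall>\<^sub>F t in at 0. \<bar>t\<bar> \<in> {0..<r} \<and> \<bar>t::real\<bar> \<noteq> 0"
    using assms by (auto simp: eventually_at dist_norm intro!: exI[of _ r])
  show "((\<lambda>t::real. \<bar>t\<bar>) \<longlongrightarrow> 0) (at 0)" by (auto intro!: tendsto_eq_intros)
qed

lemma has_real_derivative_norm_line:
  fixes x b :: "'a::euclidean_space"
  assumes "x \<noteq> 0"
  shows "((\<lambda>t. norm (x + t *\<^sub>R b)) has_real_derivative (x \<bullet> b) / norm x) (at 0)"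
proof -
  have "((\<lambda>t. x + t *\<^sub>R b) has_derivative (\<lambda>s. s *\<^sub>R b)) (at 0)"
    by (auto intro!: derivative_eq_intros)
  from has_derivative_compose[OF this, of norm "\<lambda>h. h \<bullet> sgn x"]
  have "((\<lambda>t. norm (x + t *\<^sub>R b)) has_derivative (\<lambda>s. (s *\<^sub>R b) \<bullet> sgn x)) (at 0)"
    using has_derivative_norm[OF assms] by simp
  moreover have "(\<lambda>s. (s *\<^sub>R b) \<bullet> sgn x) = (*) ((x \<bullet> b) / norm x)"
    by (auto simp: fun_eq_iff sgn_div_norm inner_commute divide_inverse)
  ultimately show ?thesis by (simp only: has_field_derivative_def)
qed

text \<open>Prescribing the derivative as \<open>s * Q s\<close> makes the gradient
  \<open>Q (norm x) *\<^sub>R x\<close>, without a division by the norm, so that the origin is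
  included.\<close>

lemma has_real_derivative_radial:
  fixes x b :: "'a::euclidean_space"
  assumes V: "\<And>s. s \<in> {0..<r} \<Longrightarrow> (V has_real_derivative s * Q s) (at s within {0..<r})"
    and x: "norm x < r" and b: "b \<in> Basis"
  shows "((\<lambda>t. V (norm (x + t *\<^sub>R b))) has_real_derivative Q (norm x) * (x \<bullet> b)) (at 0)"
proof (cases "x = 0")
  case False
  note n = has_real_derivative_norm_line[OF False, of b]
  have "(V has_real_derivative norm x * Q (norm x)) (at (norm x))"
    using V[of "norm x"] x False at_within_interior[of "norm x" "{0..<r}"] by simp
  from DERIV_chain2[OF _ n, of V "norm x * Q (norm x)"] this False show ?thesis
    by simp
next
  case True
  have r: "0 < r" using x True by simp
  have "((\<lambda>y. (V y - V 0) / (y - 0)) \<longlongrightarrow> 0) (at 0 within {0..<r})"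
    using V[of 0] r unfolding has_field_derivative_iff by simp
  then have "((\<lambda>t. (V \<bar>t\<bar> - V 0) / (\<bar>t\<bar> - 0)) \<longlongrightarrow> 0) (at 0)"
    by (rule filterlim_compose[OF _ filterlim_abs_at_0[OF r]])
  then have "((\<lambda>t. \<bar>(V \<bar>t\<bar> - V 0) / t\<bar>) \<longlongrightarrow> 0) (at 0)"
    using tendsto_rabs_zero by fastforce
  then have "((\<lambda>t. (V \<bar>t\<bar> - V 0) / t) \<longlongrightarrow> 0) (at 0)" by (rule tendsto_rabs_zero_cancel)
  then show ?thesis using True b by (simp add: has_field_derivative_iff)
qed

text \<open>Away from the origin the sum over the basis is
  \<open>DIM('a) * Q + Z - \<mu> * Q\<close>; when \<open>\<mu>\<close> is the homogeneous
  dimension, the missing multiplicities come from the derivative of the weight. At the origin the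
  quotient is 0 by convention, and continuity of \<open>Q\<close> alone gives the derivative
  \<open>Q 0\<close>.\<close>

lemma has_real_derivative_radial_gradient:
  fixes x b :: "'a::euclidean_space"
  assumes Q: "\<And>s. 0 < s \<Longrightarrow> s < r \<Longrightarrow> (Q has_real_derivative (Z s - \<mu> * Q s) / s) (at s)"
    and contQ: "continuous_on {0..<r} Q" and x: "norm x < r" and b: "b \<in> Basis"
  shows "((\<lambda>t. Q (norm (x + t *\<^sub>R b)) * ((x + t *\<^sub>R b) \<bullet> b)) has_real_derivative
    Q (norm x) + (x \<bullet> b)\<^sup>2 * (Z (norm x) - \<mu> * Q (norm x)) / (norm x)\<^sup>2) (at 0)"
proof (cases "x = 0")
  case False
  note n = has_real_derivative_norm_line[OF False, of b]
  have l: "((\<lambda>t. (x + t *\<^sub>R b) \<bullet> b) has_real_derivative 1) (at 0)"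
    using b by (auto intro!: derivative_eq_intros simp: inner_simps)
  have "((\<lambda>t. Q (norm (x + t *\<^sub>R b))) has_real_derivative (Z (norm x) - \<mu> * Q (norm x)) / norm x * ((x \<bullet> b) / norm x)) (at 0)"
    by (rule DERIV_chain2[OF _ n]) (use Q[of "norm x"] x False in simp)
  from DERIV_mult[OF this l] show ?thesis
    by (simp add: power2_eq_square field_simps)
next
  case True
  have r: "0 < r" using x True by simp
  have "(Q \<longlongrightarrow> Q 0) (at 0 within {0..<r})" using contQ r by (simp add: continuous_on_def)
  then have "((\<lambda>t. Q \<bar>t\<bar>) \<longlongrightarrow> Q 0) (at 0)"
    by (rule filterlim_compose[OF _ filterlim_abs_at_0[OF r]])
  then have "((\<lambda>t. (Q \<bar>t\<bar> * t - 0) / (t - 0)) \<longlongrightarrow> Q 0) (at 0)"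
    by (rule Lim_transform_eventually) (simp add: eventually_at_filter)
  then show ?thesis using True b by (simp add: has_field_derivative_iff inner_simps)
qed

section \<open>The Dunkl Laplacian and its regularised weight\<close>

lemma
  assumes "test_function U \<psi>"
  shows test_function_differentiable: "\<psi> differentiable (at x)"
    and test_function_differentiable2: "b \<in> Basis \<Longrightarrow> partial_deriv b \<psi> differentiable (at x)"
    and test_function_borel: "\<psi> \<in> borel_measurable borel"
    and test_function_partial_borel: "b \<in> Basis \<Longrightarrow> partial_deriv b \<psi> \<in> borel_measurable borel"
    and test_function_grad_borel: "grad \<psi> \<in> borel_measurable borel"
    and test_function_laplacian_borel: "laplacian \<psi> \<in> borel_measurable borel"
    and test_function_dunkl_part_borel: "dunkl_part \<psi> \<alpha> \<in> borel_measurable borel"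
proof -
  have C: "Ck n \<psi>" for n using assms by (simp add: test_function_def)
  have C1: "Ck n (partial_deriv b \<psi>)" if "b \<in> Basis" for n b using C[of "Suc n"] that by simp
  have C2: "Ck n (partial_deriv c (partial_deriv b \<psi>))" if "b \<in> Basis" "c \<in> Basis" for n b c
    using C1[of b "Suc n"] that by simp
  show "\<psi> differentiable (at x)" by (rule Ck_differentiable[OF C])
  show "b \<in> Basis \<Longrightarrow> partial_deriv b \<psi> differentiable (at x)" by (rule Ck_differentiable[OF C1])
  show [measurable]: "\<psi> \<in> borel_measurable borel"
    by (rule borel_measurable_continuous_onI[OF Ck_continuous[OF C]])
  show 1: "partial_deriv b \<psi> \<in> borel_measurable borel" if "b \<in> Basis" for b
    by (rule borel_measurable_continuous_onI[OF Ck_continuous[OF C1[OF that]]])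
  show [measurable]: "grad \<psi> \<in> borel_measurable borel"
    unfolding grad_def[abs_def] by (intro borel_measurable_sum borel_measurable_scaleR borel_measurable_const 1)
  show "laplacian \<psi> \<in> borel_measurable borel"
    unfolding laplacian_def[abs_def]
    by (intro borel_measurable_sum borel_measurable_continuous_onI[OF Ck_continuous[OF C2]])
  show "dunkl_part \<psi> \<alpha> \<in> borel_measurable borel"
    unfolding dunkl_part_def[abs_def] by measurable
qed

lemma
  assumes "test_function (ball 0 r) \<psi>" "r > 0"
  shows test_function_bdd: "bdd_fun_on S \<psi>"
    and test_function_partial_bdd: "b \<in> Basis \<Longrightarrow> bdd_fun_on S (partial_deriv b \<psi>)"
    and test_function_partial2_bdd: "b \<in> Basis \<Longrightarrow> c \<in> Basis \<Longrightarrow> bdd_fun_on S (partial_deriv c (partial_deriv b \<psi>))"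
    and test_function_laplacian_bdd: "bdd_fun_on S (laplacian \<psi>)"
    and test_function_dunkl_part_bdd: "\<alpha> \<noteq> 0 \<Longrightarrow> bdd_fun_on S (dunkl_part \<psi> \<alpha>)"
proof -
  have C: "Ck n \<psi>" for n using assms by (simp add: test_function_def)
  have C1: "Ck n (partial_deriv b \<psi>)" if "b \<in> Basis" for n b using C[of "Suc n"] that by simp
  have C2: "Ck n (partial_deriv c (partial_deriv b \<psi>))" if "b \<in> Basis" "c \<in> Basis" for n b c
    using C1[of b "Suc n"] that by simp
  obtain \<rho> where \<rho>: "\<And>x. norm x > \<rho> \<Longrightarrow> \<psi> x = 0" "\<And>x b. norm x > \<rho> \<Longrightarrow> partial_deriv b \<psi> x = 0"
    "\<And>x b c. norm x > \<rho> \<Longrightarrow> partial_deriv c (partial_deriv b \<psi>) x = 0"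
    using test_functionE[OF assms] by metis
  show "bdd_fun_on S \<psi>"
    using bounded_continuous_support[OF Ck_continuous[OF C] \<rho>(1)] by (metis bdd_fun_onI)
  show "bdd_fun_on S (partial_deriv b \<psi>)" if "b \<in> Basis" for b
    using bounded_continuous_support[OF Ck_continuous[OF C1[OF that]] \<rho>(2)] by (metis bdd_fun_onI)
  have B2: "bdd_fun_on S (partial_deriv c (partial_deriv b \<psi>))" if "b \<in> Basis" "c \<in> Basis" for b c S
    using bounded_continuous_support[OF Ck_continuous[OF C2[OF that]] \<rho>(3)] by (metis bdd_fun_onI)
  show "b \<in> Basis \<Longrightarrow> c \<in> Basis \<Longrightarrow> bdd_fun_on S (partial_deriv c (partial_deriv b \<psi>))" by (rule B2)
  show "bdd_fun_on S (laplacian \<psi>)"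
    unfolding laplacian_def[abs_def] by (intro bdd_fun_on_sum B2)
  show "bdd_fun_on S (dunkl_part \<psi> \<alpha>)" if \<alpha>: "\<alpha> \<noteq> 0"
  proof -
    have "\<forall>b\<in>Basis. \<forall>c\<in>Basis. \<exists>B. \<forall>x. \<bar>partial_deriv c (partial_deriv b \<psi>) x\<bar> \<le> B"
      using B2[of _ _ UNIV] by (simp add: bdd_fun_on_def)
    then obtain B where B: "\<And>b c x. b \<in> Basis \<Longrightarrow> c \<in> Basis \<Longrightarrow> \<bar>partial_deriv c (partial_deriv b \<psi>) x\<bar> \<le> B b c"
      by metis
    have "\<bar>partial_deriv c (partial_deriv b \<psi>) x\<bar> \<le> (\<Sum>b\<in>Basis. \<Sum>c\<in>Basis. B b c)" if bc: "b \<in> Basis" "c \<in> Basis" for b c x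
    proof -
      have pos: "0 \<le> B b c" if "b \<in> Basis" "c \<in> Basis" for b c
        using B[OF that, of 0] by linarith
      have "\<bar>partial_deriv c (partial_deriv b \<psi>) x\<bar> \<le> B b c" using B bc by blast
      also have "\<dots> \<le> (\<Sum>c\<in>Basis. B b c)"
        by (rule member_le_sum[OF bc(2)]) (use pos bc in auto)
      also have "\<dots> \<le> (\<Sum>b\<in>Basis. \<Sum>c\<in>Basis. B b c)"
        by (rule member_le_sum[OF bc(1)]) (use pos in \<open>auto intro: sum_nonneg\<close>)
      finally show ?thesis .
    qed
    from dunkl_part_bounded[OF C this \<alpha>] show ?thesis by (metis bdd_fun_onI)
  qed
qed

lemma
  assumes "\<And>x. norm x > \<rho> \<Longrightarrow> \<psi> x = 0" "\<And>x b. norm x > \<rho> \<Longrightarrow> partial_deriv b \<psi> x = 0"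
    "\<And>x b c. norm x > \<rho> \<Longrightarrow> partial_deriv c (partial_deriv b \<psi>) x = 0" "norm x > \<rho>"
  shows laplacian_zero_outside: "laplacian \<psi> x = 0"
    and dunkl_part_zero_outside: "dunkl_part \<psi> \<alpha> x = 0"
proof -
  have "grad \<psi> x = 0" by (simp add: grad_def assms(2,4))
  then show "dunkl_part \<psi> \<alpha> x = 0" by (simp add: dunkl_part_def assms(1,4) norm_reflection)
  show "laplacian \<psi> x = 0" by (simp add: laplacian_def assms(3,4))
qed

locale dunkl =
  fixes R :: "'a::euclidean_space set" and k :: "'a \<Rightarrow> real"
  assumes root_system: "root_system R" and multiplicity: "positive_multiplicity R k"
begin

text \<open>The degree of homogeneity of the measure with density \<open>w\<close>.\<close>

definition hom_dim :: real where "hom_dim = real DIM('a) + (\<Sum>\<alpha>\<in>R. k \<alpha>)"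

abbreviation w :: "'a \<Rightarrow> real" where "w \<equiv> dunkl_weight R k"

lemma finite_R: "finite R" and zero_notin_R: "0 \<notin> R" and k_pos: "\<alpha> \<in> R \<Longrightarrow> k \<alpha> > 0"
  and k_reflection: "\<beta> \<in> R \<Longrightarrow> \<alpha> \<in> R \<Longrightarrow> k (reflection \<beta> \<alpha>) = k \<alpha>"
  and reflection_image: "\<beta> \<in> R \<Longrightarrow> reflection \<beta> ` R = R"
  using root_system multiplicity by (auto simp: root_system_def positive_multiplicity_def)

lemma R_nonzero: "\<alpha> \<in> R \<Longrightarrow> \<alpha> \<noteq> 0" using zero_notin_R by blast

lemma bij_betw_reflection: "\<beta> \<in> R \<Longrightarrow> bij_betw (reflection \<beta>) R R"
  unfolding bij_betw_def using reflection_image reflection_involution by (metis inj_on_def)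

text \<open>Here \<open>\<bar>\<alpha> \<bullet> x\<bar>\<close> is smoothed to the square root of
  \<open>(\<alpha> \<bullet> x)\<^sup>2 + \<delta>\<^sup>2\<close>, since \<open>w\<close> itself
  need not be differentiable on the hyperplanes. The exponential form makes the logarithmic
  derivative a sum over the roots.\<close>

definition reg_weight :: "real \<Rightarrow> 'a \<Rightarrow> real" where
  "reg_weight \<delta> x = exp (\<Sum>\<alpha>\<in>R. k \<alpha> / 2 * ln ((\<alpha> \<bullet> x)\<^sup>2 + \<delta>\<^sup>2))"

lemma reg_weight_pos: "0 < reg_weight \<delta> x" by (simp add: reg_weight_def)

text \<open>A reflection in a root permutes \<open>R\<close> and preserves \<open>k\<close>, so it
  only reorders the sum.\<close>

lemma reg_weight_reflection: "\<beta> \<in> R \<Longrightarrow> reg_weight \<delta> (reflection \<beta> x) = reg_weight \<delta> x"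
  unfolding reg_weight_def
  by (subst (2) sum.reindex_bij_betw[OF bij_betw_reflection, symmetric])
    (auto simp: k_reflection reflection_inner intro!: sum.cong)

lemma continuous_on_reg_weight: "\<delta> > 0 \<Longrightarrow> continuous_on S (reg_weight \<delta>)"
  unfolding reg_weight_def
  by (intro continuous_intros ballI) (metis add_nonneg_pos zero_le_power2 zero_less_power less_irrefl)

lemma has_real_derivative_reg_weight:
  assumes "\<delta> > 0"
  shows "((\<lambda>t. reg_weight \<delta> (x + t *\<^sub>R b)) has_real_derivative
    reg_weight \<delta> x * (\<Sum>\<alpha>\<in>R. k \<alpha> * ((\<alpha> \<bullet> x) * (\<alpha> \<bullet> b) / ((\<alpha> \<bullet> x)\<^sup>2 + \<delta>\<^sup>2)))) (at 0)"
proof -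
  have "((\<lambda>t. k \<alpha> / 2 * ln ((\<alpha> \<bullet> (x + t *\<^sub>R b))\<^sup>2 + \<delta>\<^sup>2)) has_real_derivative
      k \<alpha> * ((\<alpha> \<bullet> x) * (\<alpha> \<bullet> b) / ((\<alpha> \<bullet> x)\<^sup>2 + \<delta>\<^sup>2))) (at 0)" for \<alpha>
  proof -
    have "(\<alpha> \<bullet> x)\<^sup>2 + \<delta>\<^sup>2 > 0" using assms by (simp add: add_nonneg_pos)
    then have "(ln has_real_derivative inverse ((\<alpha> \<bullet> x)\<^sup>2 + \<delta>\<^sup>2)) (at ((\<alpha> \<bullet> (x + 0 *\<^sub>R b))\<^sup>2 + \<delta>\<^sup>2))"
      using DERIV_ln[of "(\<alpha> \<bullet> x)\<^sup>2 + \<delta>\<^sup>2"] by simp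
    moreover have "((\<lambda>t. (\<alpha> \<bullet> (x + t *\<^sub>R b))\<^sup>2 + \<delta>\<^sup>2) has_real_derivative 2 * ((\<alpha> \<bullet> x) * (\<alpha> \<bullet> b))) (at 0)"
      by (auto intro!: derivative_eq_intros simp: inner_simps)
    ultimately have "((\<lambda>t. ln ((\<alpha> \<bullet> (x + t *\<^sub>R b))\<^sup>2 + \<delta>\<^sup>2)) has_real_derivative
        inverse ((\<alpha> \<bullet> x)\<^sup>2 + \<delta>\<^sup>2) * (2 * ((\<alpha> \<bullet> x) * (\<alpha> \<bullet> b)))) (at 0)"
      by (rule DERIV_chain2)
    then have "((\<lambda>t. k \<alpha> / 2 * ln ((\<alpha> \<bullet> (x + t *\<^sub>R b))\<^sup>2 + \<delta>\<^sup>2)) has_real_derivative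
        k \<alpha> / 2 * (inverse ((\<alpha> \<bullet> x)\<^sup>2 + \<delta>\<^sup>2) * (2 * ((\<alpha> \<bullet> x) * (\<alpha> \<bullet> b))))) (at 0)"
      by (rule DERIV_cmult)
    moreover have "k \<alpha> / 2 * (inverse D * (2 * P)) = k \<alpha> * (P / D)" for D P :: real
      by (cases "D = 0") (simp_all add: field_simps)
    ultimately show ?thesis by (simp only:)
  qed
  then have "((\<lambda>t. \<Sum>\<alpha>\<in>R. k \<alpha> / 2 * ln ((\<alpha> \<bullet> (x + t *\<^sub>R b))\<^sup>2 + \<delta>\<^sup>2)) has_real_derivative
      (\<Sum>\<alpha>\<in>R. k \<alpha> * ((\<alpha> \<bullet> x) * (\<alpha> \<bullet> b) / ((\<alpha> \<bullet> x)\<^sup>2 + \<delta>\<^sup>2)))) (at 0)"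
    by (rule DERIV_sum)
  from DERIV_fun_exp[OF this] show ?thesis by (simp add: reg_weight_def)
qed

text \<open>Provides a majorant independent of \<delta> for the passage to the limit.\<close>

lemma reg_weight_mono: "0 < \<delta> \<Longrightarrow> \<delta> \<le> 1 \<Longrightarrow> reg_weight \<delta> x \<le> reg_weight 1 x"
  unfolding reg_weight_def
proof (subst exp_le_cancel_iff, intro sum_mono mult_left_mono)
  fix \<alpha> assume \<delta>: "0 < \<delta>" "\<delta> \<le> 1" and \<alpha>: "\<alpha> \<in> R"
  have "\<delta>\<^sup>2 \<le> 1\<^sup>2" using \<delta> by (intro power_mono) auto
  then show "ln ((\<alpha> \<bullet> x)\<^sup>2 + \<delta>\<^sup>2) \<le> ln ((\<alpha> \<bullet> x)\<^sup>2 + 1\<^sup>2)"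
    using \<delta> by (subst ln_le_cancel_iff) (auto intro: add_nonneg_pos)
  show "0 \<le> k \<alpha> / 2" using k_pos[OF \<alpha>] by simp
qed

lemma weight_eq_exp:
  assumes "x \<in> off_hyperplanes R"
  shows "w x = exp (\<Sum>\<alpha>\<in>R. k \<alpha> / 2 * ln ((\<alpha> \<bullet> x)\<^sup>2))"
proof -
  have "w x = (\<Prod>\<alpha>\<in>R. exp (k \<alpha> / 2 * ln ((\<alpha> \<bullet> x)\<^sup>2)))"
    unfolding dunkl_weight_def
  proof (rule prod.cong)
    fix \<alpha> assume "\<alpha> \<in> R"
    then have *: "\<alpha> \<bullet> x \<noteq> 0" using assms by (simp add: off_hyperplanes_def)
    have "ln ((\<alpha> \<bullet> x)\<^sup>2) = 2 * ln \<bar>\<alpha> \<bullet> x\<bar>"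
      using * ln_realpow[of "\<bar>\<alpha> \<bullet> x\<bar>" 2] by simp
    then show "\<bar>x \<bullet> \<alpha>\<bar> powr k \<alpha> = exp (k \<alpha> / 2 * ln ((\<alpha> \<bullet> x)\<^sup>2))"
      using * by (simp add: powr_def inner_commute)
  qed simp
  then show ?thesis by (simp add: exp_sum finite_R)
qed

lemma weight_zero: "x \<notin> off_hyperplanes R \<Longrightarrow> w x = 0"
  unfolding dunkl_weight_def off_hyperplanes_def
  using finite_R by (auto simp: inner_commute intro!: prod_zero)

lemma weight_nonneg: "0 \<le> w x" by (simp add: dunkl_weight_def prod_nonneg)

lemma weight_pos: "x \<in> off_hyperplanes R \<Longrightarrow> 0 < w x" by (simp add: weight_eq_exp)

lemma weight_le_reg: "w x \<le> reg_weight 1 x"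
proof (cases "x \<in> off_hyperplanes R")
  case True
  show ?thesis
    unfolding weight_eq_exp[OF True] reg_weight_def
  proof (subst exp_le_cancel_iff, intro sum_mono mult_left_mono)
    fix \<alpha> assume \<alpha>: "\<alpha> \<in> R"
    then have *: "\<alpha> \<bullet> x \<noteq> 0" using True by (simp add: off_hyperplanes_def)
    then show "ln ((\<alpha> \<bullet> x)\<^sup>2) \<le> ln ((\<alpha> \<bullet> x)\<^sup>2 + 1\<^sup>2)"
      by (subst ln_le_cancel_iff) (auto intro: add_nonneg_pos)
    show "0 \<le> k \<alpha> / 2" using k_pos[OF \<alpha>] by simp
  qed
qed (use reg_weight_pos[of 1 x] in \<open>simp add: weight_zero\<close>)

lemma weight_bdd: "bdd_fun_on (cball z \<rho>) w"
  by (rule bdd_fun_on_abs_le[OF bdd_fun_on_compact[OF compact_cball continuous_on_reg_weight[of 1]]])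
    (auto simp: weight_nonneg weight_le_reg)

lemma weight_borel[measurable]: "w \<in> borel_measurable borel"
  unfolding dunkl_weight_def[abs_def] by measurable

lemma reg_weight_tendsto:
  assumes "x \<in> off_hyperplanes R" "\<delta> \<longlonglongrightarrow> 0"
  shows "(\<lambda>n. reg_weight (\<delta> n) x) \<longlonglongrightarrow> w x"
proof -
  have "(\<lambda>n. exp (\<Sum>\<alpha>\<in>R. k \<alpha> / 2 * ln ((\<alpha> \<bullet> x)\<^sup>2 + (\<delta> n)\<^sup>2))) \<longlonglongrightarrow> exp (\<Sum>\<alpha>\<in>R. k \<alpha> / 2 * ln ((\<alpha> \<bullet> x)\<^sup>2 + 0\<^sup>2))"
    using assms by (intro tendsto_intros) (auto simp: off_hyperplanes_def)
  then show ?thesis using weight_eq_exp[OF assms(1)] by (simp add: reg_weight_def)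
qed

text \<open>The formula read at every point, with division by zero on the hyperplanes instead of the
  limit.\<close>

definition dlap :: "('a \<Rightarrow> real) \<Rightarrow> 'a \<Rightarrow> real" where
  "dlap u x = laplacian u x + (\<Sum>\<alpha>\<in>R. k \<alpha> * dunkl_part u \<alpha> x)"

text \<open>The weight vanishes on the hyperplanes, so the value of the Dunkl Laplacian there is irrelevant.\<close>

lemma dunkl_laplacian_weight: "dunkl_laplacian R k u x * w x = dlap u x * w x"
  by (cases "x \<in> off_hyperplanes R")
    (simp_all add: dunkl_laplacian_def dunkl_laplacian_regular_def dlap_def dunkl_part_def weight_zero)

end

section \<open>Green's formula for radial functions\<close>

lemma bdd_fun_on_abs: "bdd_fun_on S f \<Longrightarrow> bdd_fun_on S (\<lambda>x. \<bar>f x\<bar>)"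
  by (auto simp: bdd_fun_on_def)

context dunkl
begin

text \<open>The ratio of the regularised factor \<open>(\<alpha> \<bullet> x) / ((\<alpha> \<bullet>
  x)\<^sup>2 + \<delta>\<^sup>2)\<close> to the singular factor
  \<open>1 / (\<alpha> \<bullet> x)\<close>.\<close>

definition theta :: "real \<Rightarrow> 'a \<Rightarrow> 'a \<Rightarrow> real" where
  "theta \<delta> \<alpha> x = (\<alpha> \<bullet> x)\<^sup>2 / ((\<alpha> \<bullet> x)\<^sup>2 + \<delta>\<^sup>2)"

lemma theta_bounds: "0 \<le> theta \<delta> \<alpha> x" "theta \<delta> \<alpha> x \<le> 1"
proof -
  show "0 \<le> theta \<delta> \<alpha> x" by (simp add: theta_def)
  have "a / (a + b) \<le> 1" if "0 \<le> a" "0 \<le> b" for a b :: real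
    using that by (cases "a + b = 0") (auto simp: divide_le_eq_1)
  then show "theta \<delta> \<alpha> x \<le> 1" by (simp add: theta_def)
qed

lemma theta_tendsto:
  assumes "\<alpha> \<bullet> x \<noteq> 0" "\<delta> \<longlonglongrightarrow> 0"
  shows "(\<lambda>n. theta (\<delta> n) \<alpha> x) \<longlonglongrightarrow> 1"
proof -
  have "(\<lambda>n. (\<alpha> \<bullet> x)\<^sup>2 / ((\<alpha> \<bullet> x)\<^sup>2 + (\<delta> n)\<^sup>2)) \<longlonglongrightarrow> (\<alpha> \<bullet> x)\<^sup>2 / ((\<alpha> \<bullet> x)\<^sup>2 + 0\<^sup>2)"
    using assms by (intro tendsto_intros) auto
  then show ?thesis using assms(1) by (simp add: theta_def)
qed

text \<open>On the hyperplane the reflection fixes \<open>x\<close>, so both sides vanish and the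
  identity has no exceptional points.\<close>

lemma theta_dunkl_part:
  "theta \<delta> \<alpha> x * dunkl_part u \<alpha> x = (\<alpha> \<bullet> x) * (grad u x \<bullet> \<alpha>) / ((\<alpha> \<bullet> x)\<^sup>2 + \<delta>\<^sup>2)
    - (norm \<alpha>)\<^sup>2 / 2 * ((u x - u (reflection \<alpha> x)) / ((\<alpha> \<bullet> x)\<^sup>2 + \<delta>\<^sup>2))"
proof (cases "\<alpha> \<bullet> x = 0")
  case True then show ?thesis by (simp add: theta_def reflection_fixed)
next
  case False
  have "a\<^sup>2 / D * (g / a - n * (u / a\<^sup>2)) = a * g / D - n * (u / D)" if "a \<noteq> 0" for a D g n u :: real
    using that by (cases "D = 0") (simp_all add: field_simps power2_eq_square)
  from this[OF False] show ?thesis unfolding theta_def dunkl_part_def .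
qed

text \<open>With the regularised weight, the divergence of \<open>reg_weight \<delta> * (V * grad \<psi> - \<psi> * grad V)\<close> (the sum of the
  \<open>D \<delta> b\<close> below) integrates to 0, and so does the jump term \<open>J\<close>, which is antisymmetric under the reflection.
  Their difference \<open>E\<close> is dominated uniformly in \<open>\<delta>\<close> because \<open>dunkl_part\<close> is bounded, although its two
  summands are not.\<close>

lemma green_radial_measurable:
  assumes \<psi>: "test_function (ball 0 r) \<psi>" and r: "r > 0"
    and [measurable]: "V \<in> borel_measurable borel" "Q \<in> borel_measurable borel" "Z \<in> borel_measurable borel"
    and contQ: "continuous_on {0..<r} Q" and contZ: "continuous_on {0..<r} Z"
    and dV: "\<And>s. s \<in> {0..<r} \<Longrightarrow> (V has_real_derivative s * Q s) (at s within {0..<r})"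
    and dQ: "\<And>s. 0 < s \<Longrightarrow> s < r \<Longrightarrow> (Q has_real_derivative (Z s - hom_dim * Q s) / s) (at s)"
    and Z0: "Z 0 = hom_dim * Q 0"
  shows "(\<integral>x. w x * (V (norm x) * dlap \<psi> x - \<psi> x * Z (norm x)) \<partial>lborel) = 0"
proof -
  obtain \<rho> where \<rho>: "0 \<le> \<rho>" "\<rho> < r" "\<And>x. norm x > \<rho> \<Longrightarrow> \<psi> x = 0" "\<And>x b. norm x > \<rho> \<Longrightarrow> partial_deriv b \<psi> x = 0"
    "\<And>x b c. norm x > \<rho> \<Longrightarrow> partial_deriv c (partial_deriv b \<psi>) x = 0"
    using test_functionE[OF \<psi> r] by metis
  have contV: "continuous_on {0..<r} V"
    using dV by (metis DERIV_continuous continuous_on_eq_continuous_within)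
  note [measurable] = test_function_borel[OF \<psi>] test_function_grad_borel[OF \<psi>] test_function_partial_borel[OF \<psi>]
    test_function_laplacian_borel[OF \<psi>] test_function_dunkl_part_borel[OF \<psi>]
  note bdds = bdd_fun_on_intros bdd_fun_on_abs test_function_bdd[OF \<psi> r] test_function_partial_bdd[OF \<psi> r]
    test_function_partial2_bdd[OF \<psi> r] test_function_laplacian_bdd[OF \<psi> r] test_function_dunkl_part_bdd[OF \<psi> r R_nonzero]
    bdd_fun_on_radial[OF contV \<rho>(2)] bdd_fun_on_radial[OF contQ \<rho>(2)] bdd_fun_on_radial[OF contZ \<rho>(2)]
  note bcont = bdd_fun_on_compact[OF compact_cball]
  define D where "D = (\<lambda>\<delta> b x. reg_weight \<delta> x * (\<Sum>\<alpha>\<in>R. k \<alpha> * ((\<alpha> \<bullet> x) * (\<alpha> \<bullet> b) / ((\<alpha> \<bullet> x)\<^sup>2 + \<delta>\<^sup>2)))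
      * (V (norm x) * partial_deriv b \<psi> x - \<psi> x * (Q (norm x) * (x \<bullet> b)))
    + reg_weight \<delta> x * (V (norm x) * partial_deriv b (partial_deriv b \<psi>) x
      - \<psi> x * (Q (norm x) + (x \<bullet> b)\<^sup>2 / (norm x)\<^sup>2 * (Z (norm x) - hom_dim * Q (norm x)))))"
    \<comment> \<open>at \<open>x = 0\<close> the quotient by \<open>norm x\<close> is 0, as it should be\<close>
  define J where "J = (\<lambda>\<delta> \<alpha> x. reg_weight \<delta> x * (V (norm x) * (k \<alpha> * ((norm \<alpha>)\<^sup>2 / 2 * ((\<psi> x - \<psi> (reflection \<alpha> x)) / ((\<alpha> \<bullet> x)\<^sup>2 + \<delta>\<^sup>2))))))"
  define E where "E = (\<lambda>\<delta> x. reg_weight \<delta> x * (V (norm x) * (laplacian \<psi> x + (\<Sum>\<alpha>\<in>R. k \<alpha> * (theta \<delta> \<alpha> x * dunkl_part \<psi> \<alpha> x)))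
      - \<psi> x * (Z (norm x) - Q (norm x) * (\<Sum>\<alpha>\<in>R. k \<alpha> * (1 - theta \<delta> \<alpha> x)))))"
  have D: "integral\<^sup>L lborel (D \<delta> b) = 0 \<and> integrable lborel (D \<delta> b)" if \<delta>: "\<delta> > 0" and b: "b \<in> Basis" for \<delta> b
  proof -
    note [measurable] = borel_measurable_continuous_onI[OF continuous_on_reg_weight[OF \<delta>]] test_function_partial_borel[OF \<psi> b]
    \<comment> \<open>The component along \<open>b\<close> of the field whose divergence is
      integrated.\<close>
    define X where "X = (\<lambda>x. reg_weight \<delta> x * (V (norm x) * partial_deriv b \<psi> x - \<psi> x * (Q (norm x) * (x \<bullet> b))))"
    have der: "((\<lambda>t. X (x + t *\<^sub>R b)) has_real_derivative D \<delta> b x) (at 0)" for x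
    proof (cases "norm x < r")
      case True
      have p: "((\<lambda>t. \<psi> (x + t *\<^sub>R b)) has_real_derivative partial_deriv b \<psi> x) (at 0)"
        using has_real_derivative_directional[where f=\<psi> and x=x and t=0 and v=b] test_function_differentiable[OF \<psi>] by simp
      have p2: "((\<lambda>t. partial_deriv b \<psi> (x + t *\<^sub>R b)) has_real_derivative partial_deriv b (partial_deriv b \<psi>) x) (at 0)"
        using has_real_derivative_directional[where f="partial_deriv b \<psi>" and x=x and t=0 and v=b] test_function_differentiable2[OF \<psi> b] by simp
      have alg: "rw * L * (v * pb - p * (q * xb)) + (q * xb * pb + pbb * v - (pb * (q * xb) + (q + A) * p)) * rw
          = rw * L * (v * pb - p * (q * xb)) + rw * (v * pbb - p * (q + A))" for rw L v pb p q xb pbb A :: real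
        by (simp add: algebra_simps)
      show ?thesis unfolding X_def
        by (rule DERIV_cong[OF DERIV_mult[OF has_real_derivative_reg_weight[OF \<delta>] DERIV_diff[OF
              DERIV_mult[OF has_real_derivative_radial[OF dV True b] p2]
              DERIV_mult[OF p has_real_derivative_radial_gradient[OF dQ contQ True b]]]]])
          (assumption, assumption, assumption, simp only: D_def scaleR_zero_left add_0_right times_divide_eq_left, rule alg)
    next
      \<comment> \<open>Beyond the support of \<psi> the field vanishes on an open set, whatever the
        profiles do there.\<close>
      case False
      then have x: "norm x > \<rho>" using \<rho>(2) by simp
      have "((\<lambda>t. X (x + t *\<^sub>R b)) has_real_derivative 0) (at 0)"
      proof (rule has_field_derivative_transform_within_open[OF DERIV_const[of 0]])
        show "open ((\<lambda>t. x + t *\<^sub>R b) -` {y. norm y > \<rho>})"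
          by (intro open_vimage open_Collect_less continuous_intros)
        show "0 \<in> (\<lambda>t. x + t *\<^sub>R b) -` {y. norm y > \<rho>}" using x by simp
      qed (simp add: X_def \<rho>(3,4))
      moreover have "D \<delta> b x = 0" using x by (simp add: D_def \<rho>)
      ultimately show ?thesis by simp
    qed
    have rb: "bdd_fun_on (cball 0 \<rho>) (reg_weight \<delta>)"
      by (rule bcont[OF continuous_on_reg_weight[OF \<delta>]])
    have Lb: "bdd_fun_on (cball 0 \<rho>) (\<lambda>x. (\<alpha> \<bullet> x) * (\<alpha> \<bullet> b) / ((\<alpha> \<bullet> x)\<^sup>2 + \<delta>\<^sup>2))" for \<alpha>
      using \<delta> by (intro bcont continuous_intros) (auto simp: add_nonneg_eq_0_iff)
    have xb: "bdd_fun_on (cball 0 \<rho>) (\<lambda>x. x \<bullet> b)" by (intro bcont continuous_intros)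
    have xn: "bdd_fun_on (cball 0 \<rho>) (\<lambda>x. (x \<bullet> b)\<^sup>2 / (norm x)\<^sup>2)"
    proof (rule bdd_fun_onI[where B=1])
      fix x
      have "(x \<bullet> b)\<^sup>2 \<le> (norm x)\<^sup>2"
        using power_mono[OF Basis_le_norm[OF b, of x], of 2] by simp
      then show "\<bar>(x \<bullet> b)\<^sup>2 / (norm x)\<^sup>2\<bar> \<le> 1" by (simp add: divide_le_eq_1)
    qed
    have "bdd_fun_on (cball 0 \<rho>) (D \<delta> b)" unfolding D_def by (intro bdds rb Lb xb xn b)
    then obtain B where B: "\<forall>x\<in>cball 0 \<rho>. \<bar>D \<delta> b x\<bar> \<le> B" unfolding bdd_fun_on_def ..
    have B': "\<bar>D \<delta> b x\<bar> \<le> \<bar>B\<bar>" for x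
      using B[rule_format, of x] by (cases "norm x > \<rho>") (auto simp: D_def \<rho>)
    have "integrable lborel X"
    proof (rule integrable_bdd_fun_on)
      show "X \<in> borel_measurable borel" unfolding X_def by measurable
      show "bdd_fun_on (cball 0 \<rho>) X" unfolding X_def by (intro bdds rb xb b)
    qed (simp add: X_def \<rho>)
    from integral_directional_derivative_zero[OF der B' _ this, of \<rho>] show ?thesis
      by (auto simp: D_def \<rho>)
  qed
  have J: "integral\<^sup>L lborel (J \<delta> \<alpha>) = 0 \<and> integrable lborel (J \<delta> \<alpha>)" if \<delta>: "\<delta> > 0" and \<alpha>: "\<alpha> \<in> R" for \<delta> \<alpha>
  proof -
    note [measurable] = borel_measurable_continuous_onI[OF continuous_on_reg_weight[OF \<delta>]]
    have m: "J \<delta> \<alpha> \<in> borel_measurable borel" unfolding J_def by measurable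
    have "J \<delta> \<alpha> (reflection \<alpha> x) = - J \<delta> \<alpha> x" for x
    proof -
      have "(\<psi> (reflection \<alpha> x) - \<psi> x) / C = - ((\<psi> x - \<psi> (reflection \<alpha> x)) / C)" for C
        by (simp add: diff_divide_distrib)
      then show ?thesis
        unfolding J_def by (simp add: reg_weight_reflection[OF \<alpha>] norm_reflection reflection_involution reflection_self_inner)
    qed
    from integral_antisymmetric_zero[OF m this] have 0: "integral\<^sup>L lborel (J \<delta> \<alpha>) = 0" .
    have rb: "bdd_fun_on (cball 0 \<rho>) (reg_weight \<delta>)"
      by (rule bcont[OF continuous_on_reg_weight[OF \<delta>]])
    have Lb: "bdd_fun_on (cball 0 \<rho>) (\<lambda>x. inverse ((\<alpha> \<bullet> x)\<^sup>2 + \<delta>\<^sup>2))"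
      using \<delta> by (intro bcont continuous_intros) (auto simp: add_nonneg_eq_0_iff)
    have s: "bdd_fun_on S (\<lambda>x. \<psi> (reflection \<alpha> x))" for S
      using test_function_bdd[OF \<psi> r, of UNIV] by (auto simp: bdd_fun_on_def)
    have "integrable lborel (J \<delta> \<alpha>)"
      by (rule integrable_bdd_fun_on[OF m, of \<rho>], unfold J_def divide_inverse[of "_ - _"], intro bdds rb Lb s)
        (simp add: \<rho>(3) norm_reflection)
    then show ?thesis using 0 by blast
  qed
  \<comment> \<open>In the divergence the logarithmic gradient of the weight is paired with
    \<open>grad \<psi> x\<close> and with \<open>x\<close>. The second pairing gives the sum of
    \<open>k \<alpha> * theta \<delta> \<alpha> x\<close>, which together with the dimension falls
    short of \<open>hom_dim\<close> by the sum of
    \<open>k \<alpha> * (1 - theta \<delta> \<alpha> x)\<close>. This shortfall is the correction in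
    \<open>E\<close>.\<close>
  have E_eq: "E \<delta> x = (\<Sum>b\<in>Basis. D \<delta> b x) - (\<Sum>\<alpha>\<in>R. J \<delta> \<alpha> x)" if \<delta>: "\<delta> > 0" for \<delta> x
  proof -
    let ?v = "V (norm x)" and ?q = "Q (norm x)" and ?z = "Z (norm x)" and ?C = "\<lambda>\<alpha>. (\<alpha> \<bullet> x)\<^sup>2 + \<delta>\<^sup>2"
    let ?L = "\<lambda>b. \<Sum>\<alpha>\<in>R. k \<alpha> * ((\<alpha> \<bullet> x) * (\<alpha> \<bullet> b) / ?C \<alpha>)"
    have s1: "(\<Sum>b\<in>Basis. ?L b * (y \<bullet> b)) = (\<Sum>\<alpha>\<in>R. k \<alpha> * ((\<alpha> \<bullet> x) * (y \<bullet> \<alpha>) / ?C \<alpha>))" for y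
    proof -
      have "(\<Sum>b\<in>Basis. ?L b * (y \<bullet> b)) = (\<Sum>\<alpha>\<in>R. \<Sum>b\<in>Basis. (k \<alpha> * (\<alpha> \<bullet> x) / ?C \<alpha>) * ((y \<bullet> b) * (\<alpha> \<bullet> b)))"
        unfolding sum_distrib_right by (subst sum.swap) (simp add: mult_ac)
      also have "\<dots> = (\<Sum>\<alpha>\<in>R. (k \<alpha> * (\<alpha> \<bullet> x) / ?C \<alpha>) * (y \<bullet> \<alpha>))"
        by (simp only: sum_distrib_left[symmetric] euclidean_inner[symmetric])
      finally show ?thesis by (simp only: times_divide_eq_left times_divide_eq_right mult.assoc)
    qed
    have gb: "partial_deriv b \<psi> x = grad \<psi> x \<bullet> b" for b
      by (rule partial_deriv_grad[OF test_function_differentiable[OF \<psi>]])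
    have s2: "(\<Sum>b\<in>Basis. (x \<bullet> b)\<^sup>2 / (norm x)\<^sup>2 * (?z - hom_dim * ?q)) = ?z - hom_dim * ?q"
    proof (cases "x = 0")
      case False
      have "(\<Sum>b\<in>Basis. (x \<bullet> b)\<^sup>2 / (norm x)\<^sup>2) = 1"
        using False by (simp add: sum_divide_distrib[symmetric] power2_norm_eq_inner euclidean_inner[of x x] power2_eq_square)
          (simp add: euclidean_inner[of x x, symmetric] dot_square_norm power2_eq_square)
      then show ?thesis by (simp only: sum_distrib_right[symmetric] mult_1_left)
    qed (simp add: Z0)
    have "(\<Sum>b\<in>Basis. D \<delta> b x) = reg_weight \<delta> x * (?v * (\<Sum>b\<in>Basis. ?L b * (grad \<psi> x \<bullet> b)) - \<psi> x * ?q * (\<Sum>b\<in>Basis. ?L b * (x \<bullet> b)))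
       + reg_weight \<delta> x * (?v * laplacian \<psi> x - \<psi> x * (real DIM('a) * ?q + (\<Sum>b\<in>Basis. (x \<bullet> b)\<^sup>2 / (norm x)\<^sup>2 * (?z - hom_dim * ?q))))"
    proof -
      have alg: "rw * L * (v * g - p * (q * y)) + rw * (v * l - p * (q + s)) = rw * v * (L * g) - rw * p * q * (L * y) + rw * v * l - rw * p * q - rw * p * s"
        for rw L v g p q y l s :: real by (simp add: algebra_simps)
      have "D \<delta> b x = reg_weight \<delta> x * ?v * (?L b * (grad \<psi> x \<bullet> b)) - reg_weight \<delta> x * \<psi> x * ?q * (?L b * (x \<bullet> b))
          + reg_weight \<delta> x * ?v * partial_deriv b (partial_deriv b \<psi>) x - reg_weight \<delta> x * \<psi> x * ?q
          - reg_weight \<delta> x * \<psi> x * ((x \<bullet> b)\<^sup>2 / (norm x)\<^sup>2 * (?z - hom_dim * ?q))" for b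
        unfolding D_def gb[symmetric] by (rule alg)
      then have "(\<Sum>b\<in>Basis. D \<delta> b x) = reg_weight \<delta> x * ?v * (\<Sum>b\<in>Basis. ?L b * (grad \<psi> x \<bullet> b))
          - reg_weight \<delta> x * \<psi> x * ?q * (\<Sum>b\<in>Basis. ?L b * (x \<bullet> b))
          + reg_weight \<delta> x * ?v * laplacian \<psi> x - reg_weight \<delta> x * \<psi> x * (real DIM('a) * ?q)
          - reg_weight \<delta> x * \<psi> x * (\<Sum>b\<in>Basis. (x \<bullet> b)\<^sup>2 / (norm x)\<^sup>2 * (?z - hom_dim * ?q))"
        by (simp only: sum.distrib sum_subtractf sum_distrib_left[symmetric] laplacian_def sum_constant)
      moreover have "rw * v * S1 - rw * p * q * S2 + rw * v * l - rw * p * (d * q) - rw * p * S3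
          = rw * (v * S1 - p * q * S2) + rw * (v * l - p * (d * q + S3))"
        for rw v S1 p q S2 l d S3 :: real by (simp add: algebra_simps)
      ultimately show ?thesis by (simp only:)
    qed
    then have DD: "(\<Sum>b\<in>Basis. D \<delta> b x) = reg_weight \<delta> x * (?v * (\<Sum>\<alpha>\<in>R. k \<alpha> * ((\<alpha> \<bullet> x) * (grad \<psi> x \<bullet> \<alpha>) / ?C \<alpha>))
         - \<psi> x * ?q * (\<Sum>\<alpha>\<in>R. k \<alpha> * theta \<delta> \<alpha> x))
       + reg_weight \<delta> x * (?v * laplacian \<psi> x - \<psi> x * (real DIM('a) * ?q + (?z - hom_dim * ?q)))"
      unfolding s1 s2 by (simp add: theta_def power2_eq_square inner_commute)
    have JJ: "(\<Sum>\<alpha>\<in>R. J \<delta> \<alpha> x) = reg_weight \<delta> x * (?v * (\<Sum>\<alpha>\<in>R. k \<alpha> * ((norm \<alpha>)\<^sup>2 / 2 * ((\<psi> x - \<psi> (reflection \<alpha> x)) / ?C \<alpha>))))"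
      unfolding J_def by (simp only: sum_distrib_left)
    have TT: "(\<Sum>\<alpha>\<in>R. k \<alpha> * (theta \<delta> \<alpha> x * dunkl_part \<psi> \<alpha> x)) = (\<Sum>\<alpha>\<in>R. k \<alpha> * ((\<alpha> \<bullet> x) * (grad \<psi> x \<bullet> \<alpha>) / ?C \<alpha>))
        - (\<Sum>\<alpha>\<in>R. k \<alpha> * ((norm \<alpha>)\<^sup>2 / 2 * ((\<psi> x - \<psi> (reflection \<alpha> x)) / ?C \<alpha>)))"
      unfolding theta_dunkl_part by (simp only: right_diff_distrib sum_subtractf)
    have KK: "(\<Sum>\<alpha>\<in>R. k \<alpha> * (1 - theta \<delta> \<alpha> x)) = (hom_dim - real DIM('a)) - (\<Sum>\<alpha>\<in>R. k \<alpha> * theta \<delta> \<alpha> x)"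
      by (simp add: hom_dim_def right_diff_distrib sum_subtractf)
    have "rw * (v * (l + (T1 - T2)) - p * (z - q * ((m - d) - K)))
        = rw * (v * T1 - p * q * K) + rw * (v * l - p * (d * q + (z - m * q))) - rw * (v * T2)"
      for rw v l T1 T2 p z q m d K :: real by (simp add: algebra_simps)
    then show ?thesis unfolding E_def DD JJ TT KK by (simp only:)
  qed
  have E0: "integral\<^sup>L lborel (E \<delta>) = 0" if "\<delta> > 0" for \<delta>
  proof -
    have "integral\<^sup>L lborel (E \<delta>) = (\<integral>x. (\<Sum>b\<in>Basis. D \<delta> b x) - (\<Sum>\<alpha>\<in>R. J \<delta> \<alpha> x) \<partial>lborel)"
      by (rule Bochner_Integration.integral_cong[OF refl E_eq[OF that]])
    also have "\<dots> = (\<integral>x. (\<Sum>b\<in>Basis. D \<delta> b x) \<partial>lborel) - (\<integral>x. (\<Sum>\<alpha>\<in>R. J \<delta> \<alpha> x) \<partial>lborel)"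
      by (rule Bochner_Integration.integral_diff; rule Bochner_Integration.integrable_sum) (use D[OF that] J[OF that] in auto)
    also have "(\<integral>x. (\<Sum>b\<in>Basis. D \<delta> b x) \<partial>lborel) = (\<Sum>b\<in>Basis. integral\<^sup>L lborel (D \<delta> b))"
      by (rule Bochner_Integration.integral_sum) (use D[OF that] in blast)
    also have "\<dots> = 0" using D[OF that] by (intro sum.neutral) blast
    also have "(\<integral>x. (\<Sum>\<alpha>\<in>R. J \<delta> \<alpha> x) \<partial>lborel) = (\<Sum>\<alpha>\<in>R. integral\<^sup>L lborel (J \<delta> \<alpha>))"
      by (rule Bochner_Integration.integral_sum) (use J[OF that] in blast)
    also have "\<dots> = 0" using J[OF that] by (intro sum.neutral) blast
    also have "0 - 0 = (0::real)" by simp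
    finally show ?thesis .
  qed
  define \<delta> where "\<delta> = (\<lambda>n. 1 / (real n + 1))"
  have \<delta>: "\<delta> n > 0" "\<delta> n \<le> 1" for n by (auto simp: \<delta>_def)
  have \<delta>0: "\<delta> \<longlonglongrightarrow> 0" unfolding \<delta>_def by real_asymp
  \<comment> \<open>A majorant for all \<delta> up to 1, since \<open>theta\<close> lies in [0, 1]
    and \<open>reg_weight\<close> increases with \<delta>.\<close>
  define G where "G = (\<lambda>x. reg_weight 1 x * (\<bar>V (norm x)\<bar> * (\<bar>laplacian \<psi> x\<bar> + (\<Sum>\<alpha>\<in>R. k \<alpha> * \<bar>dunkl_part \<psi> \<alpha> x\<bar>))
      + \<bar>\<psi> x\<bar> * (\<bar>Z (norm x)\<bar> + \<bar>Q (norm x)\<bar> * (\<Sum>\<alpha>\<in>R. k \<alpha>))))"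
  note [measurable] = borel_measurable_continuous_onI[OF continuous_on_reg_weight]
  note zero = laplacian_zero_outside[OF \<rho>(3-5)] dunkl_part_zero_outside[OF \<rho>(3-5)] \<rho>(3)
  have G: "integrable lborel G"
  proof (rule integrable_bdd_fun_on)
    show "G \<in> borel_measurable borel" unfolding G_def by measurable
    show "bdd_fun_on (cball 0 \<rho>) G" unfolding G_def
      by (intro bdds bcont[OF continuous_on_reg_weight]) auto
  qed (simp add: G_def zero)
  have "(\<lambda>n. integral\<^sup>L lborel (E (\<delta> n))) \<longlonglongrightarrow> (\<integral>x. w x * (V (norm x) * dlap \<psi> x - \<psi> x * Z (norm x)) \<partial>lborel)"
  proof (rule integral_dominated_convergence[OF _ _ G])
    show "(\<lambda>x. w x * (V (norm x) * dlap \<psi> x - \<psi> x * Z (norm x))) \<in> borel_measurable lborel"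
      unfolding dlap_def by measurable
    show "E (\<delta> n) \<in> borel_measurable lborel" for n
    proof -
      note [measurable] = borel_measurable_continuous_onI[OF continuous_on_reg_weight[OF \<delta>(1)[of n]]]
      show ?thesis unfolding E_def theta_def by measurable
    qed
    show "AE x in lborel. (\<lambda>n. E (\<delta> n) x) \<longlonglongrightarrow> w x * (V (norm x) * dlap \<psi> x - \<psi> x * Z (norm x))"
      using AE_off_hyperplanes[OF finite_R zero_notin_R]
    proof eventually_elim
      case (elim x)
      have "(\<lambda>n. theta (\<delta> n) \<alpha> x) \<longlonglongrightarrow> 1" if "\<alpha> \<in> R" for \<alpha>
        using elim that by (intro theta_tendsto[OF _ \<delta>0]) (simp add: off_hyperplanes_def)
      then have "(\<lambda>n. E (\<delta> n) x) \<longlonglongrightarrow> w x * (V (norm x) * (laplacian \<psi> x + (\<Sum>\<alpha>\<in>R. k \<alpha> * (1 * dunkl_part \<psi> \<alpha> x)))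
          - \<psi> x * (Z (norm x) - Q (norm x) * (\<Sum>\<alpha>\<in>R. k \<alpha> * (1 - 1))))"
        unfolding E_def by (intro tendsto_intros reg_weight_tendsto[OF elim \<delta>0])
      then show ?case by (simp add: dlap_def)
    qed
    show "AE x in lborel. norm (E (\<delta> n) x) \<le> G x" for n
    proof (rule AE_I2)
      fix x
      have a: "\<bar>\<Sum>\<alpha>\<in>R. k \<alpha> * (theta (\<delta> n) \<alpha> x * dunkl_part \<psi> \<alpha> x)\<bar> \<le> (\<Sum>\<alpha>\<in>R. k \<alpha> * \<bar>dunkl_part \<psi> \<alpha> x\<bar>)"
      proof (rule order_trans[OF sum_abs sum_mono])
        fix \<alpha> assume "\<alpha> \<in> R"
        then show "\<bar>k \<alpha> * (theta (\<delta> n) \<alpha> x * dunkl_part \<psi> \<alpha> x)\<bar> \<le> k \<alpha> * \<bar>dunkl_part \<psi> \<alpha> x\<bar>"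
          using k_pos[of \<alpha>] theta_bounds[of "\<delta> n" \<alpha> x]
          by (simp add: abs_mult mult_left_le_one_le)
      qed
      have b: "\<bar>\<Sum>\<alpha>\<in>R. k \<alpha> * (1 - theta (\<delta> n) \<alpha> x)\<bar> \<le> (\<Sum>\<alpha>\<in>R. k \<alpha>)"
      proof (rule order_trans[OF sum_abs sum_mono])
        fix \<alpha> assume "\<alpha> \<in> R"
        then show "\<bar>k \<alpha> * (1 - theta (\<delta> n) \<alpha> x)\<bar> \<le> k \<alpha>"
          using k_pos[of \<alpha>] theta_bounds[of "\<delta> n" \<alpha> x] by (simp add: abs_mult)
      qed
      have "\<bar>E (\<delta> n) x\<bar> \<le> reg_weight 1 x * \<bar>V (norm x) * (laplacian \<psi> x + (\<Sum>\<alpha>\<in>R. k \<alpha> * (theta (\<delta> n) \<alpha> x * dunkl_part \<psi> \<alpha> x)))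
      - \<psi> x * (Z (norm x) - Q (norm x) * (\<Sum>\<alpha>\<in>R. k \<alpha> * (1 - theta (\<delta> n) \<alpha> x)))\<bar>"
        unfolding E_def abs_mult using reg_weight_mono[OF \<delta>, of n x] reg_weight_pos[of "\<delta> n" x]
        by (intro mult_right_mono) auto
      also have "\<dots> \<le> G x" unfolding G_def
      proof (rule mult_left_mono)
        show "0 \<le> reg_weight 1 x" using reg_weight_pos[of 1 x] by simp
        show "\<bar>V (norm x) * (laplacian \<psi> x + (\<Sum>\<alpha>\<in>R. k \<alpha> * (theta (\<delta> n) \<alpha> x * dunkl_part \<psi> \<alpha> x)))
          - \<psi> x * (Z (norm x) - Q (norm x) * (\<Sum>\<alpha>\<in>R. k \<alpha> * (1 - theta (\<delta> n) \<alpha> x)))\<bar>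
          \<le> \<bar>V (norm x)\<bar> * (\<bar>laplacian \<psi> x\<bar> + (\<Sum>\<alpha>\<in>R. k \<alpha> * \<bar>dunkl_part \<psi> \<alpha> x\<bar>))
            + \<bar>\<psi> x\<bar> * (\<bar>Z (norm x)\<bar> + \<bar>Q (norm x)\<bar> * (\<Sum>\<alpha>\<in>R. k \<alpha>))"
          by (rule order_trans[OF abs_triangle_ineq4], unfold abs_mult, intro add_mono mult_left_mono abs_ge_zero,
              rule order_trans[OF abs_triangle_ineq add_left_mono[OF a]],
              rule order_trans[OF abs_triangle_ineq4], unfold abs_mult, intro add_left_mono mult_left_mono abs_ge_zero b)
      qed
      finally show "norm (E (\<delta> n) x) \<le> G x" by simp
    qed
  qed
  then have "(\<lambda>n. 0) \<longlonglongrightarrow> (\<integral>x. w x * (V (norm x) * dlap \<psi> x - \<psi> x * Z (norm x)) \<partial>lborel)"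
    by (simp only: E0[OF \<delta>(1)])
  then show ?thesis using LIMSEQ_unique[OF tendsto_const] by metis
qed


lemma
  assumes \<psi>: "test_function (ball 0 r) \<psi>" and r: "r > 0" and u: "continuous_on (ball 0 r) u"
  shows weak_integrable_laplacian: "set_integrable lborel (ball 0 r) (\<lambda>x. u x * dunkl_laplacian R k \<psi> x * w x)"
    and weak_integrable_mult: "set_integrable lborel (ball 0 r) (\<lambda>x. u x * \<psi> x * w x)"
proof -
  obtain \<rho> where \<rho>: "0 \<le> \<rho>" "\<rho> < r" "\<And>x. norm x > \<rho> \<Longrightarrow> \<psi> x = 0" "\<And>x b. norm x > \<rho> \<Longrightarrow> partial_deriv b \<psi> x = 0"
    "\<And>x b c. norm x > \<rho> \<Longrightarrow> partial_deriv c (partial_deriv b \<psi>) x = 0"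
    using test_functionE[OF \<psi> r] by metis
  note zero = laplacian_zero_outside[OF \<rho>(3-5)] dunkl_part_zero_outside[OF \<rho>(3-5)] \<rho>(3)
  \<comment> \<open>Outside the ball \<open>u\<close> is arbitrary, perhaps not even measurable; the
    cut-off is a Borel function.\<close>
  define U where "U = (\<lambda>x. indicator (ball 0 r) x * u x)"
  have [measurable]: "U \<in> borel_measurable borel"
    unfolding U_def using borel_measurable_continuous_on_indicator[OF _ u] by simp
  have "bdd_fun_on (cball 0 \<rho>) u"
    using u \<rho>(2) by (intro bdd_fun_on_compact compact_cball) (auto intro: continuous_on_subset)
  moreover have "bdd_fun_on (cball 0 \<rho>) (indicator (ball 0 r) :: 'a \<Rightarrow> real)"
    by (rule bdd_fun_onI[where B=1]) (simp add: indicator_def)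
  ultimately have bU: "bdd_fun_on (cball 0 \<rho>) U" unfolding U_def by (intro bdd_fun_on_intros)
  note [measurable] = test_function_borel[OF \<psi>] test_function_laplacian_borel[OF \<psi>] test_function_dunkl_part_borel[OF \<psi>]
  note bdds = bdd_fun_on_intros test_function_bdd[OF \<psi> r] test_function_laplacian_bdd[OF \<psi> r]
    test_function_dunkl_part_bdd[OF \<psi> r R_nonzero] weight_bdd bU
  have "integrable lborel (\<lambda>x. U x * (dlap \<psi> x * w x))"
  proof (rule integrable_bdd_fun_on)
    show "(\<lambda>x. U x * (dlap \<psi> x * w x)) \<in> borel_measurable borel" unfolding dlap_def by measurable
    show "bdd_fun_on (cball 0 \<rho>) (\<lambda>x. U x * (dlap \<psi> x * w x))" unfolding dlap_def by (intro bdds)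
  qed (simp add: dlap_def zero)
  then show "set_integrable lborel (ball 0 r) (\<lambda>x. u x * dunkl_laplacian R k \<psi> x * w x)"
    by (simp add: set_integrable_def U_def mult.assoc dunkl_laplacian_weight)
  have "integrable lborel (\<lambda>x. U x * (\<psi> x * w x))"
  proof (rule integrable_bdd_fun_on)
    show "(\<lambda>x. U x * (\<psi> x * w x)) \<in> borel_measurable borel" by measurable
    show "bdd_fun_on (cball 0 \<rho>) (\<lambda>x. U x * (\<psi> x * w x))" by (intro bdds)
  qed (simp add: zero)
  then show "set_integrable lborel (ball 0 r) (\<lambda>x. u x * \<psi> x * w x)"
    by (simp add: set_integrable_def U_def mult.assoc)
qed

text \<open>The profiles are controlled on \<open>{0..<r}\<close> only. Cutting them off by the
  indicator makes them Borel and alters neither the integrals over the ball nor the derivatives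
  within \<open>{0..<r}\<close>.\<close>

theorem green_radial:
  assumes \<psi>: "test_function (ball 0 r) \<psi>" and r: "r > 0"
    and contQ: "continuous_on {0..<r} Q" and contZ: "continuous_on {0..<r} Z"
    and dV: "\<And>s. s \<in> {0..<r} \<Longrightarrow> (V has_real_derivative s * Q s) (at s within {0..<r})"
    and dQ: "\<And>s. 0 < s \<Longrightarrow> s < r \<Longrightarrow> (Q has_real_derivative (Z s - hom_dim * Q s) / s) (at s)"
    and Z0: "Z 0 = hom_dim * Q 0"
  shows "(LINT x:ball 0 r|lborel. V (norm x) * dunkl_laplacian R k \<psi> x * w x)
    = (LINT x:ball 0 r|lborel. Z (norm x) * \<psi> x * w x)"
proof -
  have contV: "continuous_on {0..<r} V"
    using dV by (metis DERIV_continuous continuous_on_eq_continuous_within)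
  have m: "(\<lambda>s. indicator {0..<r} s * F s) \<in> borel_measurable borel" if "continuous_on {0..<r} F" for F :: "real \<Rightarrow> real"
    using borel_measurable_continuous_on_indicator[OF _ that] by simp
  have c: "continuous_on {0..<r} (\<lambda>s. indicator {0..<r} s * F s)" if "continuous_on {0..<r} F" for F :: "real \<Rightarrow> real"
    by (rule continuous_on_eq[OF that]) simp
  let ?i = "indicator {0..<r} :: real \<Rightarrow> real"
  have "(\<integral>x. w x * (?i (norm x) * V (norm x) * dlap \<psi> x - \<psi> x * (?i (norm x) * Z (norm x))) \<partial>lborel) = 0"
  proof (rule green_radial_measurable[OF \<psi> r m[OF contV] m[OF contQ] m[OF contZ] c[OF contQ] c[OF contZ]])
    show "((\<lambda>s. ?i s * V s) has_real_derivative s * (?i s * Q s)) (at s within {0..<r})" if s: "s \<in> {0..<r}" for s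
      using has_field_derivative_transform_within[OF dV[OF s] zero_less_one s, of "\<lambda>s. ?i s * V s"] s by simp
    show "((\<lambda>s. ?i s * Q s) has_real_derivative (?i s * Z s - hom_dim * (?i s * Q s)) / s) (at s)" if s: "0 < s" "s < r" for s
      using has_field_derivative_transform_within_open[OF dQ[OF s], of "{0<..<r}" "\<lambda>s. ?i s * Q s"] s by simp
    show "?i 0 * Z 0 = hom_dim * (?i 0 * Q 0)" using Z0 by simp
  qed
  moreover have "w x * (?i (norm x) * V (norm x) * dlap \<psi> x - \<psi> x * (?i (norm x) * Z (norm x)))
     = indicator (ball 0 r) x *\<^sub>R (V (norm x) * dunkl_laplacian R k \<psi> x * w x) - indicator (ball 0 r) x *\<^sub>R (Z (norm x) * \<psi> x * w x)" for x
    using dunkl_laplacian_weight[of \<psi> x] by (auto simp: indicator_def right_diff_distrib mult_ac)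
  ultimately have "(\<integral>x. indicator (ball 0 r) x *\<^sub>R (V (norm x) * dunkl_laplacian R k \<psi> x * w x)
      - indicator (ball 0 r) x *\<^sub>R (Z (norm x) * \<psi> x * w x) \<partial>lborel) = 0" by (simp only:)
  moreover have rad: "continuous_on (ball 0 r) (\<lambda>x::'a. F (norm x))" if "continuous_on {0..<r} F" for F :: "real \<Rightarrow> real"
    by (rule continuous_on_compose2[OF that]) (auto intro: continuous_intros)
  ultimately show ?thesis
    using weak_integrable_laplacian[OF \<psi> r rad[OF contV]] weak_integrable_mult[OF \<psi> r rad[OF contZ]]
    unfolding set_lebesgue_integral_def set_integrable_def by simp
qed

end

section \<open>Comparison with radial solutions\<close>

text \<open>The argument inside a bump never exceeds 1, so continuity on the unit interval gives the
  bound.\<close>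

lemma flat_exp_bounded: obtains K where "K \<ge> 0" "\<And>t. t \<le> 1 \<Longrightarrow> flat_exp j t \<le> K"
proof -
  have "continuous_on {0..1} (flat_exp j)"
    by (rule DERIV_continuous_on, rule has_field_derivative_at_within, rule has_real_derivative_flat_exp)
  then have "bdd_fun_on {0..1} (flat_exp j)" by (intro bdd_fun_on_compact) auto
  then obtain K where K: "\<forall>t\<in>{0..1}. \<bar>flat_exp j t\<bar> \<le> K" unfolding bdd_fun_on_def ..
  have "flat_exp j t \<le> \<bar>K\<bar>" if "t \<le> 1" for t
    using K[rule_format, of t] that flat_exp_eq_0[of t j] by (cases "t \<le> 0") auto
  then show ?thesis using that[of "\<bar>K\<bar>"] by simp
qed

lemma bump_bounded: obtains K where "K \<ge> 0" "\<And>z \<tau> x. bump z \<tau> j x \<le> K"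
proof -
  obtain K where "K \<ge> 0" "\<And>t. t \<le> 1 \<Longrightarrow> flat_exp j t \<le> K" using flat_exp_bounded[where j=j] by metis
  then show ?thesis using that by (simp add: bump_def)
qed

lemma bump_borel[measurable]: "bump z \<tau> j \<in> borel_measurable borel"
  by (rule borel_measurable_continuous_onI[OF Ck_continuous[OF Ck_bump[of 0]]])

lemma has_real_derivative_bump_scale:
  assumes "\<tau> > 0"
  shows "((\<lambda>\<tau>. bump z \<tau> j x) has_real_derivative
    (bump z \<tau> (j + 2) x - real j * bump z \<tau> (j + 1) x) * (2 * (norm (x - z))\<^sup>2 / \<tau> ^ 3)) (at \<tau>)"
proof -
  have "((\<lambda>\<tau>. 1 - (norm (x - z))\<^sup>2 / \<tau>\<^sup>2) has_real_derivative 2 * (norm (x - z))\<^sup>2 / \<tau> ^ 3) (at \<tau>)"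
    using assms by (auto intro!: derivative_eq_intros simp: field_simps power2_eq_square power3_eq_cube)
  from DERIV_chain2[OF has_real_derivative_flat_exp this] show ?thesis by (simp add: bump_def)
qed

text \<open>The factor \<open>\<tau>\<^sup>2\<close> absorbs the scale of the chain rule, and what
  remains is the bump of index 2 against which averages are taken later.\<close>

lemma grad_scaled_bump:
  assumes "\<tau> > 0"
  shows "grad (\<lambda>x. \<tau>\<^sup>2 * bump z \<tau> 0 x) x \<bullet> v = - 2 * bump z \<tau> 2 x * ((x - z) \<bullet> v)"
proof -
  have "((\<lambda>x. \<tau>\<^sup>2 * bump z \<tau> 0 x) has_derivative (\<lambda>v. \<tau>\<^sup>2 * ((bump z \<tau> (0 + 2) x - real 0 * bump z \<tau> (0 + 1) x) * (- 2 * ((x - z) \<bullet> v) / \<tau>\<^sup>2)))) (at x)"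
    by (rule has_derivative_mult_right[OF has_derivative_bump])
  then have d: "((\<lambda>x. \<tau>\<^sup>2 * bump z \<tau> 0 x) has_derivative (\<lambda>v. - 2 * bump z \<tau> 2 x * ((x - z) \<bullet> v))) (at x)"
    by (rule has_derivative_eq_rhs) (use assms in \<open>auto simp: fun_eq_iff numeral_2_eq_2\<close>)
  have "grad (\<lambda>x. \<tau>\<^sup>2 * bump z \<tau> 0 x) x \<bullet> v = partial_deriv v (\<lambda>x. \<tau>\<^sup>2 * bump z \<tau> 0 x) x"
    by (rule partial_deriv_grad[symmetric]) (use d in \<open>auto simp: differentiable_def\<close>)
  then show ?thesis by (simp add: partial_deriv_eq[OF d])
qed

lemma laplacian_scaled_bump:
  assumes \<tau>: "\<tau> > 0"
  shows "laplacian (\<lambda>x. \<tau>\<^sup>2 * bump z \<tau> 0 x) (x::'a::euclidean_space) = - 2 * real DIM('a) * bump z \<tau> 2 x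
    + 4 * ((norm (x - z))\<^sup>2 / \<tau>\<^sup>2) * (bump z \<tau> 4 x - 2 * bump z \<tau> 3 x)"
proof -
  let ?\<psi> = "\<lambda>x. \<tau>\<^sup>2 * bump z \<tau> 0 x"
  have p: "partial_deriv b ?\<psi> = (\<lambda>x. - 2 * bump z \<tau> 2 x * ((x - z) \<bullet> b))" for b
  proof
    fix x
    have "?\<psi> differentiable (at x)"
      using has_derivative_mult_right[OF has_derivative_bump[of z \<tau> 0 x]] unfolding differentiable_def by blast
    then show "partial_deriv b ?\<psi> x = - 2 * bump z \<tau> 2 x * ((x - z) \<bullet> b)"
      by (simp only: partial_deriv_grad grad_scaled_bump[OF \<tau>])
  qed
  have pp: "partial_deriv b (partial_deriv b ?\<psi>) x
      = - 2 * bump z \<tau> 2 x + 4 * ((x - z) \<bullet> b)\<^sup>2 / \<tau>\<^sup>2 * (bump z \<tau> 4 x - 2 * bump z \<tau> 3 x)" if b: "b \<in> Basis" for b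
  proof -
    have l: "((\<lambda>x. (x - z) \<bullet> b) has_derivative (\<lambda>v. v \<bullet> b)) (at x)" by (auto intro!: derivative_eq_intros)
    have "partial_deriv b (\<lambda>x. - 2 * bump z \<tau> 2 x * ((x - z) \<bullet> b)) x
      = - 2 * bump z \<tau> 2 x * (b \<bullet> b) + - 2 * ((bump z \<tau> (2 + 2) x - real 2 * bump z \<tau> (2 + 1) x) * (- 2 * ((x - z) \<bullet> b) / \<tau>\<^sup>2)) * ((x - z) \<bullet> b)"
      by (rule partial_deriv_eq[OF has_derivative_mult[OF has_derivative_mult_right[OF has_derivative_bump] l]])
    moreover have "- 2 * B * 1 + - 2 * ((B4 - 2 * B3) * (- 2 * y / t)) * y = - 2 * B + 4 * y\<^sup>2 / t * (B4 - 2 * B3)" for B B4 B3 y t :: real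
      by (cases "t = 0") (simp_all add: field_simps power2_eq_square)
    ultimately show ?thesis using b unfolding p by (simp add: inner_Basis)
  qed
  have "laplacian ?\<psi> x = (\<Sum>b\<in>Basis. - 2 * bump z \<tau> 2 x + 4 * ((x - z) \<bullet> b)\<^sup>2 / \<tau>\<^sup>2 * (bump z \<tau> 4 x - 2 * bump z \<tau> 3 x))"
    unfolding laplacian_def by (rule sum.cong[OF refl pp])
  also have "\<dots> = - 2 * real DIM('a) * bump z \<tau> 2 x + 4 * (\<Sum>b\<in>Basis. ((x - z) \<bullet> b)\<^sup>2) / \<tau>\<^sup>2 * (bump z \<tau> 4 x - 2 * bump z \<tau> 3 x)"
    by (simp add: sum_subtractf sum.distrib sum_distrib_left sum_distrib_right sum_divide_distrib)
  also have "(\<Sum>b\<in>Basis. ((x - z) \<bullet> b)\<^sup>2) = (norm (x - z))\<^sup>2"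
    unfolding power2_norm_eq_inner using euclidean_inner[of "x - z" "x - z"] by (simp add: power2_eq_square)
  finally show ?thesis by simp
qed

section \<open>The Dunkl Laplacian of a bump about its centre and the minimum principle\<close>

context dunkl
begin

text \<open>The roots whose reflections fix \<open>z\<close>.\<close>

definition stab :: "'a \<Rightarrow> 'a set" where "stab z = {\<alpha>\<in>R. \<alpha> \<bullet> z = 0}"

text \<open>The dimension in which a function radial about \<open>z\<close> sees the Dunkl Laplacian near \<open>z\<close>.\<close>

definition local_dim :: "'a \<Rightarrow> real" where "local_dim z = real DIM('a) + (\<Sum>\<alpha>\<in>stab z. k \<alpha>)"

lemma sum_split_stab: "(\<Sum>\<alpha>\<in>R. f \<alpha>) = (\<Sum>\<alpha>\<in>stab z. f \<alpha>) + (\<Sum>\<alpha>\<in>R - stab z. f \<alpha>)" for f :: "'a \<Rightarrow> real"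
  using sum.subset_diff[of "stab z" R f] finite_R by (simp add: stab_def add.commute)

lemma away_from_other_hyperplanes:
  obtains \<rho> where "\<rho> > 0" "\<And>\<alpha> x. \<alpha> \<in> R - stab z \<Longrightarrow> x \<in> cball z \<rho> \<Longrightarrow> \<bar>\<alpha> \<bullet> z\<bar> / 2 \<le> \<bar>\<alpha> \<bullet> x\<bar>"
proof -
  have "\<forall>\<^sub>F x in nhds z. \<bar>\<alpha> \<bullet> z\<bar> / 2 < \<bar>\<alpha> \<bullet> x\<bar>" if "\<alpha> \<in> R - stab z" for \<alpha>
  proof (rule order_tendstoD(1))
    show "((\<lambda>x. \<bar>\<alpha> \<bullet> x\<bar>) \<longlongrightarrow> \<bar>\<alpha> \<bullet> z\<bar>) (nhds z)" by (intro tendsto_intros filterlim_ident)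
    show "\<bar>\<alpha> \<bullet> z\<bar> / 2 < \<bar>\<alpha> \<bullet> z\<bar>" using that by (auto simp: stab_def)
  qed
  then have "\<forall>\<^sub>F x in nhds z. \<forall>\<alpha>\<in>R - stab z. \<bar>\<alpha> \<bullet> z\<bar> / 2 < \<bar>\<alpha> \<bullet> x\<bar>"
    using finite_R by (intro eventually_ball_finite) auto
  then obtain d where d: "d > 0" "\<And>x. dist x z < d \<Longrightarrow> \<forall>\<alpha>\<in>R - stab z. \<bar>\<alpha> \<bullet> z\<bar> / 2 < \<bar>\<alpha> \<bullet> x\<bar>"
    by (auto simp: eventually_nhds_metric)
  show ?thesis
  proof (rule that[of "d / 2"])
    show "\<bar>\<alpha> \<bullet> z\<bar> / 2 \<le> \<bar>\<alpha> \<bullet> x\<bar>" if "\<alpha> \<in> R - stab z" "x \<in> cball z (d / 2)" for \<alpha> x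
      using d(2)[of x] d(1) that by (force simp: dist_commute)
  qed (use d in simp)
qed

text \<open>If \<alpha> is orthogonal to \<open>z\<close>, the bump is invariant under the
  reflection: the jump vanishes and the gradient quotient is exactly
  \<open>- 2 * bump z \<tau> 2 x\<close>, as if \<open>k \<alpha>\<close> dimensions were added. For
  the other roots \<open>\<bar>\<alpha> \<bullet> x\<bar>\<close> is at least
  \<open>\<bar>\<alpha> \<bullet> z\<bar> / 2\<close>, which produces the constants 4 in
  \<open>C1\<close> and 2 in \<open>C2\<close>; the value at the mirror image enters with the good
  sign and is dropped.\<close>

lemma dlap_scaled_bump_lower:
  assumes \<rho>: "\<And>\<alpha> x. \<alpha> \<in> R - stab z \<Longrightarrow> x \<in> cball z \<rho> \<Longrightarrow> \<bar>\<alpha> \<bullet> z\<bar> / 2 \<le> \<bar>\<alpha> \<bullet> x\<bar>"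
    and \<tau>: "0 < \<tau>" "\<tau> \<le> \<rho>" and x: "x \<in> off_hyperplanes R"
  defines "C1 \<equiv> \<Sum>\<alpha>\<in>R - stab z. k \<alpha> * (4 * norm \<alpha> / \<bar>\<alpha> \<bullet> z\<bar>)"
    and "C2 \<equiv> \<Sum>\<alpha>\<in>R - stab z. k \<alpha> * (2 * (norm \<alpha>)\<^sup>2 / (\<alpha> \<bullet> z)\<^sup>2)"
  shows "- dlap (\<lambda>x. \<tau>\<^sup>2 * bump z \<tau> 0 x) x \<le> 2 * local_dim z * bump z \<tau> 2 x
      - 4 * ((norm (x - z))\<^sup>2 / \<tau>\<^sup>2) * (bump z \<tau> 4 x - 2 * bump z \<tau> 3 x)
      + C1 * \<tau> * bump z \<tau> 2 x + C2 * (\<tau>\<^sup>2 * bump z \<tau> 0 x)"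
proof -
  let ?\<psi> = "\<lambda>x. \<tau>\<^sup>2 * bump z \<tau> 0 x"
  have \<psi>0: "0 \<le> ?\<psi> x" for x by (simp add: bump_nonneg)
  have 1: "dunkl_part ?\<psi> \<alpha> x = - 2 * bump z \<tau> 2 x" if \<alpha>: "\<alpha> \<in> stab z" for \<alpha>
  proof -
    have az: "\<alpha> \<bullet> z = 0" "\<alpha> \<in> R" using \<alpha> by (auto simp: stab_def)
    then have ax: "\<alpha> \<bullet> x \<noteq> 0" using x by (simp add: off_hyperplanes_def)
    have "reflection \<alpha> x - z = reflection \<alpha> (x - z)"
      using reflection_add[of \<alpha> "x - z" z] reflection_fixed[OF az(1)] by simp
    then have "norm (reflection \<alpha> x - z) = norm (x - z)" by (simp add: norm_reflection)
    then have e: "?\<psi> x - ?\<psi> (reflection \<alpha> x) = 0" by (simp add: bump_def)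
    have "(x - z) \<bullet> \<alpha> = \<alpha> \<bullet> x" using az by (simp add: inner_diff_left inner_commute[of x \<alpha>] inner_commute[of z \<alpha>])
    then show ?thesis unfolding dunkl_part_def e grad_scaled_bump[OF \<tau>(1)] using ax by simp
  qed
  have 2: "- (4 * norm \<alpha> / \<bar>\<alpha> \<bullet> z\<bar> * (\<tau> * bump z \<tau> 2 x) + 2 * (norm \<alpha>)\<^sup>2 / (\<alpha> \<bullet> z)\<^sup>2 * ?\<psi> x) \<le> dunkl_part ?\<psi> \<alpha> x"
    if \<alpha>: "\<alpha> \<in> R - stab z" for \<alpha>
  proof -
    have az: "\<bar>\<alpha> \<bullet> z\<bar> > 0" using \<alpha> by (auto simp: stab_def)
    have ax: "(\<alpha> \<bullet> x)\<^sup>2 > 0" using x \<alpha> by (simp add: off_hyperplanes_def)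
    have low: "(norm \<alpha>)\<^sup>2 / 2 * ((?\<psi> x - ?\<psi> (reflection \<alpha> x)) / (\<alpha> \<bullet> x)\<^sup>2) \<le> (norm \<alpha>)\<^sup>2 / 2 * (?\<psi> x / (\<alpha> \<bullet> x)\<^sup>2)"
      using \<psi>0[of "reflection \<alpha> x"] by (intro mult_left_mono divide_right_mono) auto
    show ?thesis
    proof (cases "x \<in> ball z \<tau>")
      \<comment> \<open>Here the bump vanishes at \<open>x\<close> but perhaps not at the mirror
        image, so the inequality rests on the sign of the jump.\<close>
      case False
      then have "bump z \<tau> j x = 0" for j using bump_eq_0[OF \<tau>(1)] by blast
      then show ?thesis using low by (simp add: dunkl_part_def grad_scaled_bump[OF \<tau>(1)])
    next
      case True
      then have y: "norm (x - z) \<le> \<tau>" and xc: "x \<in> cball z \<rho>" using \<tau>(2) by (auto simp: dist_norm norm_minus_commute)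
      have c: "\<bar>\<alpha> \<bullet> z\<bar> / 2 \<le> \<bar>\<alpha> \<bullet> x\<bar>" by (rule \<rho>[OF \<alpha> xc])
      have "(\<bar>\<alpha> \<bullet> z\<bar> / 2)\<^sup>2 \<le> \<bar>\<alpha> \<bullet> x\<bar>\<^sup>2" by (rule power_mono[OF c]) simp
      then have c2: "(\<alpha> \<bullet> z)\<^sup>2 / 4 \<le> (\<alpha> \<bullet> x)\<^sup>2" by (simp add: power_divide)
      have b2: "0 \<le> bump z \<tau> 2 x" by (rule bump_nonneg)
      have "\<bar>(grad ?\<psi> x \<bullet> \<alpha>) / (\<alpha> \<bullet> x)\<bar> = 2 * bump z \<tau> 2 x * \<bar>(x - z) \<bullet> \<alpha>\<bar> / \<bar>\<alpha> \<bullet> x\<bar>"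
        using b2 by (simp add: grad_scaled_bump[OF \<tau>(1)] abs_mult)
      also have "\<dots> \<le> 2 * bump z \<tau> 2 x * (\<tau> * norm \<alpha>) / (\<bar>\<alpha> \<bullet> z\<bar> / 2)"
      proof (intro frac_le mult_left_mono c)
        show "\<bar>(x - z) \<bullet> \<alpha>\<bar> \<le> \<tau> * norm \<alpha>"
          using Cauchy_Schwarz_ineq2[of "x - z" \<alpha>] y by (meson mult_right_mono norm_ge_zero order_trans)
      qed (use b2 az \<tau> in auto)
      also have "\<dots> = 4 * norm \<alpha> / \<bar>\<alpha> \<bullet> z\<bar> * (\<tau> * bump z \<tau> 2 x)" by simp
      finally have g: "- (4 * norm \<alpha> / \<bar>\<alpha> \<bullet> z\<bar> * (\<tau> * bump z \<tau> 2 x)) \<le> (grad ?\<psi> x \<bullet> \<alpha>) / (\<alpha> \<bullet> x)"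
        by linarith
      have "(norm \<alpha>)\<^sup>2 / 2 * (?\<psi> x / (\<alpha> \<bullet> x)\<^sup>2) \<le> (norm \<alpha>)\<^sup>2 / 2 * (?\<psi> x / ((\<alpha> \<bullet> z)\<^sup>2 / 4))"
        using c2 az \<psi>0[of x] ax by (intro mult_left_mono divide_left_mono) auto
      also have "\<dots> = 2 * (norm \<alpha>)\<^sup>2 / (\<alpha> \<bullet> z)\<^sup>2 * ?\<psi> x" by simp
      finally show ?thesis using g low unfolding dunkl_part_def by linarith
    qed
  qed
  have "dlap ?\<psi> x = laplacian ?\<psi> x + (\<Sum>\<alpha>\<in>stab z. k \<alpha> * dunkl_part ?\<psi> \<alpha> x) + (\<Sum>\<alpha>\<in>R - stab z. k \<alpha> * dunkl_part ?\<psi> \<alpha> x)"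
    unfolding dlap_def by (simp add: sum_split_stab[of _ z])
  moreover have "(\<Sum>\<alpha>\<in>stab z. k \<alpha> * dunkl_part ?\<psi> \<alpha> x) = (\<Sum>\<alpha>\<in>stab z. k \<alpha>) * (- 2 * bump z \<tau> 2 x)"
    unfolding sum_distrib_right by (rule sum.cong[OF refl]) (simp only: 1)
  moreover have "- (C1 * (\<tau> * bump z \<tau> 2 x) + C2 * ?\<psi> x) \<le> (\<Sum>\<alpha>\<in>R - stab z. k \<alpha> * dunkl_part ?\<psi> \<alpha> x)"
  proof -
    have "- (C1 * (\<tau> * bump z \<tau> 2 x) + C2 * ?\<psi> x)
      = (\<Sum>\<alpha>\<in>R - stab z. k \<alpha> * (- (4 * norm \<alpha> / \<bar>\<alpha> \<bullet> z\<bar> * (\<tau> * bump z \<tau> 2 x) + 2 * (norm \<alpha>)\<^sup>2 / (\<alpha> \<bullet> z)\<^sup>2 * ?\<psi> x)))"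
      unfolding C1_def C2_def sum_distrib_right sum.distrib[symmetric] sum_negf[symmetric]
      by (rule sum.cong) (simp_all add: algebra_simps)
    also have "\<dots> \<le> (\<Sum>\<alpha>\<in>R - stab z. k \<alpha> * dunkl_part ?\<psi> \<alpha> x)"
      using 2 k_pos by (intro sum_mono mult_left_mono) (auto simp: less_imp_le)
    finally show ?thesis .
  qed
  ultimately show ?thesis
    unfolding laplacian_scaled_bump[OF \<tau>(1)] local_dim_def by (simp add: algebra_simps)
qed

text \<open>Each root orthogonal to \<open>z\<close> contributes a factor of order \<tau>, while the
  others are merely bounded. Together with the volume of the ball the exponent becomes
  \<open>local_dim z\<close>, which matches the normalisation of the averages.\<close>

lemma weight_local_bound:
  assumes "\<rho> > 0"
  obtains C where "C \<ge> 0" "\<And>\<tau> x. 0 < \<tau> \<Longrightarrow> \<tau> \<le> \<rho> \<Longrightarrow> x \<in> ball z \<tau> \<Longrightarrow> w x \<le> C * \<tau> powr (\<Sum>\<alpha>\<in>stab z. k \<alpha>)"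
proof -
  define C where "C = (\<Prod>\<alpha>\<in>stab z. norm \<alpha> powr k \<alpha>) * (\<Prod>\<alpha>\<in>R - stab z. ((norm z + \<rho>) * norm \<alpha>) powr k \<alpha>)"
  have "w x \<le> C * \<tau> powr (\<Sum>\<alpha>\<in>stab z. k \<alpha>)" if \<tau>: "0 < \<tau>" "\<tau> \<le> \<rho>" and x: "x \<in> ball z \<tau>" for \<tau> x
  proof -
    have y: "norm (x - z) \<le> \<tau>" using x by (simp add: dist_norm norm_minus_commute)
    have nx: "norm x \<le> norm z + \<rho>" using norm_triangle_ineq[of z "x - z"] y \<tau> by simp
    have s: "finite (stab z)" "stab z \<subseteq> R" using finite_R by (auto simp: stab_def)
    have "w x = (\<Prod>\<alpha>\<in>stab z. \<bar>x \<bullet> \<alpha>\<bar> powr k \<alpha>) * (\<Prod>\<alpha>\<in>R - stab z. \<bar>x \<bullet> \<alpha>\<bar> powr k \<alpha>)"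
      unfolding dunkl_weight_def using prod.subset_diff[OF s(2) finite_R] by (simp add: mult.commute)
    also have "\<dots> \<le> (\<Prod>\<alpha>\<in>stab z. \<tau> powr k \<alpha> * norm \<alpha> powr k \<alpha>) * (\<Prod>\<alpha>\<in>R - stab z. ((norm z + \<rho>) * norm \<alpha>) powr k \<alpha>)"
    proof (intro mult_mono prod_mono conjI)
      fix \<alpha> assume \<alpha>: "\<alpha> \<in> stab z"
      then have "x \<bullet> \<alpha> = (x - z) \<bullet> \<alpha>" by (simp add: stab_def inner_diff_left inner_commute[of z \<alpha>])
      then have "\<bar>x \<bullet> \<alpha>\<bar> \<le> \<tau> * norm \<alpha>"
        using Cauchy_Schwarz_ineq2[of "x - z" \<alpha>] y by (metis mult_right_mono norm_ge_zero order_trans)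
      then have "\<bar>x \<bullet> \<alpha>\<bar> powr k \<alpha> \<le> (\<tau> * norm \<alpha>) powr k \<alpha>"
        using k_pos[of \<alpha>] \<alpha> s by (intro powr_mono2) auto
      then show "\<bar>x \<bullet> \<alpha>\<bar> powr k \<alpha> \<le> \<tau> powr k \<alpha> * norm \<alpha> powr k \<alpha>"
        using \<tau> by (simp add: powr_mult)
    next
      fix \<alpha> assume \<alpha>: "\<alpha> \<in> R - stab z"
      have "\<bar>x \<bullet> \<alpha>\<bar> \<le> (norm z + \<rho>) * norm \<alpha>"
        using Cauchy_Schwarz_ineq2[of x \<alpha>] nx by (meson mult_right_mono norm_ge_zero order_trans)
      then show "\<bar>x \<bullet> \<alpha>\<bar> powr k \<alpha> \<le> ((norm z + \<rho>) * norm \<alpha>) powr k \<alpha>"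
        using k_pos[of \<alpha>] \<alpha> by (intro powr_mono2) auto
    qed (auto intro!: prod_nonneg)
    also have "\<dots> = C * \<tau> powr (\<Sum>\<alpha>\<in>stab z. k \<alpha>)"
      using \<tau> s by (simp add: C_def prod.distrib powr_sum mult_ac)
    finally show ?thesis .
  qed
  moreover have "C \<ge> 0" unfolding C_def by (intro mult_nonneg_nonneg prod_nonneg) auto
  ultimately show ?thesis using that by blast
qed


lemma hom_dim_pos: "hom_dim > 0" and local_dim_pos: "local_dim z > 0"
proof -
  have "0 \<le> sum k A" if "A \<subseteq> R" for A using k_pos that by (intro sum_nonneg) (auto simp: less_imp_le)
  from this[of R] this[of "stab z"] show "hom_dim > 0" "local_dim z > 0"
    using DIM_positive[where 'a='a] by (auto simp: hom_dim_def local_dim_def stab_def intro!: add_pos_nonneg)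
qed

text \<open>Makes the differential inequality for the averages strict. The integrand is positive on
  the ball about \<open>z\<close> off the hyperplanes, which form a null set, while the ball is not
  null.\<close>

lemma weighted_bump_integral_pos:
  assumes r: "r > 0" and \<tau>: "\<tau> > 0" "cball z \<tau> \<subseteq> ball 0 r"
  shows "0 < (LINT x:ball 0 r|lborel. (\<tau>\<^sup>2 * bump z \<tau> 0 x) * w x)"
proof -
  let ?f = "\<lambda>x. indicator (ball 0 r) x *\<^sub>R ((\<tau>\<^sup>2 * bump z \<tau> 0 x) * w x)"
  have test: "test_function (ball 0 r) (\<lambda>x. \<tau>\<^sup>2 * bump z \<tau> 0 x)" by (rule test_function_bump[OF \<tau>])
  have int: "integrable lborel ?f"
    using weak_integrable_mult[OF test r continuous_on_const[of _ 1]] by (simp add: set_integrable_def)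
  have nn: "AE x in lborel. 0 \<le> ?f x"
    by (rule AE_I2) (simp add: indicator_def bump_nonneg weight_nonneg)
  have "integral\<^sup>L lborel ?f \<noteq> 0"
  proof
    assume "integral\<^sup>L lborel ?f = 0"
    then have "AE x in lborel. ?f x = 0" using integral_nonneg_eq_0_iff_AE[OF int nn] by simp
    with AE_off_hyperplanes[OF finite_R zero_notin_R]
    have "AE x in lborel. x \<notin> ball z \<tau>"
    proof eventually_elim
      case (elim x)
      show ?case
      proof
        assume x: "x \<in> ball z \<tau>"
        then have "x \<in> ball 0 r" using \<tau>(2) ball_subset_cball by blast
        then show False
          using elim bump_pos[OF x, of 0] weight_pos[of x] \<tau>(1) by (simp add: indicator_def)
      qed
    qed
    then have "ball z \<tau> \<in> null_sets lborel" by (subst AE_iff_null_sets) auto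
    then have "emeasure lborel (ball z \<tau>) = 0" by auto
    then have "negligible (ball z \<tau>)" by (simp add: negligible_iff_null_sets null_sets_def)
    then show False using open_not_negligible[of "ball z \<tau>"] \<tau>(1) by simp
  qed
  moreover have "0 \<le> integral\<^sup>L lborel ?f" by (rule integral_nonneg_AE[OF nn])
  ultimately show ?thesis unfolding set_lebesgue_integral_def by simp
qed

text \<open>A nonnegative \<open>g\<close> vanishing at \<open>z\<close> cannot be strictly superharmonic near \<open>z\<close>: the averages \<open>Gav\<close> of
  \<open>g\<close> against the bump of width \<open>\<tau>\<close> satisfy \<open>Gav' < C * Gav\<close>, yet tend to 0 as \<open>\<tau>\<close> does.\<close>

lemma strong_minimum_principle:
  assumes r: "r > 0" and g: "continuous_on (ball 0 r) g" "\<And>x. x \<in> ball 0 r \<Longrightarrow> 0 \<le> g x"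
    and z: "z \<in> ball 0 r" "g z = 0" and \<epsilon>: "\<epsilon> > 0" and \<rho>0: "\<rho>\<^sub>0 > 0" "cball z \<rho>\<^sub>0 \<subseteq> ball 0 r"
    and super: "\<And>\<psi>. test_function (ball 0 r) \<psi> \<Longrightarrow> (\<And>x. 0 \<le> \<psi> x) \<Longrightarrow> (\<And>x. x \<notin> ball z \<rho>\<^sub>0 \<Longrightarrow> \<psi> x = 0) \<Longrightarrow>
      (LINT x:ball 0 r|lborel. g x * dunkl_laplacian R k \<psi> x * w x) \<le> - \<epsilon> * (LINT x:ball 0 r|lborel. \<psi> x * w x)"
  shows False
proof -
  define C1 where "C1 = (\<Sum>\<alpha>\<in>R - stab z. k \<alpha> * (4 * norm \<alpha> / \<bar>\<alpha> \<bullet> z\<bar>))"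
  define C2 where "C2 = (\<Sum>\<alpha>\<in>R - stab z. k \<alpha> * (2 * (norm \<alpha>)\<^sup>2 / (\<alpha> \<bullet> z)\<^sup>2))"
  have C: "0 \<le> C1" "0 \<le> C2" unfolding C1_def C2_def
    using k_pos by (auto intro!: sum_nonneg mult_nonneg_nonneg simp: less_imp_le)
  define d where "d = local_dim z"
  have d: "d > 0" by (simp add: d_def local_dim_pos)
  obtain \<rho>1 where \<rho>1: "\<rho>1 > 0" "\<And>\<alpha> x. \<alpha> \<in> R - stab z \<Longrightarrow> x \<in> cball z \<rho>1 \<Longrightarrow> \<bar>\<alpha> \<bullet> z\<bar> / 2 \<le> \<bar>\<alpha> \<bullet> x\<bar>"
    using away_from_other_hyperplanes[where z=z] by metis
  have g_small: "\<exists>\<rho>>0. \<rho> \<le> \<rho>\<^sub>0 \<and> (\<forall>x\<in>ball z \<rho>. g x \<le> s)" if s: "s > 0" for s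
  proof -
    have "isCont g z" using g(1) z(1) continuous_on_eq_continuous_at[OF open_ball] by blast
    then obtain e where e: "e > 0" "\<And>x. dist x z < e \<Longrightarrow> dist (g x) (g z) < s"
      using s unfolding continuous_at_eps_delta by blast
    show ?thesis
    proof (intro exI[of _ "min e \<rho>\<^sub>0"] conjI ballI)
      fix x assume "x \<in> ball z (min e \<rho>\<^sub>0)"
      then have "dist (g x) (g z) < s" using e(2)[of x] by (simp add: dist_commute)
      then show "g x \<le> s" using z(2) by (simp add: dist_real_def)
    qed (use e \<rho>0 in auto)
  qed
  \<comment> \<open>Near \<open>z\<close> the zero-order error \<open>C2 * g\<close> stays below
    \<open>\<epsilon> / 2\<close>, so half of \<epsilon> is left for strictness;
    \<open>C2 + 1\<close> guards against \<open>C2 = 0\<close>.\<close>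
  obtain \<rho>2 where \<rho>2: "\<rho>2 > 0" "\<And>x. x \<in> ball z \<rho>2 \<Longrightarrow> g x \<le> \<epsilon> / (2 * (C2 + 1))"
    using g_small[of "\<epsilon> / (2 * (C2 + 1))"] \<epsilon> C by force
  define \<rho> where "\<rho> = min \<rho>\<^sub>0 (min \<rho>1 \<rho>2)"
  have \<rho>: "\<rho> > 0" "\<rho> \<le> \<rho>\<^sub>0" "\<rho> \<le> \<rho>1" "\<rho> \<le> \<rho>2" using \<rho>0 \<rho>1 \<rho>2 by (auto simp: \<rho>_def)
  have cb: "cball z \<tau> \<subseteq> ball 0 r" if "\<tau> \<le> \<rho>" for \<tau> using \<rho>0(2) \<rho>(2) that by (meson subset_cball order_trans)
  define W where "W = (\<lambda>x. indicator (ball 0 r) x * g x * w x)"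
  have gb: "(\<lambda>x. indicator (ball 0 r) x * g x) \<in> borel_measurable borel"
    using borel_measurable_continuous_on_indicator[OF _ g(1)] by simp
  have [measurable]: "W \<in> borel_measurable borel" unfolding W_def using gb by measurable
  have W0: "0 \<le> W x" for x using g(2)[of x] weight_nonneg[of x] by (simp add: W_def indicator_def)
  have "bdd_fun_on (cball z \<rho>) W" unfolding W_def
  proof (intro bdd_fun_on_mult weight_bdd)
    show "bdd_fun_on (cball z \<rho>) (indicator (ball 0 r))" by (rule bdd_fun_onI[where B=1]) (simp add: indicator_def)
    show "bdd_fun_on (cball z \<rho>) g"
      by (intro bdd_fun_on_compact compact_cball continuous_on_subset[OF g(1)] cb) simp
  qed
  then obtain BW' where BW': "\<forall>x\<in>cball z \<rho>. \<bar>W x\<bar> \<le> BW'" unfolding bdd_fun_on_def ..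
  define BW where "BW = \<bar>BW'\<bar>"
  have BW: "0 \<le> BW" "\<And>x. x \<in> cball z \<rho> \<Longrightarrow> W x \<le> BW" using BW' by (force simp: BW_def)+
  obtain K2 where K2: "K2 \<ge> 0" "\<And>z \<tau> x. bump z \<tau> 2 (x::'a) \<le> K2" using bump_bounded[where j=2] by metis
  obtain K3 where K3: "K3 \<ge> 0" "\<And>z \<tau> x. bump z \<tau> 3 (x::'a) \<le> K3" using bump_bounded[where j=3] by metis
  obtain K4 where K4: "K4 \<ge> 0" "\<And>z \<tau> x. bump z \<tau> 4 (x::'a) \<le> K4" using bump_bounded[where j=4] by metis
  \<comment> \<open>This is \<open>- 2 * \<tau> powr (d + 1)\<close> times the \<tau>-derivative of
    \<open>\<tau> powr (- d) * bump z \<tau> 2 x\<close>, and at the same time the main part of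
    \<open>- dlap\<close> of \<open>\<tau>\<^sup>2 * bump z \<tau> 0\<close>.\<close>
  define H where "H = (\<lambda>\<tau> x. 2 * d * bump z \<tau> 2 x - 4 * ((norm (x - z))\<^sup>2 / \<tau>\<^sup>2) * (bump z \<tau> 4 x - 2 * bump z \<tau> 3 x))"
  have Hm[measurable]: "H \<tau> \<in> borel_measurable borel" for \<tau> unfolding H_def by measurable
  have bz: "bump z \<tau> j x = 0" if "0 < \<tau>" "\<tau> \<le> \<rho>" "x \<notin> cball z \<rho>" for \<tau> j x
    by (rule bump_eq_0[OF that(1)]) (use that in auto)
  have HB: "\<bar>H \<tau> x\<bar> \<le> 2 * d * K2 + 4 * (K4 + 2 * K3)" if \<tau>: "0 < \<tau>" for \<tau> x
  proof (cases "x \<in> ball z \<tau>")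
    case True
    then have "(norm (x - z))\<^sup>2 \<le> \<tau>\<^sup>2" by (intro power_mono) (auto simp: dist_norm norm_minus_commute)
    then have q: "(norm (x - z))\<^sup>2 / \<tau>\<^sup>2 \<le> 1" using \<tau> by simp
    have "\<bar>bump z \<tau> 4 x - 2 * bump z \<tau> 3 x\<bar> \<le> K4 + 2 * K3"
      using K3(2)[of z \<tau> x] K4(2)[of z \<tau> x] bump_nonneg[of z \<tau> 3 x] bump_nonneg[of z \<tau> 4 x] by linarith
    then have "\<bar>4 * ((norm (x - z))\<^sup>2 / \<tau>\<^sup>2) * (bump z \<tau> 4 x - 2 * bump z \<tau> 3 x)\<bar> \<le> 4 * 1 * (K4 + 2 * K3)"
      unfolding abs_mult using q by (intro mult_mono) auto
    moreover have "\<bar>2 * d * bump z \<tau> 2 x\<bar> \<le> 2 * d * K2"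
      using K2(2)[of z \<tau> x] bump_nonneg[of z \<tau> 2 x] d by (simp add: abs_mult)
    ultimately show ?thesis unfolding H_def by linarith
  next
    case False
    then have "bump z \<tau> j x = 0" for j by (rule bump_eq_0[OF \<tau>])
    then show ?thesis using d K2 K3 K4 by (simp add: H_def)
  qed
  define Gav where "Gav = (\<lambda>\<tau>. \<integral>x. \<tau> powr (- d) * bump z \<tau> 2 x * W x \<partial>lborel)"
  define Gav' where "Gav' = (\<lambda>\<tau>. \<integral>x. - (1/2) * \<tau> powr (- d - 1) * H \<tau> x * W x \<partial>lborel)"
  have int2: "integrable lborel (\<lambda>x. bump z \<tau> 2 x * W x)" if \<tau>: "0 < \<tau>" "\<tau> \<le> \<rho>" for \<tau>
  proof (rule integrable_bounded_cball[where z=z and \<rho>=\<rho> and B="K2 * BW"])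
    show "\<bar>bump z \<tau> 2 x * W x\<bar> \<le> K2 * BW" if "x \<in> cball z \<rho>" for x
      unfolding abs_mult using K2(1) K2(2)[of z \<tau> x] W0[of x] BW(2)[OF that] bump_nonneg[of z \<tau> 2 x] by (intro mult_mono) auto
    show "(\<lambda>x. bump z \<tau> 2 x * W x) \<in> borel_measurable borel" by measurable
  qed (use bz \<tau> in auto)
  have intH: "integrable lborel (\<lambda>x. H \<tau> x * W x)" if \<tau>: "0 < \<tau>" "\<tau> \<le> \<rho>" for \<tau>
  proof (rule integrable_bounded_cball[where z=z and \<rho>=\<rho> and B="(2 * d * K2 + 4 * (K4 + 2 * K3)) * BW"])
    show "\<bar>H \<tau> x * W x\<bar> \<le> (2 * d * K2 + 4 * (K4 + 2 * K3)) * BW" if "x \<in> cball z \<rho>" for x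
      unfolding abs_mult using HB[OF \<tau>(1), of x] W0[of x] BW(2)[OF that] K2 K3 K4 d by (intro mult_mono) auto
    show "(\<lambda>x. H \<tau> x * W x) \<in> borel_measurable borel" by measurable
  qed (use bz \<tau> in \<open>auto simp: H_def\<close>)
  have deriv: "(Gav has_real_derivative Gav' \<tau>) (at \<tau>)" if \<tau>: "0 < \<tau>" "\<tau> < \<rho>" for \<tau>
    unfolding Gav_def Gav'_def
  \<comment> \<open>Staying above \<open>\<tau> / 2\<close> bounds the negative power of the
    width.\<close>
  proof (rule has_real_derivative_integral_param(1)[where a="\<tau> / 2" and b=\<rho> and A="cball z \<rho>"
        and B="(1/2) * (\<tau> / 2) powr (- d - 1) * (2 * d * K2 + 4 * (K4 + 2 * K3)) * BW"])
    fix t assume t: "\<tau> / 2 < t" "t < \<rho>"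
    then have t0: "0 < t" using \<tau> by linarith
    show "integrable lborel (\<lambda>x. t powr (- d) * bump z t 2 x * W x)"
      using integrable_mult_right[OF int2[of t], of "t powr (- d)"] t t0 by (simp add: mult.assoc)
    fix x
    have "((\<lambda>\<tau>. \<tau> powr (- d) * bump z \<tau> 2 x) has_real_derivative
        (- d * t powr (- d - 1)) * bump z t 2 x
        + ((bump z t (2 + 2) x - real 2 * bump z t (2 + 1) x) * (2 * (norm (x - z))\<^sup>2 / t ^ 3)) * t powr (- d)) (at t)"
      by (rule DERIV_mult[OF has_real_derivative_powr[OF t0] has_real_derivative_bump_scale[OF t0]])
    moreover have "2 + 2 = (4::nat)" "2 + 1 = (3::nat)" "real 2 = 2" by simp_all
    moreover have "(- d * P) * B2 + ((B4 - 2 * B3) * (2 * y / t ^ 3)) * (P * t) = - (1/2) * P * (2 * d * B2 - 4 * (y / t\<^sup>2) * (B4 - 2 * B3))"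
      for P B2 B4 B3 y :: real using t0 by (simp add: field_simps power2_eq_square power3_eq_cube)
    moreover have "t powr (- d) = t powr (- d - 1) * t" using t0 by (simp add: powr_diff)
    ultimately have "((\<lambda>\<tau>. \<tau> powr (- d) * bump z \<tau> 2 x) has_real_derivative - (1/2) * t powr (- d - 1) * H t x) (at t)"
      by (simp only: H_def)
    then show "((\<lambda>\<tau>. \<tau> powr (- d) * bump z \<tau> 2 x * W x) has_real_derivative - (1/2) * t powr (- d - 1) * H t x * W x) (at t)"
      by (rule DERIV_cmult_right)
    show "\<bar>- (1/2) * t powr (- d - 1) * H t x * W x\<bar>
      \<le> (1/2) * (\<tau> / 2) powr (- d - 1) * (2 * d * K2 + 4 * (K4 + 2 * K3)) * BW * indicator (cball z \<rho>) x"
    proof (cases "x \<in> cball z \<rho>")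
      case False
      then show ?thesis using bz[of t x] t t0 by (simp add: H_def)
    next
      case True
      have "t powr (- d - 1) \<le> (\<tau> / 2) powr (- d - 1)"
        using t \<tau> d by (intro powr_mono2') auto
      then have "\<bar>- (1/2)\<bar> * \<bar>t powr (- d - 1)\<bar> * \<bar>H t x\<bar> * \<bar>W x\<bar> \<le> (1/2) * (\<tau> / 2) powr (- d - 1) * (2 * d * K2 + 4 * (K4 + 2 * K3)) * BW"
        using HB[OF t0, of x] W0[of x] BW(2)[OF True] BW(1) K2(1) K3(1) K4(1) d
        by (intro mult_mono) auto
      then show ?thesis using True by (simp only: abs_mult indicator_simps mult_1_right)
    qed
  qed (use \<tau> emeasure_bounded_finite[of "cball z \<rho>"] in auto)
  have ineq: "Gav' \<tau> < C1 / 2 * Gav \<tau>" if \<tau>: "0 < \<tau>" "\<tau> < \<rho>" for \<tau>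
  proof -
    let ?\<psi> = "\<lambda>x. \<tau>\<^sup>2 * bump z \<tau> 0 x"
    let ?P = "LINT x:ball 0 r|lborel. ?\<psi> x * w x"
    have test: "test_function (ball 0 r) ?\<psi>" by (rule test_function_bump[OF \<tau>(1) cb]) (use \<tau> in simp)
    have P: "0 < ?P" by (rule weighted_bump_integral_pos[OF r \<tau>(1) cb]) (use \<tau> in simp)
    have intP: "integrable lborel (\<lambda>x. indicator (ball 0 r) x *\<^sub>R (?\<psi> x * w x))"
      using weak_integrable_mult[OF test r continuous_on_const[of _ 1]] by (simp add: set_integrable_def)
    have L_eq: "indicator (ball 0 r) x *\<^sub>R (g x * dunkl_laplacian R k ?\<psi> x * w x) = dlap ?\<psi> x * W x" for x
      using dunkl_laplacian_weight[of ?\<psi> x] by (auto simp: W_def mult_ac)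
    have intL: "integrable lborel (\<lambda>x. dlap ?\<psi> x * W x)"
      using weak_integrable_laplacian[OF test r g(1)] by (simp only: set_integrable_def L_eq)
    have "(LINT x:ball 0 r|lborel. g x * dunkl_laplacian R k ?\<psi> x * w x) \<le> - \<epsilon> * ?P"
    proof (rule super[OF test])
      show "?\<psi> x = 0" if "x \<notin> ball z \<rho>\<^sub>0" for x
        using bump_eq_0[OF \<tau>(1), of x z 0] that \<tau> \<rho>(2) by auto
    qed (simp add: bump_nonneg)
    then have "\<epsilon> * ?P \<le> (\<integral>x. - (dlap ?\<psi> x * W x) \<partial>lborel)"
      unfolding set_lebesgue_integral_def L_eq by simp
    also have "\<dots> \<le> (\<integral>x. H \<tau> x * W x + C1 * \<tau> * (bump z \<tau> 2 x * W x) + \<epsilon> / 2 * (indicator (ball 0 r) x *\<^sub>R (?\<psi> x * w x)) \<partial>lborel)"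
    proof (rule integral_mono_AE)
      show "integrable lborel (\<lambda>x. - (dlap ?\<psi> x * W x))" using intL by simp
      show "integrable lborel (\<lambda>x. H \<tau> x * W x + C1 * \<tau> * (bump z \<tau> 2 x * W x) + \<epsilon> / 2 * (indicator (ball 0 r) x *\<^sub>R (?\<psi> x * w x)))"
        using intH[of \<tau>] int2[of \<tau>] intP \<tau> by (intro Bochner_Integration.integrable_add integrable_mult_right) auto
      show "AE x in lborel. - (dlap ?\<psi> x * W x) \<le> H \<tau> x * W x + C1 * \<tau> * (bump z \<tau> 2 x * W x) + \<epsilon> / 2 * (indicator (ball 0 r) x *\<^sub>R (?\<psi> x * w x))"
        using AE_off_hyperplanes[OF finite_R zero_notin_R]
      proof eventually_elim
        case (elim x)
        have "- dlap ?\<psi> x \<le> H \<tau> x + C1 * \<tau> * bump z \<tau> 2 x + C2 * ?\<psi> x"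
          unfolding H_def d_def C1_def C2_def
          by (rule dlap_scaled_bump_lower[OF \<rho>1(2) \<tau>(1) _ elim]) (use \<tau> \<rho> in auto)
        then have "- dlap ?\<psi> x * W x \<le> (H \<tau> x + C1 * \<tau> * bump z \<tau> 2 x + C2 * ?\<psi> x) * W x"
          by (rule mult_right_mono[OF _ W0])
        moreover have "C2 * ?\<psi> x * W x \<le> \<epsilon> / 2 * (indicator (ball 0 r) x *\<^sub>R (?\<psi> x * w x))"
        proof (cases "x \<in> ball z \<tau>")
          case False
          then show ?thesis using bump_eq_0[OF \<tau>(1), of x z 0] by simp
        next
          case True
          then have xr: "x \<in> ball 0 r" and x2: "x \<in> ball z \<rho>2"
            using subsetD[OF cb[of \<tau>], of x] \<tau> \<rho> by simp_all
          have "C2 * g x \<le> C2 * (\<epsilon> / (2 * (C2 + 1)))" using \<rho>2(2)[OF x2] C by (intro mult_left_mono) auto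
          also have "\<dots> \<le> \<epsilon> / 2" using C \<epsilon> by (simp add: field_simps)
          finally have "C2 * g x * (?\<psi> x * w x) \<le> \<epsilon> / 2 * (?\<psi> x * w x)"
            by (rule mult_right_mono) (simp add: bump_nonneg weight_nonneg)
          then show ?thesis using xr by (simp add: W_def mult_ac)
        qed
        ultimately show ?case by (simp only: distrib_right mult.assoc minus_mult_left)
      qed
    qed
    also have "\<dots> = (\<integral>x. H \<tau> x * W x \<partial>lborel) + C1 * \<tau> * (\<integral>x. bump z \<tau> 2 x * W x \<partial>lborel) + \<epsilon> / 2 * ?P"
      using intH[of \<tau>] int2[of \<tau>] intP \<tau> by (simp add: set_lebesgue_integral_def)
    finally have "0 < (\<integral>x. H \<tau> x * W x \<partial>lborel) + C1 * \<tau> * (\<integral>x. bump z \<tau> 2 x * W x \<partial>lborel)"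
      using mult_pos_pos[OF \<epsilon> P] by linarith
    then have "0 < \<tau> powr (- d - 1) * ((\<integral>x. H \<tau> x * W x \<partial>lborel) + C1 * \<tau> * (\<integral>x. bump z \<tau> 2 x * W x \<partial>lborel))"
      using \<tau> by (intro mult_pos_pos) auto
    moreover have "Gav' \<tau> = - (1/2) * \<tau> powr (- d - 1) * (\<integral>x. H \<tau> x * W x \<partial>lborel)"
      by (simp add: Gav'_def mult.assoc)
    moreover have "Gav \<tau> = \<tau> powr (- d - 1) * \<tau> * (\<integral>x. bump z \<tau> 2 x * W x \<partial>lborel)"
      using \<tau> by (simp add: Gav_def mult.assoc powr_diff)
    ultimately show ?thesis by (simp add: algebra_simps)
  qed
  have G0: "0 \<le> Gav \<tau>" for \<tau> unfolding Gav_def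
    by (rule integral_nonneg_AE, rule AE_I2) (intro mult_nonneg_nonneg bump_nonneg W0 powr_ge_zero)
  \<comment> \<open>The integrating factor for \<open>ineq\<close>: \<open>E\<close> is strictly
    decreasing in the width, hence bounded below by a positive number as the width shrinks.\<close>
  define E where "E = (\<lambda>\<tau>. exp (- (C1 / 2) * \<tau>) * Gav \<tau>)"
  have Edec: "E t < E s" if st: "0 < s" "s < t" "t < \<rho>" for s t
  proof (rule DERIV_neg_imp_decreasing[OF st(2)])
    fix x assume x: "s \<le> x" "x \<le> t"
    have "(E has_real_derivative (exp (- (C1 / 2) * x) * (- (C1 / 2))) * Gav x + Gav' x * exp (- (C1 / 2) * x)) (at x)"
      unfolding E_def using x st
      by (intro DERIV_mult deriv DERIV_fun_exp) (auto intro!: derivative_eq_intros)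
    moreover have "(exp (- (C1 / 2) * x) * (- (C1 / 2))) * Gav x + Gav' x * exp (- (C1 / 2) * x) = exp (- (C1 / 2) * x) * (Gav' x - C1 / 2 * Gav x)"
      by (simp add: algebra_simps)
    moreover have "exp (- (C1 / 2) * x) * (Gav' x - C1 / 2 * Gav x) < 0"
      using ineq[of x] x st by (intro mult_pos_neg) auto
    ultimately show "\<exists>y. (E has_real_derivative y) (at x) \<and> y < 0" by (intro exI conjI) (assumption, simp only:)
  qed
  define e where "e = E (\<rho> / 4)"
  have "0 \<le> E (\<rho> / 2)" by (simp add: E_def G0)
  then have e: "e > 0" using Edec[of "\<rho> / 4" "\<rho> / 2"] \<rho> by (simp add: e_def)
  obtain Cw where Cw: "Cw \<ge> 0" "\<And>\<tau> x. 0 < \<tau> \<Longrightarrow> \<tau> \<le> \<rho> \<Longrightarrow> x \<in> ball z \<tau> \<Longrightarrow> w x \<le> Cw * \<tau> powr (\<Sum>\<alpha>\<in>stab z. k \<alpha>)"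
    using weight_local_bound[OF \<rho>(1)] by metis
  define M where "M = K2 * Cw * unit_ball_vol DIM('a)"
  have M: "M \<ge> 0" using K2(1) Cw(1) by (simp add: M_def)
  \<comment> \<open>\<open>M * s\<close> bounds the average over a ball on which \<open>g\<close> is
    at most \<open>s\<close>, since the powers of \<tau> cancel. This \<open>s\<close> puts the
    bound below \<open>e\<close>, whereas \<open>E\<close> exceeds \<open>e\<close> at every width
    below \<open>\<rho> / 4\<close>.\<close>
  define s where "s = e / (2 * (M + 1))"
  have s: "s > 0" using e M by (simp add: s_def)
  obtain \<rho>3 where \<rho>3: "\<rho>3 > 0" "\<And>x. x \<in> ball z \<rho>3 \<Longrightarrow> g x \<le> s" using g_small[OF s] by blast
  define \<tau> where "\<tau> = min \<rho>3 (\<rho> / 8)"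
  have \<tau>: "0 < \<tau>" "\<tau> \<le> \<rho>3" "\<tau> < \<rho> / 4" "\<tau> \<le> \<rho>" using \<rho>3 \<rho> by (auto simp: \<tau>_def)
  have "Gav \<tau> \<le> (\<integral>x. (\<tau> powr (- d) * K2 * s * (Cw * \<tau> powr (\<Sum>\<alpha>\<in>stab z. k \<alpha>))) * indicator (ball z \<tau>) x \<partial>lborel)"
    unfolding Gav_def
  proof (rule integral_mono)
    show "integrable lborel (\<lambda>x. \<tau> powr (- d) * bump z \<tau> 2 x * W x)"
      using integrable_mult_right[OF int2[of \<tau>], of "\<tau> powr (- d)"] \<tau> by (simp add: mult.assoc)
    show "integrable lborel (\<lambda>x. (\<tau> powr (- d) * K2 * s * (Cw * \<tau> powr (\<Sum>\<alpha>\<in>stab z. k \<alpha>))) * indicator (ball z \<tau>) x)"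
      using emeasure_bounded_finite[of "ball z \<tau>"] by (intro integrable_mult_right) (simp add: integrable_indicator_iff)
    fix x
    show "\<tau> powr (- d) * bump z \<tau> 2 x * W x \<le> (\<tau> powr (- d) * K2 * s * (Cw * \<tau> powr (\<Sum>\<alpha>\<in>stab z. k \<alpha>))) * indicator (ball z \<tau>) x"
    proof (cases "x \<in> ball z \<tau>")
      case False
      then show ?thesis using bump_eq_0[OF \<tau>(1), of x z 2] by simp
    next
      case True
      have xr: "x \<in> ball 0 r" using True subsetD[OF cb[OF \<tau>(4)], of x] by simp
      have "W x \<le> s * (Cw * \<tau> powr (\<Sum>\<alpha>\<in>stab z. k \<alpha>))"
        using xr True \<tau> \<rho>3(2)[of x] Cw(2)[OF \<tau>(1,4) True] s g(2)[OF xr] weight_nonneg[of x]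
        unfolding W_def by (auto intro!: mult_mono)
      then have "\<tau> powr (- d) * bump z \<tau> 2 x * W x \<le> \<tau> powr (- d) * K2 * (s * (Cw * \<tau> powr (\<Sum>\<alpha>\<in>stab z. k \<alpha>)))"
        using K2 bump_nonneg[of z \<tau> 2 x] W0[of x] by (intro mult_mono) auto
      then show ?thesis using True by (simp add: mult.assoc)
    qed
  qed
  also have "\<dots> = (\<tau> powr (- d) * K2 * s * (Cw * \<tau> powr (\<Sum>\<alpha>\<in>stab z. k \<alpha>))) * (unit_ball_vol DIM('a) * \<tau> ^ DIM('a))"
    using content_ball[of \<tau> z] \<tau>(1) by simp
  also have "\<dots> = M * s * (\<tau> powr (- d) * \<tau> powr (\<Sum>\<alpha>\<in>stab z. k \<alpha>) * \<tau> powr real DIM('a))"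
    using \<tau>(1) by (simp add: M_def powr_realpow)
  also have "\<tau> powr (- d) * \<tau> powr (\<Sum>\<alpha>\<in>stab z. k \<alpha>) * \<tau> powr real DIM('a) = 1"
    using \<tau>(1) by (simp add: powr_add[symmetric] d_def local_dim_def)
  finally have Gs: "Gav \<tau> \<le> M * s" by simp
  have "E \<tau> \<le> 1 * Gav \<tau>" unfolding E_def using C(1) \<tau>(1) G0 by (intro mult_right_mono) auto
  also have "\<dots> \<le> M * s" using Gs by simp
  also have "\<dots> < e" using e M by (simp add: s_def field_simps) (smt (verit) mult_nonneg_nonneg)
  finally have "E \<tau> < e" .
  moreover have "e < E \<tau>" unfolding e_def by (rule Edec) (use \<tau> \<rho> in auto)
  ultimately show False by simp
qed

text \<open>Since \<open>u\<close> explodes at the sphere while \<open>V\<close> is at most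
  \<open>N\<close>, the perturbed difference attains its maximum inside. Around that point
  \<open>u\<close> lies below \<open>V\<close>, and monotonicity of \<phi> makes the distance to the
  maximum strictly superharmonic in the weak sense, against
  \<open>strong_minimum_principle\<close>.\<close>

theorem comparison_at_origin:
  assumes r: "r > 0" and u: "continuous_on (ball 0 r) u" "\<And>x. x \<in> ball 0 r \<Longrightarrow> u x > 0"
    and weak: "\<And>\<psi>. test_function (ball 0 r) \<psi> \<Longrightarrow>
      (LINT x:ball 0 r|lborel. u x * dunkl_laplacian R k \<psi> x * w x) = (LINT x:ball 0 r|lborel. \<phi> (u x) * \<psi> x * w x)"
    and blowup: "\<And>z. z \<in> sphere 0 r \<Longrightarrow> filterlim u at_top (at z within ball 0 r)"
    and \<phi>: "mono_on {0..} \<phi>" "continuous_on {0..} \<phi>"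
    and contQ: "continuous_on {0..<r} Q"
    and V: "\<And>s. s \<in> {0..<r} \<Longrightarrow> 0 \<le> V s" "\<And>s. s \<in> {0..<r} \<Longrightarrow> V s \<le> N"
    and dV: "\<And>s. s \<in> {0..<r} \<Longrightarrow> (V has_real_derivative s * Q s) (at s within {0..<r})"
    and dQ: "\<And>s. 0 < s \<Longrightarrow> s < r \<Longrightarrow> (Q has_real_derivative (\<phi> (V s) - hom_dim * Q s) / s) (at s)"
    and Z0: "\<phi> (V 0) = hom_dim * Q 0"
  shows "V 0 \<le> u 0"
proof (rule ccontr)
  assume "\<not> V 0 \<le> u 0"
  define h0 where "h0 = V 0 - u 0"
  have h0: "h0 > 0" using \<open>\<not> V 0 \<le> u 0\<close> by (simp add: h0_def)
  \<comment> \<open>With this choice \<open>\<eta> * (norm x)\<^sup>2\<close> is at most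
    \<open>h0 / 2\<close> on the ball, so a maximum of at least \<open>h0\<close> still forces
    \<open>u z < V (norm z)\<close>.\<close>
  define \<eta> where "\<eta> = h0 / (2 * r\<^sup>2)"
  have \<eta>: "\<eta> > 0" "\<eta> * r\<^sup>2 = h0 / 2" using h0 r by (auto simp: \<eta>_def)
  define h where "h = (\<lambda>x. V (norm x) + \<eta> * (norm x)\<^sup>2 - u x)"
  have contV: "continuous_on {0..<r} V"
    using dV by (metis DERIV_continuous continuous_on_eq_continuous_within)
  have rad: "continuous_on (ball 0 r) (\<lambda>x::'a. V (norm x))"
    by (rule continuous_on_compose2[OF contV]) (auto intro: continuous_intros)
  have hc: "continuous_on (ball 0 r) h" unfolding h_def by (intro continuous_intros rad u(1))
  have sq: "\<eta> * (norm x)\<^sup>2 \<le> h0 / 2" if "x \<in> ball 0 r" for x :: 'a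
  proof -
    have "(norm x)\<^sup>2 \<le> r\<^sup>2" using that by (intro power_mono) auto
    then show ?thesis using \<eta> by (metis less_imp_le mult_left_mono)
  qed
  have hh: "h 0 = h0" by (simp add: h_def h0_def)
  \<comment> \<open>Only these points compete with the origin. By the explosion of \<open>u\<close>
    they stay away from the sphere, which is why the set is compact.\<close>
  define S where "S = {x \<in> ball 0 r. h0 \<le> h x}"
  have "closed S" unfolding closed_sequential_limits
  proof (intro allI impI, elim conjE)
    fix X l assume X: "\<forall>n. X n \<in> S" "X \<longlonglongrightarrow> l"
    have Xb: "X n \<in> ball 0 r" "h0 \<le> h (X n)" for n using X(1) by (auto simp: S_def)
    have "norm l \<le> r"
      by (rule LIMSEQ_le_const2[OF tendsto_norm[OF X(2)]]) (use Xb(1) in \<open>auto simp: less_imp_le\<close>)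
    moreover have "norm l \<noteq> r"
    proof
      assume l: "norm l = r"
      have "filterlim X (at l within ball 0 r) sequentially"
        unfolding filterlim_at using X(2) Xb(1) l by (auto intro!: always_eventually)
      moreover have "filterlim u at_top (at l within ball 0 r)" using l by (intro blowup) simp
      ultimately have "filterlim (\<lambda>n. u (X n)) at_top sequentially" by (rule filterlim_compose[rotated])
      then have "\<forall>\<^sub>F n in sequentially. N < u (X n)" by (simp add: filterlim_at_top_dense)
      then obtain n where n: "N < u (X n)" by (auto simp: eventually_sequentially)
      have "V (norm (X n)) \<le> N" using Xb(1)[of n] by (intro V(2)) simp
      then have "h (X n) \<le> h0 / 2 + (N - u (X n))" using sq[OF Xb(1)[of n]] by (simp add: h_def)
      then show False using Xb(2)[of n] n h0 by linarith
    qed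
    ultimately have l: "l \<in> ball 0 r" by simp
    have "(\<lambda>n. h (X n)) \<longlonglongrightarrow> h l"
      by (rule continuous_on_tendsto_compose[OF hc X(2) l]) (use Xb(1) in auto)
    then have "h0 \<le> h l" by (rule LIMSEQ_le_const) (use Xb(2) in auto)
    then show "l \<in> S" using l by (simp add: S_def)
  qed
  moreover have "bounded S" by (rule bounded_subset[OF bounded_ball[of 0 r]]) (auto simp: S_def)
  ultimately have "compact S" by (simp add: compact_eq_bounded_closed)
  moreover have "0 \<in> S" using r hh by (simp add: S_def)
  moreover have "continuous_on S h" by (rule continuous_on_subset[OF hc]) (auto simp: S_def)
  ultimately obtain z where z: "z \<in> S" "\<And>x. x \<in> S \<Longrightarrow> h x \<le> h z"
    using continuous_attains_sup[of S h] by blast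
  have zb: "z \<in> ball 0 r" and hz: "h0 \<le> h z" using z(1) by (auto simp: S_def)
  have max: "h x \<le> h z" if "x \<in> ball 0 r" for x
    using z(2)[of x] hz that by (cases "h0 \<le> h x") (auto simp: S_def)
  define g where "g = (\<lambda>x. h z - h x)"
  have gc: "continuous_on (ball 0 r) g" unfolding g_def by (intro continuous_intros hc)
  have "V (norm z) - u z > 0" using hz sq[OF zb] h0 by (simp add: h_def)
  moreover have "isCont (\<lambda>x. V (norm x) - u x) z"
    using continuous_on_diff[OF rad u(1)] zb continuous_on_eq_continuous_at[OF open_ball] by blast
  ultimately have "\<forall>\<^sub>F x in at z. 0 < V (norm x) - u x"
    unfolding isCont_def by (rule order_tendstoD(1)[rotated])
  with \<open>V (norm z) - u z > 0\<close> have "\<forall>\<^sub>F x in nhds z. 0 < V (norm x) - u x"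
    by (simp add: eventually_nhds_conv_at)
  moreover have "\<forall>\<^sub>F x in nhds z. x \<in> ball 0 r" using zb by (intro eventually_nhds_in_open) auto
  ultimately have "\<forall>\<^sub>F x in nhds z. 0 < V (norm x) - u x \<and> x \<in> ball 0 r" by (rule eventually_conj)
  then obtain e where e: "e > 0" "\<And>x. dist x z < e \<Longrightarrow> 0 < V (norm x) - u x \<and> x \<in> ball 0 r"
    by (auto simp: eventually_nhds_metric)
  show False
  proof (rule strong_minimum_principle[OF r gc _ zb _ _ _ _, where \<epsilon>="2 * hom_dim * \<eta>" and \<rho>\<^sub>0="e / 2"])
    show "0 \<le> g x" if "x \<in> ball 0 r" for x using max[OF that] by (simp add: g_def)
    show "g z = 0" by (simp add: g_def)
    show "0 < 2 * hom_dim * \<eta>" using hom_dim_pos \<eta> by simp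
    show "0 < e / 2" using e by simp
    show "cball z (e / 2) \<subseteq> ball 0 r" using e by (force simp: dist_commute)
    fix \<psi> assume \<psi>: "test_function (ball 0 r) \<psi>" "\<And>x. 0 \<le> \<psi> x" "\<And>x. x \<notin> ball z (e / 2) \<Longrightarrow> \<psi> x = 0"
    let ?L = "dunkl_laplacian R k \<psi>"
    have phiu: "continuous_on (ball 0 r) (\<lambda>x. \<phi> (u x))"
      by (rule continuous_on_compose2[OF \<phi>(2) u(1)]) (use u(2) in \<open>force intro: less_imp_le\<close>)
    have phiV: "continuous_on {0..<r} (\<lambda>s. \<phi> (V s))"
      by (rule continuous_on_compose2[OF \<phi>(2) contV]) (use V(1) in auto)
    have phiVn: "continuous_on (ball 0 r) (\<lambda>x::'a. \<phi> (V (norm x)))"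
      by (rule continuous_on_compose2[OF phiV]) (auto intro: continuous_intros)
    let ?V1 = "\<lambda>s. V s + \<eta> * s\<^sup>2" and ?Z1 = "\<lambda>s. \<phi> (V s) + 2 * hom_dim * \<eta>"
    \<comment> \<open>The added square has the radial derivative \<open>2 * \<eta> * s\<close>,
      hence \<open>2 * \<eta>\<close> in \<open>Q\<close>, and the Dunkl Laplacian
      \<open>2 * hom_dim * \<eta>\<close>.\<close>
    have A: "(LINT x:ball 0 r|lborel. ?V1 (norm x) * ?L x * w x) = (LINT x:ball 0 r|lborel. ?Z1 (norm x) * \<psi> x * w x)"
    proof (rule green_radial[OF \<psi>(1) r, where Q="\<lambda>s. Q s + 2 * \<eta>"])
      show "continuous_on {0..<r} (\<lambda>s. Q s + 2 * \<eta>)" by (intro continuous_intros contQ)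
      show "continuous_on {0..<r} ?Z1" by (intro continuous_intros phiV)
      show "(?V1 has_real_derivative s * (Q s + 2 * \<eta>)) (at s within {0..<r})" if s: "s \<in> {0..<r}" for s
        by (rule DERIV_cong[OF DERIV_add[OF dV[OF s] DERIV_cmult[OF DERIV_power[OF DERIV_ident, where n=2]]]])
          (simp add: algebra_simps)
      show "((\<lambda>s. Q s + 2 * \<eta>) has_real_derivative (?Z1 s - hom_dim * (Q s + 2 * \<eta>)) / s) (at s)" if "0 < s" "s < r" for s
        by (rule DERIV_cong[OF DERIV_add[OF dQ[OF that] DERIV_const]]) (simp add: algebra_simps)
      show "?Z1 0 = hom_dim * (Q 0 + 2 * \<eta>)" using Z0 by (simp add: algebra_simps)
    qed
    \<comment> \<open>Constants have Dunkl Laplacian 0, so subtracting from the maximum value leaves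
      the weak identity intact.\<close>
    have B: "(LINT x:ball 0 r|lborel. h z * ?L x * w x) = (LINT x:ball 0 r|lborel. 0 * \<psi> x * w x)"
      by (rule green_radial[OF \<psi>(1) r, where Q="\<lambda>_. 0" and V="\<lambda>_. h z" and Z="\<lambda>_. 0"]) auto
    have iV: "set_integrable lborel (ball 0 r) (\<lambda>x. ?V1 (norm x) * ?L x * w x)"
      by (rule weak_integrable_laplacian[OF \<psi>(1) r]) (intro continuous_intros rad)
    have iu: "set_integrable lborel (ball 0 r) (\<lambda>x. u x * ?L x * w x)" by (rule weak_integrable_laplacian[OF \<psi>(1) r u(1)])
    have ic: "set_integrable lborel (ball 0 r) (\<lambda>x. h z * ?L x * w x)" by (rule weak_integrable_laplacian[OF \<psi>(1) r]) simp
    have iZ: "set_integrable lborel (ball 0 r) (\<lambda>x. ?Z1 (norm x) * \<psi> x * w x)"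
      by (rule weak_integrable_mult[OF \<psi>(1) r]) (intro continuous_intros phiVn)
    have ip: "set_integrable lborel (ball 0 r) (\<lambda>x. \<phi> (u x) * \<psi> x * w x)" by (rule weak_integrable_mult[OF \<psi>(1) r phiu])
    have i1: "set_integrable lborel (ball 0 r) (\<lambda>x. \<psi> x * w x)"
      using weak_integrable_mult[OF \<psi>(1) r continuous_on_const[of _ 1]] by simp
    have "(LINT x:ball 0 r|lborel. g x * ?L x * w x)
      = (LINT x:ball 0 r|lborel. (h z * ?L x * w x - ?V1 (norm x) * ?L x * w x) + u x * ?L x * w x)"
      by (simp add: g_def h_def algebra_simps)
    also have "\<dots> = (LINT x:ball 0 r|lborel. h z * ?L x * w x) - (LINT x:ball 0 r|lborel. ?V1 (norm x) * ?L x * w x)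
        + (LINT x:ball 0 r|lborel. u x * ?L x * w x)"
      by (simp only: set_integral_add[OF set_integral_diff(1)[OF ic iV] iu] set_integral_diff[OF ic iV])
    also have "\<dots> = (LINT x:ball 0 r|lborel. \<phi> (u x) * \<psi> x * w x) - (LINT x:ball 0 r|lborel. ?Z1 (norm x) * \<psi> x * w x)"
      unfolding A B weak[OF \<psi>(1)] by simp
    also have "\<dots> = (LINT x:ball 0 r|lborel. \<phi> (u x) * \<psi> x * w x - ?Z1 (norm x) * \<psi> x * w x)"
      by (rule set_integral_diff(2)[OF ip iZ, symmetric])
    also have "\<dots> \<le> (LINT x:ball 0 r|lborel. (- (2 * hom_dim * \<eta>)) * (\<psi> x * w x))"
    proof (rule set_integral_mono)
      show "set_integrable lborel (ball 0 r) (\<lambda>x. \<phi> (u x) * \<psi> x * w x - ?Z1 (norm x) * \<psi> x * w x)"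
        by (rule set_integral_diff(1)[OF ip iZ])
      show "set_integrable lborel (ball 0 r) (\<lambda>x. (- (2 * hom_dim * \<eta>)) * (\<psi> x * w x))"
        by (rule set_integrable_mult_right[OF i1])
      fix x :: 'a assume x: "x \<in> ball 0 r"
      show "\<phi> (u x) * \<psi> x * w x - ?Z1 (norm x) * \<psi> x * w x \<le> (- (2 * hom_dim * \<eta>)) * (\<psi> x * w x)"
      proof (cases "x \<in> ball z (e / 2)")
        case False
        then show ?thesis using \<psi>(3) by simp
      next
        case True
        then have "dist x z < e" using e(1) by (simp add: dist_commute)
        then have "u x \<le> V (norm x)" using e(2)[of x] by simp
        then have "\<phi> (u x) \<le> \<phi> (V (norm x))" using u(2)[OF x] by (intro mono_onD[OF \<phi>(1)]) auto
        then have "(\<phi> (u x) - \<phi> (V (norm x))) * (\<psi> x * w x) \<le> 0"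
          using \<psi>(2)[of x] weight_nonneg[of x] by (intro mult_nonpos_nonneg) auto
        then show ?thesis by (simp add: algebra_simps)
      qed
    qed
    also have "\<dots> = - (2 * hom_dim * \<eta>) * (LINT x:ball 0 r|lborel. \<psi> x * w x)"
      by (rule set_integral_mult_right)
    finally show "(LINT x:ball 0 r|lborel. g x * ?L x * w x) \<le> - (2 * hom_dim * \<eta>) * (LINT x:ball 0 r|lborel. \<psi> x * w x)" .
  qed
qed

end

section \<open>The radial equation\<close>

locale radial_ode =
  fixes m :: real and \<phi> :: "real \<Rightarrow> real"
  assumes m: "m > 1" and phi_cont: "continuous_on {0..} \<phi>" and phi_mono: "mono_on {0..} \<phi>"
    and phi_nonneg: "\<And>t. t \<ge> 0 \<Longrightarrow> 0 \<le> \<phi> t"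
begin

text \<open>The integral of \<open>t powr (m - 1) * f t\<close> over \<open>{0..s}\<close> divided
  by \<open>s powr m\<close>, in rescaled form so that \<open>s = 0\<close> is not
  exceptional.\<close>

definition J :: "(real \<Rightarrow> real) \<Rightarrow> real \<Rightarrow> real" where
  "J f s = integral {0..1} (\<lambda>q. q powr (m - 1) * f (s * q))"

text \<open>The integral form of the radial equation: the outer integrand plays the role of
  \<open>v'\<close>, and \<open>s powr (m - 1) * v'\<close> is the integral of
  \<open>t powr (m - 1) * \<phi> (v t)\<close>.\<close>

definition T :: "real \<Rightarrow> (real \<Rightarrow> real) \<Rightarrow> real \<Rightarrow> real" where
  "T c v s = c + integral {0..s} (\<lambda>\<tau>. \<tau> * J (\<lambda>t. \<phi> (v t)) \<tau>)"

lemma powr_cont: "continuous_on {0..} (\<lambda>q::real. q powr (m - 1))"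
  using m by (intro continuous_on_powr' continuous_intros) auto

lemma powr_has_integral: "((\<lambda>q. q powr (m - 1)) has_integral 1 / m) {0..1}"
  using has_integral_powr_from_0[of "m - 1" 1] m by simp

lemma scaled_range: "0 \<le> s \<Longrightarrow> q \<in> {0..1} \<Longrightarrow> s * q \<in> {0..s}" for s q :: real
  by (auto intro: mult_left_le)

lemma J_integrable:
  assumes "continuous_on {0..s} f" "0 \<le> s"
  shows "(\<lambda>q. q powr (m - 1) * f (s * q)) integrable_on {0..1}"
proof (rule integrable_continuous_real, rule continuous_on_mult)
  show "continuous_on {0..1} (\<lambda>q. q powr (m - 1))" by (rule continuous_on_subset[OF powr_cont]) auto
  show "continuous_on {0..1} (\<lambda>q. f (s * q))"
    by (rule continuous_on_compose2[OF assms(1)]) (use scaled_range[OF assms(2)] in \<open>auto intro!: continuous_intros\<close>)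
qed

lemma J_mono:
  assumes "continuous_on {0..s} f" "continuous_on {0..s} g" "0 \<le> s" "\<And>t. t \<in> {0..s} \<Longrightarrow> f t \<le> g t"
  shows "J f s \<le> J g s"
  unfolding J_def using assms scaled_range[OF assms(3)]
  by (intro integral_le J_integrable mult_left_mono) auto

lemma J_const: "J (\<lambda>_. C) s = C / m"
  unfolding J_def by (rule integral_unique) (use has_integral_mult_left[OF powr_has_integral, of C] in simp)

lemma J_add: "continuous_on {0..s} f \<Longrightarrow> continuous_on {0..s} g \<Longrightarrow> 0 \<le> s \<Longrightarrow> J (\<lambda>t. f t + g t) s = J f s + J g s"
  unfolding J_def distrib_left by (rule integral_add[OF J_integrable J_integrable])

lemma J_at_0: "J f 0 = f 0 / m"
  using J_const[of "f 0" 0] by (simp add: J_def)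

lemma J_cont:
  assumes "continuous_on {0..a} f"
  shows "continuous_on {0..a} (J f)"
proof -
  have "continuous_on ({0..a} \<times> cbox 0 1) (\<lambda>(s, q). q powr (m - 1) * f (s * q))"
    unfolding case_prod_beta
  proof (rule continuous_on_mult)
    show "continuous_on ({0..a} \<times> cbox 0 1) (\<lambda>x. snd x powr (m - 1))"
      by (rule continuous_on_compose2[OF powr_cont]) (auto intro!: continuous_intros)
    show "continuous_on ({0..a} \<times> cbox 0 1) (\<lambda>x. f (fst x * snd x))"
    proof (rule continuous_on_compose2[OF assms])
      show "(\<lambda>x. fst x * snd x) ` ({0..a} \<times> cbox 0 1) \<subseteq> {0..a}"
      proof (rule image_subsetI)
        fix x :: "real \<times> real" assume "x \<in> {0..a} \<times> cbox 0 1"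
        then have x: "fst x \<in> {0..a}" "snd x \<in> {0..1}" by auto
        then have "fst x * snd x \<le> fst x" by (intro mult_left_le) auto
        then show "fst x * snd x \<in> {0..a}" using x by auto
      qed
    qed (auto intro!: continuous_intros)
  qed
  from integral_continuous_on_param[OF this] show ?thesis by (simp add: J_def[abs_def])
qed

lemma J_limit:
  assumes "\<And>n. continuous_on {0..s} (f n)" "0 \<le> s" "\<And>n t. t \<in> {0..s} \<Longrightarrow> \<bar>f n t\<bar> \<le> B"
    "\<And>t. t \<in> {0..s} \<Longrightarrow> (\<lambda>n. f n t) \<longlonglongrightarrow> g t"
  shows "(\<lambda>n. J (f n) s) \<longlonglongrightarrow> J g s"
  unfolding J_def
proof (rule dominated_convergence(2)[where h="\<lambda>_. B"])
  fix n show "(\<lambda>q. q powr (m - 1) * f n (s * q)) integrable_on {0..1}" by (rule J_integrable[OF assms(1,2)])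
  fix q :: real assume q: "q \<in> {0..1}"
  have "q powr (m - 1) \<le> 1" using q m by (intro powr_le1) auto
  then show "norm (q powr (m - 1) * f n (s * q)) \<le> B"
    using assms(3)[OF scaled_range[OF assms(2) q], of n] by (simp add: abs_mult mult_left_le_one_le order_trans[OF mult_left_le_one_le])
next
  show "(\<lambda>n. q powr (m - 1) * f n (s * q)) \<longlonglongrightarrow> q powr (m - 1) * g (s * q)" if "q \<in> {0..1}" for q
    by (intro tendsto_intros assms(4) scaled_range assms(2) that)
qed auto

lemma J_unscaled:
  assumes f: "continuous_on {0..s} f" and s: "0 < s"
  shows "J f s = s powr (- m) * integral {0..s} (\<lambda>t. t powr (m - 1) * f t)"
proof -
  have "continuous_on {0..s} (\<lambda>t. t powr (m - 1) * f t)"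
    by (intro continuous_on_mult f continuous_on_subset[OF powr_cont]) auto
  then have "((\<lambda>t. t powr (m - 1) * f t) has_integral integral {0..s} (\<lambda>t. t powr (m - 1) * f t)) {0..s}"
    by (simp add: integrable_continuous_real integrable_integral)
  from has_integral_stretch_real[OF this, of s] s
  have "((\<lambda>q. (s * q) powr (m - 1) * f (s * q)) has_integral (1 / s) * integral {0..s} (\<lambda>t. t powr (m - 1) * f t)) {0..1}"
    by (simp add: image_divide_atLeastAtMost)
  then have "((\<lambda>q. s powr (m - 1) * (q powr (m - 1) * f (s * q))) has_integral (1 / s) * integral {0..s} (\<lambda>t. t powr (m - 1) * f t)) {0..1}"
    by (rule has_integral_eq[rotated]) (use s in \<open>auto simp: powr_mult\<close>)
  from integral_unique[OF this] have "s powr (m - 1) * J f s = (1 / s) * integral {0..s} (\<lambda>t. t powr (m - 1) * f t)"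
    by (simp add: J_def)
  then have I: "integral {0..s} (\<lambda>t. t powr (m - 1) * f t) = s * (s powr (m - 1) * J f s)"
    using s by (simp add: field_simps)
  have "s powr (- m) * s * s powr (m - 1) = 1"
    using s by (simp add: powr_minus powr_diff field_simps)
  then have "s powr (- m) * (s * (s powr (m - 1) * J f s)) = J f s"
    by (simp only: mult.assoc[symmetric] mult_1_left)
  then show ?thesis unfolding I by simp
qed

text \<open>By \<open>J_unscaled\<close> this is the product rule for a power and an indefinite
  integral.\<close>

lemma J_deriv:
  assumes f: "continuous_on {0..<a} f" and s: "0 < s" "s < a"
  shows "(J f has_real_derivative (f s - m * J f s) / s) (at s)"
proof -
  define b where "b = (s + a) / 2"
  have b: "s < b" "b < a" using s by (auto simp: b_def)
  define Y where "Y = (\<lambda>x. integral {0..x} (\<lambda>t. t powr (m - 1) * f t))"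
  have fb: "continuous_on {0..b} f" by (rule continuous_on_subset[OF f]) (use b in auto)
  have "continuous_on {0..b} (\<lambda>t. t powr (m - 1) * f t)"
    by (intro continuous_on_mult fb continuous_on_subset[OF powr_cont]) auto
  then have "(Y has_real_derivative s powr (m - 1) * f s) (at s within {0..b})"
    unfolding Y_def by (rule integral_has_real_derivative) (use s b in auto)
  then have Y: "(Y has_real_derivative s powr (m - 1) * f s) (at s)"
    using at_within_interior[of s "{0..b}"] s b by simp
  have "((\<lambda>x. x powr (- m) * Y x) has_real_derivative
      (- m * s powr (- m - 1)) * Y s + (s powr (m - 1) * f s) * s powr (- m)) (at s)"
    by (rule DERIV_mult[OF has_real_derivative_powr[OF s(1)] Y])
  moreover have "(- m * s powr (- m - 1)) * Y s + (s powr (m - 1) * f s) * s powr (- m) = (f s - m * J f s) / s"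
  proof -
    have "J f s = s powr (- m) * Y s"
      unfolding Y_def by (rule J_unscaled[OF continuous_on_subset[OF fb]]) (use s b in auto)
    moreover have "s powr (- m - 1) = s powr (- m) / s" using s by (simp add: powr_diff)
    moreover have "s powr (m - 1) * f s * s powr (- m) = f s / s"
      using s by (simp add: powr_minus powr_diff field_simps)
    ultimately show ?thesis by (simp add: diff_divide_distrib)
  qed
  ultimately have "((\<lambda>x. x powr (- m) * Y x) has_real_derivative (f s - m * J f s) / s) (at s)" by simp
  then show ?thesis
  proof (rule has_field_derivative_transform_within_open[where S="{0<..<b}"])
    show "x powr (- m) * Y x = J f x" if "x \<in> {0<..<b}" for x
      unfolding Y_def by (rule J_unscaled[symmetric, OF continuous_on_subset[OF fb]]) (use that in auto)
  qed (use s b in auto)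
qed

lemma phi_compose_cont:
  assumes "continuous_on S v" "\<And>t. t \<in> S \<Longrightarrow> 0 \<le> v t"
  shows "continuous_on S (\<lambda>t. \<phi> (v t))"
  by (rule continuous_on_compose2[OF phi_cont assms(1)]) (use assms(2) in auto)

lemma phi_le: "0 \<le> x \<Longrightarrow> x \<le> y \<Longrightarrow> \<phi> x \<le> \<phi> y"
  using phi_mono by (auto simp: mono_on_def)

lemma integrand_cont:
  assumes "continuous_on {0..a} v" "\<And>t. t \<in> {0..a} \<Longrightarrow> 0 \<le> v t"
  shows "continuous_on {0..a} (\<lambda>\<tau>. \<tau> * J (\<lambda>t. \<phi> (v t)) \<tau>)"
  by (intro continuous_intros J_cont phi_compose_cont assms)

lemma J_phi_nonneg:
  assumes "continuous_on {0..s} v" "\<And>t. t \<in> {0..s} \<Longrightarrow> 0 \<le> v t" "0 \<le> s"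
  shows "0 \<le> J (\<lambda>t. \<phi> (v t)) s"
  using J_mono[of s "\<lambda>_. 0" "\<lambda>t. \<phi> (v t)"] phi_compose_cont[OF assms(1,2)] assms phi_nonneg J_const[of 0 s] by simp

lemma T_cont:
  assumes "continuous_on {0..a} v" "\<And>t. t \<in> {0..a} \<Longrightarrow> 0 \<le> v t"
  shows "continuous_on {0..a} (T c v)"
  unfolding T_def[abs_def]
  by (intro continuous_intros indefinite_integral_continuous_1 integrable_continuous_real integrand_cont assms)

lemma T_mono:
  assumes "continuous_on {0..s} v" "continuous_on {0..s} v'" "\<And>t. t \<in> {0..s} \<Longrightarrow> 0 \<le> v t"
    "\<And>t. t \<in> {0..s} \<Longrightarrow> v t \<le> v' t" "c \<le> c'" "0 \<le> s"
  shows "T c v s \<le> T c' v' s"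
  unfolding T_def
proof (rule add_mono[OF assms(5)], rule integral_le)
  have pos: "0 \<le> v' t" if "t \<in> {0..s}" for t
    by (rule order_trans[OF assms(3)[OF that] assms(4)[OF that]])
  show "(\<lambda>\<tau>. \<tau> * J (\<lambda>t. \<phi> (v t)) \<tau>) integrable_on {0..s}" "(\<lambda>\<tau>. \<tau> * J (\<lambda>t. \<phi> (v' t)) \<tau>) integrable_on {0..s}"
    by (intro integrable_continuous_real integrand_cont assms pos; assumption)+
  fix \<tau> assume \<tau>: "\<tau> \<in> {0..s}"
  have sub: "{0..\<tau>} \<subseteq> {0..s}" using \<tau> by auto
  have "J (\<lambda>t. \<phi> (v t)) \<tau> \<le> J (\<lambda>t. \<phi> (v' t)) \<tau>"
    by (intro J_mono continuous_on_subset[OF phi_compose_cont sub] assms(1,2) phi_le assms(3,4) pos)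
      (use \<tau> sub in auto)
  then show "\<tau> * J (\<lambda>t. \<phi> (v t)) \<tau> \<le> \<tau> * J (\<lambda>t. \<phi> (v' t)) \<tau>" using \<tau> by (intro mult_left_mono) auto
qed

lemma T_mono_arg:
  assumes "continuous_on {0..s'} v" "\<And>t. t \<in> {0..s'} \<Longrightarrow> 0 \<le> v t" "0 \<le> s" "s \<le> s'"
  shows "T c v s \<le> T c v s'"
proof -
  have "integral {0..s} (\<lambda>\<tau>. \<tau> * J (\<lambda>t. \<phi> (v t)) \<tau>) \<le> integral {0..s'} (\<lambda>\<tau>. \<tau> * J (\<lambda>t. \<phi> (v t)) \<tau>)"
  proof (rule integral_subset_le)
    show "(\<lambda>\<tau>. \<tau> * J (\<lambda>t. \<phi> (v t)) \<tau>) integrable_on {0..s'}"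
      by (intro integrable_continuous_real integrand_cont assms)
    then show "(\<lambda>\<tau>. \<tau> * J (\<lambda>t. \<phi> (v t)) \<tau>) integrable_on {0..s}"
      by (rule integrable_on_subinterval) (use assms in auto)
    show "\<forall>\<tau>\<in>{0..s'}. 0 \<le> \<tau> * J (\<lambda>t. \<phi> (v t)) \<tau>"
    proof (intro ballI mult_nonneg_nonneg J_phi_nonneg)
      fix \<tau> assume that: "\<tau> \<in> {0..s'}"
      show "continuous_on {0..\<tau>} v" by (rule continuous_on_subset[OF assms(1)]) (use that in auto)
    qed (use assms(2) in auto)
  qed (use assms in auto)
  then show ?thesis by (simp add: T_def)
qed

lemma T_at_0: "T c v 0 = c" by (simp add: T_def)

text \<open>Dominated convergence in both integrals. The limit \<open>w\<close> is not yet known to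
  be continuous, hence the separate claim of integrability, from which continuity of
  \<open>T c' w\<close> is recovered later.\<close>

lemma T_limit:
  assumes "\<And>n. continuous_on {0..a} (v n)" "0 \<le> s" "s \<le> a" "\<And>n t. t \<in> {0..a} \<Longrightarrow> 0 \<le> v n t \<and> v n t \<le> B"
    "\<And>t. t \<in> {0..a} \<Longrightarrow> (\<lambda>n. v n t) \<longlonglongrightarrow> w t" "c \<longlonglongrightarrow> c'"
  shows "(\<lambda>n. T (c n) (v n) s) \<longlonglongrightarrow> T c' w s"
    and "(\<lambda>\<tau>. \<tau> * J (\<lambda>t. \<phi> (w t)) \<tau>) integrable_on {0..s}"
proof -
  have w: "0 \<le> w t" if "t \<in> {0..a}" for t
    by (rule LIMSEQ_le_const[OF assms(5)[OF that]]) (use assms(4)[OF that] in simp)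
  have phi_lim: "(\<lambda>n. \<phi> (v n t)) \<longlonglongrightarrow> \<phi> (w t)" if t: "t \<in> {0..a}" for t
    by (rule continuous_on_tendsto_compose[OF phi_cont assms(5)[OF t]])
      (use w[OF t] assms(4)[OF t] in auto)
  have bnd: "\<bar>\<phi> (v n t)\<bar> \<le> \<phi> B" if t: "t \<in> {0..a}" for n t
    using assms(4)[OF t, of n] phi_nonneg[of "v n t"] phi_le[of "v n t" B] by simp
  have cont: "continuous_on {0..a} (\<lambda>t. \<phi> (v n t))" for n
    by (rule phi_compose_cont[OF assms(1)]) (use assms(4) in auto)
  have Jl: "(\<lambda>n. J (\<lambda>t. \<phi> (v n t)) \<tau>) \<longlonglongrightarrow> J (\<lambda>t. \<phi> (w t)) \<tau>" if "\<tau> \<in> {0..s}" for \<tau>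
    by (rule J_limit[where B="\<phi> B"]) (use that assms(2,3) phi_lim bnd in \<open>auto intro: continuous_on_subset[OF cont]\<close>)
  have Jb: "\<bar>J (\<lambda>t. \<phi> (v n t)) \<tau>\<bar> \<le> \<phi> B / m" if "\<tau> \<in> {0..s}" for \<tau> n
  proof -
    have sub: "{0..\<tau>} \<subseteq> {0..a}" using that assms(3) by auto
    have "J (\<lambda>t. \<phi> (v n t)) \<tau> \<le> J (\<lambda>t. \<phi> B) \<tau>"
      by (rule J_mono[OF continuous_on_subset[OF cont sub]]) (use that sub bnd[of _ n] in \<open>auto intro: order_trans[OF abs_ge_self]\<close>)
    moreover have "0 \<le> J (\<lambda>t. \<phi> (v n t)) \<tau>"
      using that assms(4) sub by (intro J_phi_nonneg continuous_on_subset[OF assms(1) sub]) auto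
    ultimately show ?thesis by (simp add: J_const)
  qed
  have dom: "norm (\<tau> * J (\<lambda>t. \<phi> (v n t)) \<tau>) \<le> s * (\<phi> B / m)" if "\<tau> \<in> {0..s}" for \<tau> n
    unfolding real_norm_def abs_mult by (rule mult_mono[OF _ Jb[OF that]]) (use that assms(2) in auto)
  have int: "(\<lambda>\<tau>. \<tau> * J (\<lambda>t. \<phi> (v n t)) \<tau>) integrable_on {0..s}" for n
    by (intro integrable_continuous_real continuous_on_mult continuous_on_id J_cont continuous_on_subset[OF cont])
      (use assms(3) in auto)
  have lim: "(\<lambda>n. \<tau> * J (\<lambda>t. \<phi> (v n t)) \<tau>) \<longlonglongrightarrow> \<tau> * J (\<lambda>t. \<phi> (w t)) \<tau>" if "\<tau> \<in> {0..s}" for \<tau>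
    by (intro tendsto_intros Jl that)
  have const: "(\<lambda>_. s * (\<phi> B / m)) integrable_on {0..s}" by (rule integrable_const_ivl)
  show "(\<lambda>\<tau>. \<tau> * J (\<lambda>t. \<phi> (w t)) \<tau>) integrable_on {0..s}"
    by (rule dominated_convergence(1)[OF int const dom lim])
  have "(\<lambda>n. integral {0..s} (\<lambda>\<tau>. \<tau> * J (\<lambda>t. \<phi> (v n t)) \<tau>)) \<longlonglongrightarrow> integral {0..s} (\<lambda>\<tau>. \<tau> * J (\<lambda>t. \<phi> (w t)) \<tau>)"
    by (rule dominated_convergence(2)[OF int const dom lim])
  then show "(\<lambda>n. T (c n) (v n) s) \<longlonglongrightarrow> T c' w s"
    unfolding T_def by (intro tendsto_intros assms(6))
qed

end

text \<open>Lets continuity and derivatives on the half-open interval be taken from compact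
  subintervals.\<close>

lemma at_within_half_open:
  fixes s :: real
  assumes "s < a" "a \<le> \<rho>"
  shows "at s within {0..<\<rho>} = at s within {0..a}"
proof (rule at_within_nhd[where S="{..<a}"])
  show "{0..<\<rho>} \<inter> {..<a} - {s} = {0..a} \<inter> {..<a} - {s}" using assms by auto
qed (use assms in auto)

lemma continuous_on_half_open:
  fixes f :: "real \<Rightarrow> real"
  assumes "\<And>a. 0 \<le> a \<Longrightarrow> a < \<rho> \<Longrightarrow> continuous_on {0..a} f"
  shows "continuous_on {0..<\<rho>} f"
  unfolding continuous_on_eq_continuous_within
proof
  fix s assume s: "s \<in> {0..<\<rho>}"
  define a where "a = (s + \<rho>) / 2"
  have a: "s < a" "a < \<rho>" using s by (auto simp: a_def)
  have "continuous (at s within {0..a}) f"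
    using assms[of a] s a by (simp add: continuous_on_eq_continuous_within)
  then show "continuous (at s within {0..<\<rho>}) f"
    using at_within_half_open[of s a \<rho>] a by simp
qed

section \<open>Solutions as limits of a monotone iteration\<close>

context radial_ode
begin

text \<open>Monotonicity of \<open>T\<close> makes the sequence increasing, so an upper bound is all
  that convergence requires.\<close>

primrec iterate :: "real \<Rightarrow> nat \<Rightarrow> real \<Rightarrow> real" where
  "iterate c 0 = (\<lambda>_. c)"
| "iterate c (Suc j) = T c (iterate c j)"

lemma it_cont_ge:
  assumes "c \<ge> 0"
  shows "continuous_on {0..a} (iterate c j)" "s \<ge> 0 \<Longrightarrow> c \<le> iterate c j s"
proof -
  have "(\<forall>a. continuous_on {0..a} (iterate c j)) \<and> (\<forall>s\<ge>0. c \<le> iterate c j s)"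
  proof (induction j)
    case (Suc j)
    have pos: "0 \<le> iterate c j t" if "t \<in> {0..a}" for t a
      using Suc assms that by (meson atLeastAtMost_iff order_trans)
    have "T c (iterate c j) 0 \<le> T c (iterate c j) s" if "s \<ge> 0" for s
      using Suc pos that by (intro T_mono_arg) auto
    then show ?case using Suc pos by (auto simp: T_at_0 intro!: T_cont)
  qed simp
  then show "continuous_on {0..a} (iterate c j)" "s \<ge> 0 \<Longrightarrow> c \<le> iterate c j s" by auto
qed

lemma it_nonneg: "c \<ge> 0 \<Longrightarrow> s \<ge> 0 \<Longrightarrow> 0 \<le> iterate c j s"
  using it_cont_ge(2)[of c s j] by linarith

lemma it_mono_arg: "c \<ge> 0 \<Longrightarrow> 0 \<le> s \<Longrightarrow> s \<le> s' \<Longrightarrow> iterate c j s \<le> iterate c j s'"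
  by (cases j) (auto intro!: T_mono_arg it_cont_ge it_nonneg)

lemma it_incseq:
  assumes "c \<ge> 0" "s \<ge> 0"
  shows "incseq (\<lambda>j. iterate c j s)"
proof -
  have "\<forall>s\<ge>0. iterate c j s \<le> iterate c (Suc j) s" for j
  proof (induction j)
    case 0 then show ?case using it_cont_ge(2)[OF assms(1), of _ "Suc 0"] by simp
  next
    case (Suc j)
    show ?case unfolding iterate.simps(2)[of c "Suc j"] iterate.simps(2)[of c j]
    proof (intro allI impI T_mono)
      show "continuous_on {0..s} (iterate c j)" "continuous_on {0..s} (T c (iterate c j))" for s
        using it_cont_ge(1)[OF assms(1), of s j] it_cont_ge(1)[OF assms(1), of s "Suc j"] by simp_all
    qed (use Suc it_nonneg[OF assms(1)] in auto)
  qed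
  then show ?thesis using assms(2) by (intro incseq_SucI) auto
qed

text \<open>Since \<open>T\<close> is monotone, the bound \<open>w\<close> is inherited from each
  iterate by the next. Most upper bounds for iterates below come from a suitable
  \<open>w\<close>.\<close>

lemma it_le_supersolution:
  assumes "0 \<le> c'" "c' \<le> c" "continuous_on {0..a} w" "\<And>t. t \<in> {0..a} \<Longrightarrow> c \<le> w t"
    "\<And>t. t \<in> {0..a} \<Longrightarrow> T c w t \<le> w t" "s \<in> {0..a}"
  shows "iterate c' j s \<le> w s"
proof -
  have "\<forall>s\<in>{0..a}. iterate c' j s \<le> w s"
  proof (induction j)
    case 0 then show ?case using assms(2,4) by (auto intro: order_trans)
  next
    case (Suc j)
    show ?case
    proof
      fix s assume s: "s \<in> {0..a}"
      have "T c' (iterate c' j) s \<le> T c w s"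
      proof (rule T_mono)
        show "continuous_on {0..s} w" by (rule continuous_on_subset[OF assms(3)]) (use s in auto)
        show "continuous_on {0..s} (iterate c' j)" by (rule it_cont_ge(1)[OF assms(1)])
      qed (use s Suc assms(2) it_nonneg[OF assms(1)] in auto)
      then show "iterate c' (Suc j) s \<le> w s" using assms(5)[OF s] by simp
    qed
  qed
  then show ?thesis using assms(6) by blast
qed

lemma it_mono_init:
  assumes "0 \<le> c'" "c' \<le> c" "s \<ge> 0"
  shows "iterate c' j s \<le> iterate c j s"
  using assms(3)
proof (induction j arbitrary: s)
  case (Suc j)
  show ?case unfolding iterate.simps
    by (rule T_mono) (use Suc assms in \<open>auto intro: it_cont_ge it_nonneg\<close>)
qed (use assms in simp)

text \<open>Lets bounds for smaller initial values pass to their supremum, one iterate at a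
  time.\<close>

lemma it_limit_init:
  assumes "c \<longlonglongrightarrow> c'" "\<And>n. 0 \<le> c n" "\<And>n. c n \<le> C" "s \<ge> 0"
  shows "(\<lambda>n. iterate (c n) j s) \<longlonglongrightarrow> iterate c' j s"
  using assms(4)
proof (induction j arbitrary: s)
  case 0 then show ?case using assms(1) by simp
next
  case (Suc j)
  have C: "0 \<le> C" using assms(2,3) order_trans by blast
  show ?case unfolding iterate.simps
  proof (rule T_limit(1)[where a=s and B="iterate C j s"])
    show "0 \<le> iterate (c n) j t \<and> iterate (c n) j t \<le> iterate C j s" if "t \<in> {0..s}" for n t
      using that it_nonneg[OF assms(2)] it_mono_init[OF assms(2,3), of t n j] it_mono_arg[OF C, of t s j]
      by (auto intro: order_trans)
  qed (use Suc assms it_cont_ge in auto)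
qed

text \<open>The lower bound by \<open>c\<close> keeps the values in the range where \<phi> is
  controlled. The right end is left open for solutions that explode there.\<close>

definition is_sol :: "real \<Rightarrow> real \<Rightarrow> (real \<Rightarrow> real) \<Rightarrow> bool" where
  "is_sol c \<rho> v \<longleftrightarrow> continuous_on {0..<\<rho>} v \<and> (\<forall>s\<in>{0..<\<rho>}. c \<le> v s \<and> v s = T c v s)"

text \<open>Continuity of the limit is a consequence of the fixed point equation, whose right side
  is an indefinite integral.\<close>

lemma it_limit_closed:
  assumes c: "c \<ge> 0" and a: "0 \<le> a" and B: "\<And>j. iterate c j a \<le> B"
  defines "v \<equiv> \<lambda>s. lim (\<lambda>j. iterate c j s)"
  shows "continuous_on {0..a} v" "s \<in> {0..a} \<Longrightarrow> v s = T c v s" "s \<in> {0..a} \<Longrightarrow> (\<lambda>j. iterate c j s) \<longlonglongrightarrow> v s"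
    "s \<in> {0..a} \<Longrightarrow> c \<le> v s"
proof -
  have b: "0 \<le> iterate c j t \<and> iterate c j t \<le> B" if "t \<in> {0..a}" for j t
    using B[of j] it_mono_arg[OF c, of t a j] it_nonneg[OF c, of t j] that by (auto intro: order_trans)
  have lim: "(\<lambda>j. iterate c j s) \<longlonglongrightarrow> v s" if s: "s \<in> {0..a}" for s
  proof -
    have inc: "incseq (\<lambda>j. iterate c j s)" using it_incseq[OF c, of s] s by simp
    have "\<forall>j. iterate c j s \<le> B" using b[OF s] by blast
    from incseq_convergent[OF inc this] obtain L where "(\<lambda>j. iterate c j s) \<longlonglongrightarrow> L" .
    then have "convergent (\<lambda>j. iterate c j s)" by (rule convergentI)
    then show ?thesis by (simp add: v_def convergent_LIMSEQ_iff)
  qed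
  have Tl: "(\<lambda>j. T c (iterate c j) s) \<longlonglongrightarrow> T c v s" "(\<lambda>\<tau>. \<tau> * J (\<lambda>t. \<phi> (v t)) \<tau>) integrable_on {0..s}"
    if "s \<in> {0..a}" for s
    using T_limit[where v="iterate c" and w=v and s=s and a=a and B=B and c="\<lambda>_. c" and c'=c] it_cont_ge(1)[OF c] that b lim by auto
  have eq: "v s = T c v s" if s: "s \<in> {0..a}" for s
  proof (rule LIMSEQ_unique)
    show "(\<lambda>j. iterate c (Suc j) s) \<longlonglongrightarrow> v s" using lim[OF s] by (rule LIMSEQ_Suc)
    show "(\<lambda>j. iterate c (Suc j) s) \<longlonglongrightarrow> T c v s" using Tl(1)[OF s] by simp
  qed
  have "continuous_on {0..a} (T c v)"
    unfolding T_def[abs_def] using Tl(2)[of a] a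
    by (intro continuous_intros indefinite_integral_continuous_1) auto
  then show "continuous_on {0..a} v" by (rule continuous_on_eq) (use eq in auto)
  show "s \<in> {0..a} \<Longrightarrow> v s = T c v s" by (rule eq)
  show "s \<in> {0..a} \<Longrightarrow> (\<lambda>j. iterate c j s) \<longlonglongrightarrow> v s" by (rule lim)
  show "c \<le> v s" if s: "s \<in> {0..a}"
    by (rule LIMSEQ_le_const[OF lim[OF s]]) (use it_cont_ge(2)[OF c] s in auto)
qed

lemma is_sol_limit:
  assumes c: "c \<ge> 0" and bnd: "\<And>s. s \<in> {0..<\<rho>} \<Longrightarrow> \<exists>B. \<forall>j. iterate c j s \<le> B"
  obtains v where "is_sol c \<rho> v" "\<And>s. s \<in> {0..<\<rho>} \<Longrightarrow> (\<lambda>j. iterate c j s) \<longlonglongrightarrow> v s"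
proof -
  define v where "v = (\<lambda>s. lim (\<lambda>j. iterate c j s))"
  have step: "continuous_on {0..s} v \<and> v s = T c v s \<and> (\<lambda>j. iterate c j s) \<longlonglongrightarrow> v s \<and> c \<le> v s" if s: "0 \<le> s" "s < \<rho>" for s
  proof -
    obtain B where "\<And>j. iterate c j s \<le> B" using bnd[of s] s by auto
    from it_limit_closed[OF c s(1) this] show ?thesis using s by (simp add: v_def)
  qed
  then have "continuous_on {0..<\<rho>} v" by (intro continuous_on_half_open) blast
  then have "is_sol c \<rho> v" unfolding is_sol_def using step by (meson atLeastLessThan_iff)
  moreover have "(\<lambda>j. iterate c j s) \<longlonglongrightarrow> v s" if "s \<in> {0..<\<rho>}" for s
    using step[of s] that unfolding atLeastLessThan_iff by blast
  ultimately show ?thesis by (rule that)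
qed

section \<open>Energy estimates for a solution\<close>

definition Phi :: "real \<Rightarrow> real" where "Phi t = integral {0..t} \<phi>"

lemma phi_integrable: "\<phi> integrable_on {0..t}"
  by (rule integrable_continuous_real[OF continuous_on_subset[OF phi_cont]]) auto

lemma Phi_deriv:
  assumes "t > 0"
  shows "(Phi has_real_derivative \<phi> t) (at t)"
proof -
  have "(Phi has_real_derivative \<phi> t) (at t within {0..t + 1})"
    unfolding Phi_def by (rule integral_has_real_derivative[OF continuous_on_subset[OF phi_cont]]) (use assms in auto)
  then show ?thesis using at_within_interior[of t "{0..t + 1}"] assms by simp
qed

lemma Phi_mono: "0 \<le> s \<Longrightarrow> s \<le> t \<Longrightarrow> Phi s \<le> Phi t"
  unfolding Phi_def by (rule integral_subset_le) (use phi_integrable phi_nonneg in auto)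

lemma Phi_nonneg: "0 \<le> Phi t"
  unfolding Phi_def by (rule integral_nonneg[OF phi_integrable]) (use phi_nonneg in auto)

lemma Phi_le: "0 \<le> t \<Longrightarrow> Phi t \<le> t * \<phi> t"
proof -
  assume t: "0 \<le> t"
  have "integral {0..t} \<phi> \<le> integral {0..t} (\<lambda>_. \<phi> t)"
    by (rule integral_le[OF phi_integrable integrable_const_ivl]) (use phi_le in auto)
  then show ?thesis using t by (simp add: Phi_def)
qed

context
  fixes c \<rho> v
  assumes sol: "is_sol c \<rho> v" and c: "c > 0"
begin

lemma sol_cont: "continuous_on {0..<\<rho>} v" and sol_ge: "s \<in> {0..<\<rho>} \<Longrightarrow> c \<le> v s"
  and sol_eq: "s \<in> {0..<\<rho>} \<Longrightarrow> v s = T c v s"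
  using sol unfolding is_sol_def by blast+

lemma sol_nonneg: "s \<in> {0..<\<rho>} \<Longrightarrow> 0 \<le> v s" using sol_ge c by force

lemma sol_cont_sub: "s < \<rho> \<Longrightarrow> continuous_on {0..s} v"
  by (rule continuous_on_subset[OF sol_cont]) auto

text \<open>For positive \<open>s\<close> this is \<open>v'(s) / s\<close>, a form that stays
  regular at the origin.\<close>

definition "Q = J (\<lambda>t. \<phi> (v t))"

lemma sol_phi_cont: "continuous_on {0..<\<rho>} (\<lambda>t. \<phi> (v t))"
  by (rule phi_compose_cont[OF sol_cont sol_nonneg])

lemma Q_cont: "continuous_on {0..<\<rho>} Q"
  unfolding Q_def by (intro continuous_on_half_open J_cont continuous_on_subset[OF sol_phi_cont]) auto

lemma Q_deriv: "0 < s \<Longrightarrow> s < \<rho> \<Longrightarrow> (Q has_real_derivative (\<phi> (v s) - m * Q s) / s) (at s)"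
  unfolding Q_def by (rule J_deriv[OF sol_phi_cont])

lemma Q_at_0: "\<phi> (v 0) = m * Q 0"
  unfolding Q_def J_at_0 using m by simp

lemma sol_deriv:
  assumes s: "s \<in> {0..<\<rho>}"
  shows "(v has_real_derivative s * Q s) (at s within {0..<\<rho>})"
proof -
  define a where "a = (s + \<rho>) / 2"
  have a: "s < a" "a < \<rho>" using s by (auto simp: a_def)
  have "(T c v has_real_derivative 0 + s * Q s) (at s within {0..a})"
    unfolding T_def[abs_def] Q_def
  proof (intro DERIV_add DERIV_const integral_has_real_derivative integrand_cont)
    show "continuous_on {0..a} v" using a by (intro sol_cont_sub)
    show "0 \<le> v t" if "t \<in> {0..a}" for t using that a by (intro sol_nonneg) auto
  qed (use s a in auto)
  then have "(T c v has_real_derivative s * Q s) (at s within {0..<\<rho>})"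
    using at_within_half_open[of s a \<rho>] a by simp
  then show ?thesis
    by (rule has_field_derivative_transform_within[OF _ zero_less_one s]) (use sol_eq in auto)
qed

lemma sol_deriv_at: "0 < s \<Longrightarrow> s < \<rho> \<Longrightarrow> (v has_real_derivative s * Q s) (at s)"
  using sol_deriv[of s] at_within_interior[of s "{0..<\<rho>}"] by simp

lemma sol_mono: "0 \<le> s \<Longrightarrow> s \<le> s' \<Longrightarrow> s' < \<rho> \<Longrightarrow> v s \<le> v s'"
  using sol_eq[of s] sol_eq[of s'] T_mono_arg[of s' v s c] sol_cont_sub[of s'] sol_nonneg by simp

lemma Q_nonneg: "0 \<le> s \<Longrightarrow> s < \<rho> \<Longrightarrow> 0 \<le> Q s"
  unfolding Q_def using sol_cont_sub sol_nonneg by (intro J_phi_nonneg) auto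

text \<open>The integrand \<open>\<phi> (v t)\<close> increases with \<open>t\<close>. Consequently
  the friction term \<open>(m - 1) * Q s\<close> takes away at most the fraction
  \<open>(m - 1) / m\<close> of \<open>\<phi> (v s)\<close>.\<close>

lemma Q_le:
  assumes "0 \<le> s" "s < \<rho>"
  shows "Q s \<le> \<phi> (v s) / m"
proof -
  have "Q s \<le> J (\<lambda>_. \<phi> (v s)) s"
    unfolding Q_def
    by (rule J_mono) (use assms in \<open>auto intro!: continuous_on_subset[OF sol_phi_cont] phi_le sol_mono sol_nonneg\<close>)
  then show ?thesis by (simp add: J_const)
qed

lemma flux_deriv:
  assumes "0 < s" "s < \<rho>"
  shows "((\<lambda>s. s * Q s) has_real_derivative \<phi> (v s) - (m - 1) * Q s) (at s)"
  by (rule DERIV_cong[OF DERIV_mult[OF DERIV_ident Q_deriv[OF assms]]]) (use assms in \<open>simp add: field_simps\<close>)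

lemma flux_sq_deriv:
  assumes "0 < s" "s < \<rho>"
  shows "((\<lambda>s. (s * Q s)\<^sup>2) has_real_derivative 2 * (s * Q s) * (\<phi> (v s) - (m - 1) * Q s)) (at s)"
  by (rule DERIV_cong[OF DERIV_power[OF flux_deriv[OF assms], of 2]]) simp

lemma Phi_sol_deriv:
  assumes "0 < s" "s < \<rho>"
  shows "((\<lambda>s. Phi (v s)) has_real_derivative \<phi> (v s) * (s * Q s)) (at s)"
proof -
  have "0 < v s" using sol_ge[of s] c assms by simp
  from DERIV_chain2[OF Phi_deriv[OF this] sol_deriv_at[OF assms]] show ?thesis .
qed

text \<open>Friction makes twice the potential minus the squared speed increase, starting from a
  nonnegative value at 0.\<close>

lemma energy_upper:
  assumes "0 \<le> s" "s < \<rho>"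
  shows "(s * Q s)\<^sup>2 \<le> 2 * Phi (v s)"
proof -
  have "2 * Phi (v 0) - (0 * Q 0)\<^sup>2 \<le> 2 * Phi (v s) - (s * Q s)\<^sup>2"
  proof (rule DERIV_nonneg_imp_increasing_open[OF assms(1)])
    fix x assume x: "0 < x" "x < s"
    have D: "((\<lambda>s. 2 * Phi (v s) - (s * Q s)\<^sup>2) has_real_derivative
        2 * (\<phi> (v x) * (x * Q x)) - 2 * (x * Q x) * (\<phi> (v x) - (m - 1) * Q x)) (at x)"
      using x assms by (intro DERIV_diff DERIV_cmult Phi_sol_deriv flux_sq_deriv) auto
    have E: "2 * (\<phi> (v x) * (x * Q x)) - 2 * (x * Q x) * (\<phi> (v x) - (m - 1) * Q x) = 2 * (x * Q x) * ((m - 1) * Q x)"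
      by (simp add: algebra_simps)
    have N: "0 \<le> 2 * (x * Q x) * ((m - 1) * Q x)"
      using x assms m Q_nonneg[of x] by (intro mult_nonneg_nonneg) auto
    show "\<exists>y. ((\<lambda>s. 2 * Phi (v s) - (s * Q s)\<^sup>2) has_real_derivative y) (at x) \<and> 0 \<le> y" using D N unfolding E by blast
  next
    have "continuous_on {0..v s} Phi"
      unfolding Phi_def[abs_def] by (rule indefinite_integral_continuous_1[OF phi_integrable])
    then have "continuous_on {0..s} (\<lambda>s. Phi (v s))"
      by (rule continuous_on_compose2[OF _ sol_cont_sub]) (use assms sol_nonneg sol_mono in auto)
    then show "continuous_on {0..s} (\<lambda>s. 2 * Phi (v s) - (s * Q s)\<^sup>2)"
      using assms by (intro continuous_intros continuous_on_subset[OF Q_cont]) auto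
  qed
  then show ?thesis using Phi_nonneg[of "v 0"] by simp
qed

text \<open>By \<open>Q_le\<close> the acceleration is at least \<open>\<phi> (v s) / m\<close>;
  multiply by twice the speed and integrate.\<close>

lemma energy_lower:
  assumes "0 < s\<^sub>0" "s\<^sub>0 \<le> s" "s < \<rho>"
  shows "2 / m * (Phi (v s) - Phi (v s\<^sub>0)) \<le> (s * Q s)\<^sup>2"
proof -
  have "(s\<^sub>0 * Q s\<^sub>0)\<^sup>2 - 2 / m * Phi (v s\<^sub>0) \<le> (s * Q s)\<^sup>2 - 2 / m * Phi (v s)"
  proof (rule DERIV_nonneg_imp_nondecreasing[OF assms(2)])
    fix x assume x: "s\<^sub>0 \<le> x" "x \<le> s"
    have D: "((\<lambda>s. (s * Q s)\<^sup>2 - 2 / m * Phi (v s)) has_real_derivative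
        2 * (x * Q x) * (\<phi> (v x) - (m - 1) * Q x) - 2 / m * (\<phi> (v x) * (x * Q x))) (at x)"
      using x assms by (intro DERIV_diff DERIV_cmult Phi_sol_deriv flux_sq_deriv) auto
    have E: "2 * (x * Q x) * (\<phi> (v x) - (m - 1) * Q x) - 2 / m * (\<phi> (v x) * (x * Q x))
        = 2 * (x * Q x) * ((m - 1) * (\<phi> (v x) / m - Q x))"
      using m by (simp add: field_simps)
    have N: "0 \<le> 2 * (x * Q x) * ((m - 1) * (\<phi> (v x) / m - Q x))"
      using x assms m Q_nonneg[of x] Q_le[of x] by (intro mult_nonneg_nonneg) auto
    show "\<exists>y. ((\<lambda>s. (s * Q s)\<^sup>2 - 2 / m * Phi (v s)) has_real_derivative y) (at x) \<and> 0 \<le> y" using D N unfolding E by blast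
  qed
  then show ?thesis using zero_le_power2[of "s\<^sub>0 * Q s\<^sub>0"] unfolding right_diff_distrib by linarith
qed

text \<open>The same lower bound for the acceleration, frozen at \<open>s\<^sub>0\<close> and
  integrated twice.\<close>

lemma growth_lower:
  assumes "0 < s\<^sub>0" "s\<^sub>0 \<le> s" "s < \<rho>"
  shows "v s\<^sub>0 + \<phi> (v s\<^sub>0) * (s - s\<^sub>0)\<^sup>2 / (2 * m) \<le> v s"
proof -
  define K where "K = \<phi> (v s\<^sub>0) / m"
  have p: "K * (x - s\<^sub>0) \<le> x * Q x" if x: "s\<^sub>0 \<le> x" "x \<le> s" for x
  proof -
    have "s\<^sub>0 * Q s\<^sub>0 - K * (s\<^sub>0 - s\<^sub>0) \<le> x * Q x - K * (x - s\<^sub>0)"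
    proof (rule DERIV_nonneg_imp_nondecreasing[OF x(1)])
      fix y assume y: "s\<^sub>0 \<le> y" "y \<le> x"
      have "((\<lambda>x. x * Q x - K * (x - s\<^sub>0)) has_real_derivative \<phi> (v y) - (m - 1) * Q y - K) (at y)"
        by (rule DERIV_cong[OF DERIV_diff[OF flux_deriv DERIV_cmult[OF DERIV_diff[OF DERIV_ident DERIV_const]]]])
          (use y x assms in auto)
      moreover have "0 \<le> \<phi> (v y) - (m - 1) * Q y - K"
      proof -
        have "K \<le> \<phi> (v y) / m" unfolding K_def
          using m y x assms by (intro divide_right_mono phi_le sol_mono sol_nonneg) auto
        moreover have "(m - 1) * Q y \<le> (m - 1) * (\<phi> (v y) / m)"
          using m y x assms Q_le[of y] by (intro mult_left_mono) auto
        moreover have "(m - 1) * (\<phi> (v y) / m) = \<phi> (v y) - \<phi> (v y) / m" using m by (simp add: field_simps)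
        ultimately show ?thesis by linarith
      qed
      ultimately show "\<exists>z. ((\<lambda>x. x * Q x - K * (x - s\<^sub>0)) has_real_derivative z) (at y) \<and> 0 \<le> z" by blast
    qed
    moreover have "0 \<le> s\<^sub>0 * Q s\<^sub>0" using assms Q_nonneg[of s\<^sub>0] by simp
    ultimately show ?thesis by simp
  qed
  have "v s\<^sub>0 - K * (s\<^sub>0 - s\<^sub>0)\<^sup>2 / 2 \<le> v s - K * (s - s\<^sub>0)\<^sup>2 / 2"
  proof (rule DERIV_nonneg_imp_nondecreasing[OF assms(2)])
    fix x assume x: "s\<^sub>0 \<le> x" "x \<le> s"
    have "((\<lambda>x. v x - K * (x - s\<^sub>0)\<^sup>2 / 2) has_real_derivative x * Q x - K * (x - s\<^sub>0)) (at x)"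
      using x assms by (auto intro!: derivative_eq_intros sol_deriv_at)
    then show "\<exists>z. ((\<lambda>x. v x - K * (x - s\<^sub>0)\<^sup>2 / 2) has_real_derivative z) (at x) \<and> 0 \<le> z"
      using p[OF x] by force
  qed
  then show ?thesis using m by (simp add: K_def field_simps)
qed

end

end

section \<open>The Keller-Osserman integral\<close>

text \<open>Bisection glues the local constants together on the compact interval.\<close>

lemma locally_lipschitz_mono_interval:
  assumes "locally_lipschitz_on {0..} f" "0 \<le> B"
  obtains L where "L \<ge> 0" "\<And>x y. 0 \<le> x \<Longrightarrow> x \<le> y \<Longrightarrow> y \<le> B \<Longrightarrow> f y - f x \<le> L * (y - x)"
proof -
  \<comment> \<open>\<open>Bolzano\<close> also asks about intervals that start below 0, where
    nothing is known about \<open>f\<close>; the guard makes these trivial.\<close>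
  define P where "P = (\<lambda>a b. (0::real) \<le> a \<longrightarrow> (\<exists>L\<ge>0. \<forall>x y. a \<le> x \<and> x \<le> y \<and> y \<le> b \<longrightarrow> f y - f x \<le> L * (y - x)))"
  have "P 0 B"
  proof (rule Bolzano[OF assms(2)])
    fix a b c :: real assume P: "P a b" "P b c" and ab: "a \<le> b" "b \<le> c"
    show "P a c" unfolding P_def
    proof
      assume a: "0 \<le> a"
      obtain L1 where L1: "L1 \<ge> 0" "\<And>x y. a \<le> x \<Longrightarrow> x \<le> y \<Longrightarrow> y \<le> b \<Longrightarrow> f y - f x \<le> L1 * (y - x)"
        using P(1) a unfolding P_def by blast
      have "0 \<le> b" using a ab by simp
      then obtain L2 where L2: "L2 \<ge> 0" "\<And>x y. b \<le> x \<Longrightarrow> x \<le> y \<Longrightarrow> y \<le> c \<Longrightarrow> f y - f x \<le> L2 * (y - x)"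
        using P(2) unfolding P_def by blast
      define L where "L = max L1 L2"
      have L: "L1 \<le> L" "L2 \<le> L" "0 \<le> L" using L1 L2 by (auto simp: L_def)
      have "f y - f x \<le> L * (y - x)" if xy: "a \<le> x" "x \<le> y" "y \<le> c" for x y
      proof -
        have m: "L1 * (y - x) \<le> L * (y - x)" "L2 * (y - x) \<le> L * (y - x)" if "x \<le> y" for x y
          using L that by (auto intro!: mult_right_mono)
        consider "y \<le> b" | "b \<le> x" | "x \<le> b" "b \<le> y" by linarith
        then show ?thesis
        proof cases
          case 1 then show ?thesis using L1(2)[of x y] m(1)[of x y] xy by linarith
        next
          case 2 then show ?thesis using L2(2)[of x y] m(2)[of x y] xy by linarith
        next
          case 3
          have "L * (y - x) = L * (y - b) + L * (b - x)" by (simp add: algebra_simps)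
          then show ?thesis
            using L1(2)[of x b] L2(2)[of b y] m(1)[of x b] m(2)[of b y] xy 3 by linarith
        qed
      qed
      then show "\<exists>L\<ge>0. \<forall>x y. a \<le> x \<and> x \<le> y \<and> y \<le> c \<longrightarrow> f y - f x \<le> L * (y - x)" using L(3) by blast
    qed
  next
    fix x :: real assume x: "0 \<le> x" "x \<le> B"
    obtain e L where e: "e > 0" "L-lipschitz_on (cball x e \<inter> {0..}) f"
      using assms(1) x unfolding locally_lipschitz_on_def by force
    have "P a b" if "a \<le> x \<and> x \<le> b \<and> b - a < e" for a b
      unfolding P_def
    proof (intro impI exI[of _ L] conjI allI)
      show "0 \<le> L" using lipschitz_on_nonneg[OF e(2)] .
      fix y z assume "0 \<le> a" "a \<le> y \<and> y \<le> z \<and> z \<le> b"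
      then have "dist (f z) (f y) \<le> L * dist z y"
        by (intro lipschitz_onD[OF e(2)]) (use that in \<open>auto simp: dist_real_def\<close>)
      then show "f z - f y \<le> L * (z - y)"
        using \<open>a \<le> y \<and> y \<le> z \<and> z \<le> b\<close> by (simp add: dist_real_def)
    qed
    then show "\<exists>d>0. \<forall>a b. a \<le> x \<and> x \<le> b \<and> b - a < d \<longrightarrow> P a b" using e(1) by blast
  qed
  then obtain L where "L \<ge> 0" "\<forall>x y. 0 \<le> x \<and> x \<le> y \<and> y \<le> B \<longrightarrow> f y - f x \<le> L * (y - x)"
    unfolding P_def by auto
  then show ?thesis by (intro that[of L]) auto
qed

lemma locally_lipschitz_continuous:
  assumes "locally_lipschitz_on {0..} f"
  shows "continuous_on {0..} f"
  unfolding continuous_on_eq_continuous_within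
proof
  fix x :: real assume x: "x \<in> {0..}"
  obtain e L where e: "e > 0" "L-lipschitz_on (cball x e \<inter> {0..}) f"
    using assms x unfolding locally_lipschitz_on_def by blast
  have "continuous_on (cball x e \<inter> {0..}) f" by (rule lipschitz_on_continuous_on[OF e(2)])
  then have "continuous (at x within cball x e \<inter> {0..}) f"
    using x e(1) by (simp add: continuous_on_eq_continuous_within)
  moreover have "at x within {0..} = at x within cball x e \<inter> {0..}"
    by (rule at_within_nhd[where S="ball x e"]) (use e in \<open>auto simp: dist_real_def\<close>)
  ultimately show "continuous (at x within {0..}) f" by simp
qed

context radial_ode
begin

text \<open>When \<open>Phi a > 0\<close>, this is bounded in \<open>t\<close> precisely if the
  Keller-Osserman integral from \<open>a\<close> converges.\<close>

definition G :: "real \<Rightarrow> real \<Rightarrow> real" where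
  "G a t = integral {a..t} (\<lambda>x. 1 / sqrt (Phi x))"

lemma Phi_continuous: "continuous_on {0..t} Phi"
  unfolding Phi_def[abs_def] by (rule indefinite_integral_continuous_1[OF phi_integrable])

lemma G_integrand_cont:
  assumes "a \<ge> 0" "Phi a > 0"
  shows "continuous_on {a..t} (\<lambda>x. 1 / sqrt (Phi x))"
proof -
  have "Phi x > 0" if "a \<le> x" for x using Phi_mono[of a x] assms that by linarith
  then show ?thesis
    using assms by (intro continuous_intros continuous_on_subset[OF Phi_continuous[of t]]) (auto simp: less_imp_neq[symmetric])
qed

lemma G_deriv:
  assumes "a \<ge> 0" "Phi a > 0" "a < t"
  shows "(G a has_real_derivative 1 / sqrt (Phi t)) (at t)"
proof -
  have "(G a has_real_derivative 1 / sqrt (Phi t)) (at t within {a..t + 1})"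
    unfolding G_def by (rule integral_has_real_derivative[OF G_integrand_cont]) (use assms in auto)
  then show ?thesis using at_within_interior[of t "{a..t + 1}"] assms by simp
qed

text \<open>The integrand decreases, so its value at \<open>y\<close> bounds it from below.\<close>

lemma G_diff_lower:
  assumes "a \<ge> 0" "Phi a > 0" "a < x" "x \<le> y"
  shows "(y - x) / sqrt (Phi y) \<le> G a y - G a x"
proof -
  have "G a x - x / sqrt (Phi y) \<le> G a y - y / sqrt (Phi y)"
  proof (rule DERIV_nonneg_imp_nondecreasing[OF assms(4)])
    fix z assume z: "x \<le> z" "z \<le> y"
    have "((\<lambda>z. G a z - z / sqrt (Phi y)) has_real_derivative 1 / sqrt (Phi z) - 1 / sqrt (Phi y)) (at z)"
      using assms z by (intro DERIV_diff G_deriv DERIV_cdivide DERIV_ident) auto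
    moreover have "0 < Phi z" using Phi_mono[of a z] assms z by linarith
    then have "1 / sqrt (Phi y) \<le> 1 / sqrt (Phi z)"
      using Phi_mono[of z y] assms z by (intro divide_left_mono) auto
    ultimately show "\<exists>d. ((\<lambda>z. G a z - z / sqrt (Phi y)) has_real_derivative d) (at z) \<and> 0 \<le> d" by force
  qed
  then show ?thesis by (simp add: diff_divide_distrib)
qed

lemma G_mono:
  assumes "a \<ge> 0" "Phi a > 0" "a \<le> x" "x \<le> y"
  shows "G a x \<le> G a y"
  unfolding G_def
  by (rule integral_subset_le)
    (use assms Phi_nonneg in \<open>auto intro!: integrable_continuous_real G_integrand_cont\<close>)

lemma G_bounded_tail:
  assumes a: "a \<ge> 0" "Phi a > 0" and M: "\<And>t. t \<ge> a \<Longrightarrow> G a t \<le> M" and e: "\<epsilon> > 0"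
  obtains t\<^sub>0 where "t\<^sub>0 > a" "\<And>x y. t\<^sub>0 \<le> x \<Longrightarrow> x \<le> y \<Longrightarrow> G a y - G a x < \<epsilon>"
proof -
  let ?S = "G a ` {a<..}"
  have S: "?S \<noteq> {}" "bdd_above ?S" using M by (auto intro!: bdd_aboveI2[of _ _ M])
  have "Sup ?S - \<epsilon> < Sup ?S" using e by simp
  then obtain t where t: "t > a" "Sup ?S - \<epsilon> < G a t"
    using less_cSup_iff[OF S] by auto
  show ?thesis
  proof (rule that[OF t(1)])
    fix x y assume xy: "t \<le> x" "x \<le> y"
    have "G a t \<le> G a x" using G_mono[OF a less_imp_le[OF t(1)] xy(1)] .
    moreover have "G a y \<le> Sup ?S" using xy t(1) S(2) by (intro cSup_upper) auto
    ultimately show "G a y - G a x < \<epsilon>" using t(2) by linarith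
  qed
qed

text \<open>Beyond \<open>x\<close> the slope of \<open>Phi\<close> is at least
  \<open>\<phi> x\<close>. Combined with \<open>Phi_le\<close>, this shows that doubling the
  argument at least doubles \<open>Phi\<close>.\<close>

lemma Phi_twice_ge:
  assumes "0 < x"
  shows "Phi x + x * \<phi> x \<le> Phi (2 * x)"
proof -
  have "Phi x - x * \<phi> x \<le> Phi (2 * x) - 2 * x * \<phi> x"
  proof (rule DERIV_nonneg_imp_nondecreasing[where f="\<lambda>z. Phi z - z * \<phi> x" and a=x and b="2 * x"])
    fix z assume z: "x \<le> z" "z \<le> 2 * x"
    have "((\<lambda>z. Phi z - z * \<phi> x) has_real_derivative \<phi> z - 1 * \<phi> x) (at z)"
      using assms z by (intro DERIV_diff Phi_deriv DERIV_cmult_right DERIV_ident) auto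
    then show "\<exists>d. ((\<lambda>z. Phi z - z * \<phi> x) has_real_derivative d) (at z) \<and> 0 \<le> d"
      using phi_le[of x z] assms z by force
  qed (use assms in simp)
  then show ?thesis by simp
qed

lemma Phi_double: "0 < x \<Longrightarrow> 2 * Phi x \<le> Phi (2 * x)"
  using Phi_twice_ge[of x] Phi_le[of x] by simp

text \<open>The upper energy estimate bounds the speed by \<open>sqrt 2 * sqrt (P v)\<close>; divide
  and integrate in \<open>s\<close>. A majorant \<open>P\<close> instead of \<open>Phi\<close>
  allows the truncated equation to be measured with the potential of the full one.\<close>

lemma growth_upper:
  assumes sol: "is_sol c \<rho> v" and a: "0 < a" "a < c"
    and P: "continuous_on {a..} P" "\<And>t. t \<ge> a \<Longrightarrow> 0 < P t" "\<And>t. t \<ge> a \<Longrightarrow> Phi t \<le> P t"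
    and s: "0 \<le> s" "s < \<rho>"
  shows "integral {a..v s} (\<lambda>x. 1 / sqrt (P x)) \<le> integral {a..c} (\<lambda>x. 1 / sqrt (P x)) + sqrt 2 * s"
proof -
  have c: "c > 0" using a by simp
  define H where "H = (\<lambda>t. integral {a..t} (\<lambda>x. 1 / sqrt (P x)))"
  have Pc: "continuous_on {a..t} (\<lambda>x. 1 / sqrt (P x))" for t
    by (intro continuous_intros continuous_on_subset[OF P(1)]) (force dest: P(2))+
  have Hd: "(H has_real_derivative 1 / sqrt (P t)) (at t)" if "a < t" for t
  proof -
    have "(H has_real_derivative 1 / sqrt (P t)) (at t within {a..t + 1})"
      unfolding H_def by (rule integral_has_real_derivative[OF Pc]) (use that in auto)
    then show ?thesis using at_within_interior[of t "{a..t + 1}"] that by simp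
  qed
  have Hc: "continuous_on {a..t} H" for t
    unfolding H_def by (intro indefinite_integral_continuous_1 integrable_continuous_real Pc)
  have "sqrt 2 * 0 - H (v 0) \<le> sqrt 2 * s - H (v s)"
  proof (rule DERIV_nonneg_imp_increasing_open[OF s(1)])
    fix x assume x: "0 < x" "x < s"
    have vx: "c \<le> v x" using sol_ge[OF sol c, of x] x s by simp
    have D: "((\<lambda>s. sqrt 2 * s - H (v s)) has_real_derivative sqrt 2 * 1 - 1 / sqrt (P (v x)) * (x * Q v x)) (at x)"
      by (intro DERIV_diff DERIV_cmult DERIV_ident DERIV_chain2[OF Hd sol_deriv_at[OF sol c]])
        (use x s a vx in auto)
    have "(x * Q v x)\<^sup>2 \<le> 2 * P (v x)"
      using energy_upper[OF sol c, of x] P(3)[of "v x"] x s a vx by linarith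
    then have "x * Q v x \<le> sqrt 2 * sqrt (P (v x))"
      unfolding real_sqrt_mult[symmetric] by (rule real_le_rsqrt)
    moreover have "sqrt (P (v x)) > 0" using P(2)[of "v x"] a vx by simp
    ultimately have "0 \<le> sqrt 2 * 1 - 1 / sqrt (P (v x)) * (x * Q v x)" by (simp add: divide_le_eq)
    then show "\<exists>y. ((\<lambda>s. sqrt 2 * s - H (v s)) has_real_derivative y) (at x) \<and> 0 \<le> y" using D by blast
  next
    have "continuous_on {0..s} (\<lambda>s. H (v s))"
    proof (rule continuous_on_compose2[OF Hc[of "v s"] sol_cont_sub[OF sol c s(2)]])
      show "v ` {0..s} \<subseteq> {a..v s}"
      proof (rule image_subsetI)
        fix x assume x: "x \<in> {0..s}"
        then have "c \<le> v x" using s by (intro sol_ge[OF sol c]) auto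
        moreover have "v x \<le> v s" using x s by (intro sol_mono[OF sol c]) auto
        ultimately show "v x \<in> {a..v s}" using a by simp
      qed
    qed
    then show "continuous_on {0..s} (\<lambda>s. sqrt 2 * s - H (v s))" by (intro continuous_intros)
  qed
  moreover have "v 0 = c" using sol_eq[OF sol c, of 0] s by (simp add: T_at_0)
  ultimately show ?thesis by (simp add: H_def)
qed

text \<open>If \<open>v s\<^sub>0\<close> is large, the remaining tail of \<open>G\<close> is so
  short that \<open>v\<close> doubles within the first third of the interval up to \<open>r\<close>,
  and in the second third \<open>G\<close> along \<open>v\<close> would have to increase by more
  than the whole tail. The bound does not depend on the initial value.\<close>

lemma sol_bound:
  assumes a: "a > 0" "Phi a > 0" and M: "\<And>t. t \<ge> a \<Longrightarrow> G a t \<le> M" and s0: "0 < s\<^sub>0" "s\<^sub>0 < r"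
  obtains B where "\<And>c v. c > 0 \<Longrightarrow> is_sol c r v \<Longrightarrow> v s\<^sub>0 \<le> B"
proof -
  define \<eta> where "\<eta> = (r - s\<^sub>0) / 3"
  \<comment> \<open>The constant serves twice:
    \<open>\<epsilon>\<^sup>2 = \<eta>\<^sup>2 / (8 * m)\<close> makes the quadratic growth over
    time \<eta> exceed \<open>v s\<^sub>0\<close>, and \<epsilon> is at most
    \<open>\<eta> / sqrt m\<close>, the least increase of \<open>G\<close> along \<open>v\<close>
    over the second third.\<close>
  define \<epsilon> where "\<epsilon> = \<eta> / sqrt (8 * m)"
  have \<eta>: "\<eta> > 0" using s0 by (simp add: \<eta>_def)
  have \<epsilon>: "\<epsilon> > 0" using \<eta> m by (simp add: \<epsilon>_def)
  have \<epsilon>2: "\<epsilon>\<^sup>2 = \<eta>\<^sup>2 / (8 * m)" using m by (simp add: \<epsilon>_def power_divide)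
  obtain t\<^sub>0 where t0: "t\<^sub>0 > a" "\<And>x y. t\<^sub>0 \<le> x \<Longrightarrow> x \<le> y \<Longrightarrow> G a y - G a x < \<epsilon>"
    using G_bounded_tail[OF less_imp_le[OF a(1)] a(2) M \<epsilon>] by blast
  have "v s\<^sub>0 \<le> 2 * t\<^sub>0" if c: "c > 0" and sol: "is_sol c r v" for c v
  proof (rule ccontr)
    assume "\<not> v s\<^sub>0 \<le> 2 * t\<^sub>0"
    then have V0: "v s\<^sub>0 > 2 * t\<^sub>0" by simp
    let ?V = "v s\<^sub>0"
    define s\<^sub>1 where "s\<^sub>1 = s\<^sub>0 + \<eta>"
    define s\<^sub>2 where "s\<^sub>2 = s\<^sub>0 + 2 * \<eta>"
    have ss: "s\<^sub>0 \<le> s\<^sub>1" "s\<^sub>1 < s\<^sub>2" "s\<^sub>2 < r" "s\<^sub>2 - s\<^sub>1 = \<eta>"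
      using s0 by (auto simp: s\<^sub>1_def s\<^sub>2_def \<eta>_def field_simps)
    have Vpos: "?V > 0" "a < ?V" "a < ?V / 2" using V0 t0(1) a by auto
    have PV: "Phi ?V > 0" using Phi_mono[of a ?V] a Vpos by linarith
    \<comment> \<open>A small increase of \<open>G\<close> between half of \<open>?V\<close> and
      \<open>?V\<close> means that \<open>Phi ?V\<close> is large, and by \<open>Phi_le\<close> so
      is \<open>\<phi> ?V\<close>.\<close>
    have "(?V - ?V / 2) / sqrt (Phi ?V) < \<epsilon>"
      using G_diff_lower[of a "?V / 2" ?V] t0(2)[of "?V / 2" ?V] a V0 Vpos by linarith
    then have h: "?V / 2 < \<epsilon> * sqrt (Phi ?V)" using PV by (simp add: divide_less_eq)
    have "(?V / 2)\<^sup>2 < (\<epsilon> * sqrt (Phi ?V))\<^sup>2" by (rule power_strict_mono[OF h]) (use Vpos in auto)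
    then have "?V\<^sup>2 / 4 < \<epsilon>\<^sup>2 * Phi ?V" using PV by (simp add: power_mult_distrib power_divide)
    also have "\<dots> \<le> \<epsilon>\<^sup>2 * (?V * \<phi> ?V)" using Phi_le[of ?V] Vpos by (intro mult_left_mono) auto
    finally have "?V * (?V / 4) < ?V * (\<epsilon>\<^sup>2 * \<phi> ?V)" by (simp add: power2_eq_square mult_ac)
    then have "?V / 4 < \<epsilon>\<^sup>2 * \<phi> ?V" using Vpos(1) by (simp only: mult_less_cancel_left_pos)
    then have "?V < \<phi> ?V * \<eta>\<^sup>2 / (2 * m)" using m by (simp add: \<epsilon>2 field_simps)
    moreover have "?V + \<phi> ?V * (s\<^sub>1 - s\<^sub>0)\<^sup>2 / (2 * m) \<le> v s\<^sub>1"
      by (rule growth_lower[OF sol c s0(1) ss(1)]) (use ss in simp)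
    ultimately have V1: "2 * ?V \<le> v s\<^sub>1" by (simp add: s\<^sub>1_def)
    \<comment> \<open>After the doubling \<open>Phi ?V\<close> is at most half of
      \<open>Phi (v x)\<close>, so subtracting it in \<open>energy_lower\<close> costs only a factor
      2.\<close>
    have flux: "sqrt (Phi (v x)) / sqrt m \<le> x * Q v x" if x: "s\<^sub>1 \<le> x" "x \<le> s\<^sub>2" for x
    proof -
      have "v s\<^sub>1 \<le> v x" by (rule sol_mono[OF sol c]) (use x ss s0 in auto)
      then have "2 * Phi ?V \<le> Phi (v x)"
        using Phi_double[OF Vpos(1)] Phi_mono[of "2 * ?V" "v x"] V1 Vpos by linarith
      then have "Phi (v x) / m \<le> 2 / m * (Phi (v x) - Phi ?V)" using m by (simp add: field_simps)
      also have "\<dots> \<le> (x * Q v x)\<^sup>2" by (rule energy_lower[OF sol c s0(1)]) (use x ss in auto)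
      finally have "sqrt (Phi (v x) / m) \<le> x * Q v x"
        using Q_nonneg[OF sol c, of x] x ss s0 by (intro real_le_lsqrt) auto
      then show ?thesis by (simp add: real_sqrt_divide)
    qed
    have "G a (v s\<^sub>1) - s\<^sub>1 / sqrt m \<le> G a (v s\<^sub>2) - s\<^sub>2 / sqrt m"
    proof (rule DERIV_nonneg_imp_nondecreasing[where f="\<lambda>x. G a (v x) - x / sqrt m" and a="s\<^sub>1" and b="s\<^sub>2"])
      fix x assume x: "s\<^sub>1 \<le> x" "x \<le> s\<^sub>2"
      have vx: "v s\<^sub>1 \<le> v x" by (rule sol_mono[OF sol c]) (use x ss s0 in auto)
      then have ax: "a < v x" using V1 Vpos by linarith
      have D: "((\<lambda>x. G a (v x) - x / sqrt m) has_real_derivative 1 / sqrt (Phi (v x)) * (x * Q v x) - 1 / sqrt m) (at x)"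
        by (intro DERIV_diff DERIV_cdivide DERIV_ident DERIV_chain2[OF G_deriv sol_deriv_at[OF sol c]])
          (use a ax x ss s0 in auto)
      have "0 < Phi (v x)" using Phi_mono[of a "v x"] a ax by linarith
      then have "1 / sqrt m \<le> 1 / sqrt (Phi (v x)) * (x * Q v x)"
        using flux[OF x] by (simp add: field_simps)
      then show "\<exists>d. ((\<lambda>x. G a (v x) - x / sqrt m) has_real_derivative d) (at x) \<and> 0 \<le> d" using D by force
    qed (use ss in simp)
    moreover have "G a (v s\<^sub>2) - G a (v s\<^sub>1) < \<epsilon>"
      by (rule t0(2)) (use V1 V0 Vpos t0(1) a sol_mono[OF sol c, of s\<^sub>1 s\<^sub>2] ss s0 in auto)
    moreover have "s\<^sub>2 / sqrt m - s\<^sub>1 / sqrt m = \<eta> / sqrt m"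
      unfolding diff_divide_distrib[symmetric] ss(4) ..
    ultimately have "\<eta> / sqrt m < \<epsilon>" by linarith
    moreover have "\<epsilon> \<le> \<eta> / sqrt m"
      unfolding \<epsilon>_def using \<eta> m by (intro divide_left_mono) auto
    ultimately show False by simp
  qed
  then show ?thesis by (rule that)
qed


text \<open>If the solution \<open>v\<close> started at \<open>c\<close> is bounded on \<open>[0, r]\<close>, then \<open>v + \<delta> * exp (lam * s)\<close> is a supersolution
  for the initial value \<open>c + \<delta>\<close>.\<close>

lemma bounded_init_open:
  assumes lip: "locally_lipschitz_on {0..} \<phi>" and r: "r > 0" and c: "c \<ge> 0" and B: "\<And>j. iterate c j r \<le> B"
  obtains \<delta> C where "\<delta> > 0" "\<And>j. iterate (c + \<delta>) j r \<le> C"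
proof -
  define v where "v = (\<lambda>s. lim (\<lambda>j. iterate c j s))"
  have lc: "continuous_on {0..r} v" "\<And>s. s \<in> {0..r} \<Longrightarrow> v s = T c v s"
    "\<And>s. s \<in> {0..r} \<Longrightarrow> (\<lambda>j. iterate c j s) \<longlonglongrightarrow> v s" "\<And>s. s \<in> {0..r} \<Longrightarrow> c \<le> v s"
    unfolding v_def by (rule it_limit_closed[OF c less_imp_le[OF r] B]; assumption)+
  have v0: "0 \<le> v s" if "s \<in> {0..r}" for s using lc(4)[OF that] c by simp
  have vB: "v s \<le> v r" if "s \<in> {0..r}" for s
    using T_mono_arg[OF lc(1) v0, of s c] lc(2)[OF that] lc(2)[of r] that r by auto
  have vr: "0 \<le> v r" using v0[of r] r by simp
  obtain L where L: "L \<ge> 0" "\<And>x y. 0 \<le> x \<Longrightarrow> x \<le> y \<Longrightarrow> y \<le> v r + 1 \<Longrightarrow> \<phi> y - \<phi> x \<le> L * (y - x)"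
    using locally_lipschitz_mono_interval[OF lip, of "v r + 1"] vr by auto
  \<comment> \<open>The rate \<open>lam\<close> dominates \<open>L * \<tau> / m\<close>, by which
    the integral operator amplifies the perturbation. The choice of \<delta> keeps the perturbation
    at most 1 on \<open>{0..r}\<close>, within the range where \<open>L\<close> applies.\<close>
  define lam where "lam = L * r / m + 1"
  define \<delta> where "\<delta> = exp (- lam * r)"
  define w where "w = (\<lambda>s. v s + \<delta> * exp (lam * s))"
  have lam: "lam > 0" "L * r / m \<le> lam" using L(1) r m by (auto simp: lam_def intro!: add_nonneg_pos)
  have \<delta>: "\<delta> > 0" by (simp add: \<delta>_def)
  have e1: "\<delta> * exp (lam * s) \<le> 1" if "s \<le> r" for s
  proof -
    have "\<delta> * exp (lam * s) = exp (lam * (s - r))" by (simp add: \<delta>_def exp_add[symmetric] algebra_simps)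
    then show ?thesis using that lam(1) by (simp add: mult_le_0_iff)
  qed
  have wcont: "continuous_on {0..r} w" unfolding w_def by (intro continuous_intros lc(1))
  have wv: "v s \<le> w s" for s using \<delta> by (simp add: w_def)
  have wc: "c + \<delta> \<le> w s" if s: "s \<in> {0..r}" for s
  proof -
    have "1 \<le> exp (lam * s)" using s lam(1) by simp
    then have "\<delta> * 1 \<le> \<delta> * exp (lam * s)" using \<delta> by (intro mult_left_mono) auto
    then show ?thesis using lc(4)[OF s] by (simp add: w_def)
  qed
  have super: "T (c + \<delta>) w s \<le> w s" if s: "s \<in> {0..r}" for s
  proof -
    have Jw: "\<tau> * J (\<lambda>t. \<phi> (w t)) \<tau> \<le> \<tau> * J (\<lambda>t. \<phi> (v t)) \<tau> + \<delta> * (lam * exp (lam * \<tau>))" if \<tau>: "\<tau> \<in> {0..s}" for \<tau>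
    proof -
      have sub: "{0..\<tau>} \<subseteq> {0..r}" using \<tau> s by auto
      have c1: "continuous_on {0..\<tau>} (\<lambda>t. \<phi> (w t))" "continuous_on {0..\<tau>} (\<lambda>t. \<phi> (v t))"
        using order_trans[OF v0 wv] v0 sub
        by (auto intro!: phi_compose_cont continuous_on_subset[OF wcont] continuous_on_subset[OF lc(1)])
      let ?k = "L * \<delta> * exp (lam * \<tau>)"
      have "J (\<lambda>t. \<phi> (w t)) \<tau> \<le> J (\<lambda>t. \<phi> (v t) + ?k) \<tau>"
      proof (rule J_mono[OF c1(1)])
        fix t assume t: "t \<in> {0..\<tau>}"
        then have tr: "t \<in> {0..r}" using sub by auto
        have "w t \<le> v r + 1" using vB[OF tr] e1[of t] tr by (simp add: w_def)
        then have "\<phi> (w t) - \<phi> (v t) \<le> L * (w t - v t)" by (intro L(2) v0[OF tr] wv)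
        also have "\<dots> = L * \<delta> * exp (lam * t)" by (simp add: w_def)
        also have "\<dots> \<le> ?k" using t lam(1) L(1) \<delta> by (intro mult_left_mono) auto
        finally show "\<phi> (w t) \<le> \<phi> (v t) + ?k" by simp
      qed (use \<tau> c1 in \<open>auto intro!: continuous_intros\<close>)
      also have "\<dots> = J (\<lambda>t. \<phi> (v t)) \<tau> + ?k / m"
        using \<tau> by (subst J_add[OF c1(2)]) (auto simp: J_const)
      finally have "\<tau> * J (\<lambda>t. \<phi> (w t)) \<tau> \<le> \<tau> * (J (\<lambda>t. \<phi> (v t)) \<tau> + ?k / m)"
        using \<tau> by (intro mult_left_mono) auto
      moreover have "\<tau> * (?k / m) \<le> \<delta> * (lam * exp (lam * \<tau>))"
      proof -
        have "\<tau> * (?k / m) = (\<tau> * L / m) * (\<delta> * exp (lam * \<tau>))" by simp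
        also have "\<dots> \<le> lam * (\<delta> * exp (lam * \<tau>))"
        proof (rule mult_right_mono)
          have "\<tau> * L / m \<le> L * r / m" using \<tau> s L(1) m by (intro divide_right_mono) (auto simp: mult.commute intro: mult_left_mono)
          then show "\<tau> * L / m \<le> lam" using lam(2) by simp
        qed (use \<delta> in simp)
        finally show ?thesis by (simp add: mult_ac)
      qed
      ultimately show ?thesis by (simp add: distrib_left)
    qed
    have sub: "{0..s} \<subseteq> {0..r}" using s by auto
    have ci: "continuous_on {0..s} (\<lambda>\<tau>. \<tau> * J (\<lambda>t. \<phi> (w t)) \<tau>)" "continuous_on {0..s} (\<lambda>\<tau>. \<tau> * J (\<lambda>t. \<phi> (v t)) \<tau>)"
      using order_trans[OF v0 wv] v0 sub
      by (auto intro!: integrand_cont continuous_on_subset[OF wcont] continuous_on_subset[OF lc(1)])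
    have ex: "((\<lambda>\<tau>. \<delta> * (lam * exp (lam * \<tau>))) has_integral \<delta> * exp (lam * s) - \<delta> * exp (lam * 0)) {0..s}"
    proof (rule fundamental_theorem_of_calculus)
      show "((\<lambda>\<tau>. \<delta> * exp (lam * \<tau>)) has_vector_derivative \<delta> * (lam * exp (lam * x))) (at x within {0..s})" for x
        unfolding has_real_derivative_iff_has_vector_derivative[symmetric]
        by (auto intro!: derivative_eq_intros)
    qed (use s in auto)
    have "integral {0..s} (\<lambda>\<tau>. \<tau> * J (\<lambda>t. \<phi> (w t)) \<tau>) \<le> integral {0..s} (\<lambda>\<tau>. \<tau> * J (\<lambda>t. \<phi> (v t)) \<tau> + \<delta> * (lam * exp (lam * \<tau>)))"
      by (intro integral_le integrable_continuous_real ci continuous_on_add Jw) (auto intro!: continuous_intros)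
    also have "\<dots> = integral {0..s} (\<lambda>\<tau>. \<tau> * J (\<lambda>t. \<phi> (v t)) \<tau>) + (\<delta> * exp (lam * s) - \<delta>)"
      using integral_add[OF integrable_continuous_real[OF ci(2)] has_integral_integrable[OF ex]] integral_unique[OF ex]
      by (simp only: exp_zero mult_zero_right mult_1_right)
    finally show ?thesis using lc(2)[OF s] by (simp add: T_def w_def)
  qed
  have "iterate (c + \<delta>) j r \<le> w r" for j
    by (rule it_le_supersolution[OF _ order_refl wcont wc super]) (use c \<delta> r in auto)
  then show ?thesis using that[OF \<delta>] by blast
qed

text \<open>The initial value is the supremum of those whose solution stays bounded on \<open>[0, r]\<close>.\<close>

lemma explosive_solution:
  assumes lip: "locally_lipschitz_on {0..} \<phi>" and phi0: "\<phi> 0 = 0"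
    and a: "a > 0" "Phi a > 0" and M: "\<And>t. t \<ge> a \<Longrightarrow> G a t \<le> M" and r: "r > 0"
  obtains c v where "c > 0" "is_sol c r v" "\<And>B. \<exists>s\<in>{0..<r}. B < v s"
proof -
  define A where "A = {c. 0 \<le> c \<and> (\<exists>B. \<forall>j. iterate c j r \<le> B)}"
  have bnd: "\<exists>B. \<forall>c\<in>A. \<forall>j. iterate c j s \<le> B" if s: "s < r" "s \<ge> 0" for s
  proof -
    \<comment> \<open>\<open>sol_bound\<close> asks for a positive radius, whereas \<open>s\<close>
      may be 0.\<close>
    define s' where "s' = (s + r) / 2"
    have s': "0 < s'" "s' < r" "s \<le> s'" using s r by (auto simp: s'_def)
    obtain B where B: "\<And>c v. c > 0 \<Longrightarrow> is_sol c r v \<Longrightarrow> v s' \<le> B"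
      using sol_bound[OF a M s'(1,2)] by metis
    have pos: "iterate c j s \<le> B" if c: "c > 0" "c \<in> A" for c j
    proof -
      obtain B' where B': "\<And>j. iterate c j r \<le> B'" using c by (auto simp: A_def)
      have "\<exists>B. \<forall>j. iterate c j t \<le> B" if "t \<in> {0..<r}" for t
        using B' it_mono_arg[of c t r] c(1) that by (intro exI[of _ B'] allI) (force intro: order_trans)
      then obtain v where v: "is_sol c r v" "\<And>s. s \<in> {0..<r} \<Longrightarrow> (\<lambda>j. iterate c j s) \<longlonglongrightarrow> v s"
        using is_sol_limit[of c r] c(1) by (metis less_imp_le)
      have "iterate c j s \<le> iterate c j s'" using c s s' by (intro it_mono_arg) auto
      also have "\<dots> \<le> v s'"
        using c s' by (intro incseq_le[OF it_incseq v(2)]) auto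
      also have "\<dots> \<le> B" by (rule B[OF c(1) v(1)])
      finally show ?thesis .
    qed
    have "iterate c j s \<le> max B (iterate 0 j s)" if "c \<in> A" for c j
      using pos[of c j] that by (cases "c = 0") (auto simp: A_def)
    \<comment> \<open>\<open>sol_bound\<close> covers positive initial values only; for the value 0
      the zero function is a solution because \<open>\<phi> 0 = 0\<close>.\<close>
    moreover have "iterate 0 j s \<le> 0" for j
      by (rule it_le_supersolution[where w="\<lambda>_. 0" and c=0 and a=s]) (use s in \<open>auto simp: T_def phi0 J_const\<close>)
    ultimately have "iterate c j s \<le> max B 0" if "c \<in> A" for c j
      using that by (meson max.mono order_refl order_trans)
    then show ?thesis by blast
  qed
  have "iterate 0 j r \<le> 0" for j
    by (rule it_le_supersolution[where w="\<lambda>_. 0" and c=0 and a=r]) (use r in \<open>auto simp: T_def phi0 J_const\<close>)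
  then have A0: "0 \<in> A" by (auto simp: A_def)
  have op: "\<exists>\<delta>>0. c + \<delta> \<in> A" if "c \<in> A" for c
  proof -
    obtain B where c: "0 \<le> c" and B: "\<And>j. iterate c j r \<le> B" using \<open>c \<in> A\<close> by (auto simp: A_def)
    obtain \<delta> C where "\<delta> > 0" "\<And>j. iterate (c + \<delta>) j r \<le> C" using bounded_init_open[OF lip r c B] by metis
    then have "c + \<delta> \<in> A" using c unfolding A_def by (auto intro!: exI[of _ C])
    then show ?thesis using \<open>\<delta> > 0\<close> by blast
  qed
  have "bdd_above A"
  proof -
    obtain B where "\<forall>c\<in>A. \<forall>j. iterate c j 0 \<le> B" using bnd[of 0] r by auto
    then have "\<forall>c\<in>A. iterate c 0 0 \<le> B" by blast
    then show ?thesis by (auto intro: bdd_aboveI)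
  qed
  define c where "c = Sup A"
  have up: "x \<le> c" if "x \<in> A" for x unfolding c_def by (rule cSup_upper[OF that \<open>bdd_above A\<close>])
  \<comment> \<open>By \<open>op\<close> the set has no largest element.\<close>
  have cA: "c \<notin> A" using op up by force
  have c: "c > 0" using op[OF A0] up by force
  have down: "x \<in> A" if x: "0 \<le> x" "x < c" for x
  proof -
    obtain y where y: "y \<in> A" "x < y" using less_cSup_iff[of A x] A0 \<open>bdd_above A\<close> x by (auto simp: c_def)
    then obtain B where "\<forall>j. iterate y j r \<le> B" by (auto simp: A_def)
    then have "\<forall>j. iterate x j r \<le> B" using it_mono_init[of x y r] x y r by (force intro: order_trans)
    then show ?thesis using x by (auto simp: A_def)
  qed
  have "\<exists>B. \<forall>j. iterate c j s \<le> B" if s: "s \<in> {0..<r}" for s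
  proof -
    obtain B where B: "\<forall>c\<in>A. \<forall>j. iterate c j s \<le> B" using bnd[of s] s by auto
    \<comment> \<open>Members of \<open>A\<close> tending to \<open>c\<close> from below: their
      common bound at \<open>s\<close> passes to every iterate started at \<open>c\<close>.\<close>
    define cn where "cn = (\<lambda>n. c * (1 - 1 / (real n + 2)))"
    have cn: "0 \<le> cn n" "cn n < c" for n using c by (auto simp: cn_def field_simps)
    have lim: "cn \<longlonglongrightarrow> c" unfolding cn_def by real_asymp
    have "iterate c j s \<le> B" for j
      by (rule LIMSEQ_le_const2[OF it_limit_init[OF lim cn(1) less_imp_le[OF cn(2)]]])
        (use s B down cn in auto)
    then show ?thesis by blast
  qed
  then obtain v where v: "is_sol c r v" "\<And>s. s \<in> {0..<r} \<Longrightarrow> (\<lambda>j. iterate c j s) \<longlonglongrightarrow> v s"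
    using is_sol_limit[of c r] c by (metis less_imp_le)
  have "\<exists>s\<in>{0..<r}. B < v s" for B
  proof (rule ccontr)
    assume "\<not> ?thesis"
    then have vB: "v s \<le> B" if "s \<in> {0..<r}" for s using that by force
    \<comment> \<open>A bound for \<open>v\<close> on \<open>{0..<r}\<close> would reach the end
      point through the continuity of each single iterate, and so put \<open>c\<close> into
      \<open>A\<close>.\<close>
    define sn where "sn = (\<lambda>n. r * (1 - 1 / (real n + 2)))"
    have sn: "sn n \<in> {0..<r}" for n using r by (auto simp: sn_def field_simps)
    have lim: "sn \<longlonglongrightarrow> r" unfolding sn_def by real_asymp
    have "iterate c j r \<le> B" for j
    proof (rule LIMSEQ_le_const2)
      show "(\<lambda>n. iterate c j (sn n)) \<longlonglongrightarrow> iterate c j r"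
        by (rule continuous_on_tendsto_compose[OF it_cont_ge(1)[of c r j] lim]) (use c r sn in \<open>auto simp: less_imp_le\<close>)
      have "iterate c j (sn n) \<le> B" for n
        using incseq_le[OF it_incseq[of c "sn n"] v(2)[OF sn[of n]], of j] vB[OF sn[of n]] sn[of n] c by auto
      then show "\<exists>N. \<forall>n\<ge>N. iterate c j (sn n) \<le> B" by blast
    qed
    then have "c \<in> A" using c by (auto simp: A_def)
    then show False using cA by blast
  qed
  then show ?thesis using that c v(1) by blast
qed

text \<open>For the truncation \<open>\<phi> (min t N)\<close> solutions exist globally, and their bound from \<open>growth_upper\<close> does not
  depend on \<open>N\<close>.\<close>

lemma bounded_solution:
  assumes a: "a > 0" "Phi a > 0" and unb: "\<And>M. \<exists>t\<ge>a. M < G a t" and c: "a < c" and r: "r > 0"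
  obtains v N where "is_sol c r v" "\<And>s. s \<in> {0..<r} \<Longrightarrow> v s \<le> N"
proof -
  \<comment> \<open>A level that \<open>growth_upper\<close> does not allow the solution to reach
    before \<open>r\<close>.\<close>
  obtain N where N: "N \<ge> a" "G a c + sqrt 2 * r < G a N" using unb by blast
  have cN: "c < N"
  proof (rule ccontr)
    assume "\<not> c < N"
    then have "G a N \<le> G a c" using N(1) a by (intro G_mono) auto
    moreover have "0 \<le> sqrt 2 * r" using r by simp
    ultimately show False using N(2) by linarith
  qed
  interpret N: radial_ode m "\<lambda>t. \<phi> (min t N)"
  proof
    show "continuous_on {0..} (\<lambda>t. \<phi> (min t N))"
      by (rule continuous_on_compose2[OF phi_cont]) (use cN c a in \<open>auto intro!: continuous_intros\<close>)
    show "mono_on {0..} (\<lambda>t. \<phi> (min t N))"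
      using cN c a by (auto simp: mono_on_def intro!: phi_le)
    show "0 \<le> \<phi> (min t N)" if "t \<ge> 0" for t using that cN c a by (intro phi_nonneg) auto
  qed (rule m)
  have c0: "c > 0" using a c by simp
  have le: "\<phi> (min t N) \<le> \<phi> t" "\<phi> (min t N) \<le> \<phi> N" if "t \<ge> 0" for t
    using that cN c0 by (auto intro!: phi_le)
  \<comment> \<open>The truncated nonlinearity is at most \<open>\<phi> N\<close>, so a constant of
    this size is a supersolution on \<open>{0..r}\<close>.\<close>
  define W where "W = c + r * (r * \<phi> N / m)"
  have phiN: "0 \<le> \<phi> N" using cN c0 by (intro phi_nonneg) auto
  have W: "0 \<le> W" "c \<le> W" using c0 r m phiN by (auto simp: W_def)
  have TW: "N.T c (\<lambda>_. W) t \<le> W" if t: "t \<in> {0..r}" for t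
  proof -
    have "integral {0..t} (\<lambda>\<tau>. \<tau> * N.J (\<lambda>_. \<phi> (min W N)) \<tau>) \<le> integral {0..t} (\<lambda>_. r * \<phi> N / m)"
    proof (rule integral_le)
      show "(\<lambda>\<tau>. \<tau> * N.J (\<lambda>_. \<phi> (min W N)) \<tau>) integrable_on {0..t}"
        unfolding N.J_const by (intro integrable_continuous_real continuous_intros) (use m in auto)
      show "\<tau> * N.J (\<lambda>_. \<phi> (min W N)) \<tau> \<le> r * \<phi> N / m" if "\<tau> \<in> {0..t}" for \<tau>
      proof -
        have "\<tau> * \<phi> (min W N) \<le> r * \<phi> N"
          using that t le(2)[OF W(1)] N.phi_nonneg[OF W(1)] by (intro mult_mono) auto
        then show ?thesis unfolding N.J_const using m by (simp add: divide_right_mono)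
      qed
    qed (rule integrable_const_ivl)
    also have "\<dots> = t * (r * \<phi> N / m)" using t by simp
    also have "\<dots> \<le> r * (r * \<phi> N / m)" using t r m phiN by (intro mult_right_mono) auto
    finally show ?thesis by (simp add: N.T_def W_def)
  qed
  have "N.iterate c j s \<le> W" if "s \<in> {0..<r}" for s j
    by (rule N.it_le_supersolution[where w="\<lambda>_. W" and a=r and c=c]) (use c0 W TW that in auto)
  then obtain v where v: "N.is_sol c r v"
    using N.is_sol_limit[of c r] c0 by (metis less_imp_le)
  have vN: "v s \<le> N" if s: "s \<in> {0..<r}" for s
  proof (rule ccontr)
    assume "\<not> v s \<le> N"
    then have Nv: "N \<le> v s" by simp
    have Ppos: "0 < Phi t" if "t \<ge> a" for t using Phi_mono[of a t] that a by linarith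
    have "integral {a..v s} (\<lambda>x. 1 / sqrt (Phi x)) \<le> integral {a..c} (\<lambda>x. 1 / sqrt (Phi x)) + sqrt 2 * s"
    proof (rule N.growth_upper[OF v a(1) c])
      show "continuous_on {a..} Phi"
        unfolding continuous_on_eq_continuous_within
      proof
        fix t assume t: "t \<in> {a..}"
        then have "isCont Phi t" using Phi_deriv[of t] a by (intro DERIV_isCont) auto
        then show "continuous (at t within {a..}) Phi" by (rule continuous_at_imp_continuous_at_within)
      qed
      show "N.Phi t \<le> Phi t" if "t \<ge> a" for t
        unfolding N.Phi_def Phi_def by (rule integral_le[OF N.phi_integrable phi_integrable]) (use le in auto)
    qed (use Ppos s in auto)
    then have "G a (v s) \<le> G a c + sqrt 2 * s" by (simp add: G_def)
    also have "\<dots> \<le> G a c + sqrt 2 * r" using s by simp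
    also have "\<dots> < G a N" by (rule N(2))
    also have "\<dots> \<le> G a (v s)" using a c cN Nv by (intro G_mono) auto
    finally show False by simp
  qed
  have "is_sol c r v" unfolding is_sol_def
  proof (intro conjI ballI)
    show "continuous_on {0..<r} v" by (rule N.sol_cont[OF v c0])
    fix s assume s: "s \<in> {0..<r}"
    show "c \<le> v s" by (rule N.sol_ge[OF v c0 s])
    \<comment> \<open>As \<open>v\<close> stays below \<open>N\<close>, the truncation is inactive
      and the equation is the original one.\<close>
    have "N.J (\<lambda>t. \<phi> (min (v t) N)) \<tau> = J (\<lambda>t. \<phi> (v t)) \<tau>" if \<tau>: "\<tau> \<in> {0..s}" for \<tau>
      unfolding J_def
    proof (rule integral_cong)
      fix q :: real assume "q \<in> {0..1}"
      then have "\<tau> * q \<in> {0..\<tau>}" using scaled_range[of \<tau> q] \<tau> by auto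
      then have "v (\<tau> * q) \<le> N" using \<tau> s by (intro vN) auto
      then show "q powr (m - 1) * \<phi> (min (v (\<tau> * q)) N) = q powr (m - 1) * \<phi> (v (\<tau> * q))" by simp
    qed
    then have "N.T c v s = T c v s"
      unfolding N.T_def T_def by (intro arg_cong2[where f="(+)"] integral_cong refl) simp
    then show "v s = T c v s" using N.sol_eq[OF v c0 s] by simp
  qed
  then show ?thesis using that vN by blast
qed

section \<open>The Keller-Osserman integral in terms of \<open>G\<close>\<close>

lemma keller_osserman_eq:
  assumes "a \<ge> 0" "Phi a > 0"
  shows "keller_osserman_integral \<phi> a = (\<integral>\<^sup>+t. ennreal (1 / sqrt (Phi t)) * indicator {a..} t \<partial>lborel)"
  unfolding keller_osserman_integral_def
proof (rule nn_integral_cong)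
  fix t
  show "1 / ennreal (sqrt (LBINT s:{0..t}. \<phi> s)) * indicator {a..} t = ennreal (1 / sqrt (Phi t)) * indicator {a..} t"
  proof (cases "t \<ge> a")
    case True
    have "set_integrable lborel {0..t} \<phi>"
      by (rule borel_integrable_atLeastAtMost'[OF continuous_on_subset[OF phi_cont]]) auto
    then have "(LBINT s:{0..t}. \<phi> s) = Phi t" unfolding Phi_def by (rule set_borel_integral_eq_integral)
    moreover have "0 < Phi t" using Phi_mono[of a t] True assms by linarith
    ultimately show ?thesis using divide_ennreal[of 1 "sqrt (Phi t)"] by simp
  qed simp
qed

lemma nn_integral_G:
  assumes "a \<ge> 0" "Phi a > 0" "a \<le> t"
  shows "(\<integral>\<^sup>+x. ennreal (1 / sqrt (Phi x)) * indicator {a..t} x \<partial>lborel) = ennreal (G a t)"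
proof -
  have si: "set_integrable lborel {a..t} (\<lambda>x. 1 / sqrt (Phi x))"
    by (rule borel_integrable_atLeastAtMost'[OF G_integrand_cont[OF assms(1,2)]])
  have "(\<integral>\<^sup>+x. ennreal (1 / sqrt (Phi x)) * indicator {a..t} x \<partial>lborel)
      = (\<integral>\<^sup>+x. ennreal (indicator {a..t} x *\<^sub>R (1 / sqrt (Phi x))) \<partial>lborel)"
    by (rule nn_integral_cong) (simp add: indicator_def)
  also have "\<dots> = ennreal (\<integral>x. indicator {a..t} x *\<^sub>R (1 / sqrt (Phi x)) \<partial>lborel)"
    by (rule nn_integral_eq_integral) (use si Phi_nonneg in \<open>auto simp: set_integrable_def\<close>)
  also have "(\<integral>x. indicator {a..t} x *\<^sub>R (1 / sqrt (Phi x)) \<partial>lborel) = G a t"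
    using set_borel_integral_eq_integral(2)[OF si] by (simp add: G_def set_lebesgue_integral_def)
  finally show ?thesis .
qed

lemma keller_osserman_bounded:
  assumes a: "a \<ge> 0" "Phi a > 0" and fin: "keller_osserman_integral \<phi> a < \<infinity>" and t: "t \<ge> a"
  shows "G a t \<le> enn2real (keller_osserman_integral \<phi> a)"
proof -
  have "ennreal (G a t) \<le> keller_osserman_integral \<phi> a"
    unfolding nn_integral_G[OF a t, symmetric] keller_osserman_eq[OF a]
    by (rule nn_integral_mono) (use t in \<open>auto simp: indicator_def\<close>)
  also have "\<dots> = ennreal (enn2real (keller_osserman_integral \<phi> a))" using fin by simp
  finally show ?thesis by (simp add: ennreal_le_iff)
qed

text \<open>Monotone convergence over the intervals \<open>{a..a + real n}\<close>: a bound for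
  \<open>G a\<close> would bound the integral.\<close>

lemma keller_osserman_unbounded:
  assumes a: "a \<ge> 0" "Phi a > 0" and inf: "keller_osserman_integral \<phi> a = \<infinity>"
  shows "\<exists>t\<ge>a. M < G a t"
proof (rule ccontr)
  assume "\<not> ?thesis"
  then have M: "G a t \<le> M" if "t \<ge> a" for t using that by force
  define f where "f = (\<lambda>n x. ennreal (1 / sqrt (Phi x)) * indicator {a..a + real n} x)"
  have "(\<lambda>x. indicator {a..} x *\<^sub>R (1 / sqrt (Phi x))) \<in> borel_measurable borel"
  proof (rule borel_measurable_continuous_on_indicator)
    have Ppos: "0 < Phi t" if "t \<ge> a" for t using Phi_mono[of a t] that a by linarith
    have "continuous (at t within {a..}) (\<lambda>x. 1 / sqrt (Phi x))" if "t \<ge> a" for t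
    proof -
      have "continuous (at t within {a..t + 1}) (\<lambda>x. 1 / sqrt (Phi x))"
        using G_integrand_cont[OF a, of "t + 1"] that by (simp add: continuous_on_eq_continuous_within)
      moreover have "at t within {a..} = at t within {a..t + 1}"
        by (rule at_within_nhd[where S="{..<t + 1}"]) auto
      ultimately show ?thesis by simp
    qed
    then show "continuous_on {a..} (\<lambda>x. 1 / sqrt (Phi x))"
      by (simp add: continuous_on_eq_continuous_within)
  qed simp
  then have meas: "(\<lambda>x. ennreal (indicator {a..} x *\<^sub>R (1 / sqrt (Phi x)))) \<in> borel_measurable borel" by measurable
  have fn: "f n x = ennreal (indicator {a..} x *\<^sub>R (1 / sqrt (Phi x))) * indicator {a..a + real n} x" for n x
    by (auto simp: f_def indicator_def)
  have fm: "f n \<in> borel_measurable lborel" for n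
    unfolding fn[abs_def] using meas by measurable
  have inc: "incseq f"
    by (auto simp: incseq_def le_fun_def f_def indicator_def)
  have sup: "(SUP n. f n x) = ennreal (1 / sqrt (Phi x)) * indicator {a..} x" for x
  proof (cases "a \<le> x")
    case True
    obtain N where N: "x - a \<le> real N" using real_arch_simple by blast
    show ?thesis
    proof (rule antisym)
      show "(SUP n. f n x) \<le> ennreal (1 / sqrt (Phi x)) * indicator {a..} x"
        by (rule SUP_least) (auto simp: f_def indicator_def)
      have "ennreal (1 / sqrt (Phi x)) * indicator {a..} x = f N x" using True N by (simp add: f_def)
      also have "\<dots> \<le> (SUP n. f n x)" by (rule SUP_upper) simp
      finally show "ennreal (1 / sqrt (Phi x)) * indicator {a..} x \<le> (SUP n. f n x)" .
    qed
  qed (simp add: f_def)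
  have "keller_osserman_integral \<phi> a = (\<integral>\<^sup>+x. (SUP n. f n x) \<partial>lborel)"
    unfolding keller_osserman_eq[OF a] sup ..
  also have "\<dots> = (SUP n. integral\<^sup>N lborel (f n))"
    by (rule nn_integral_monotone_convergence_SUP[OF inc fm])
  also have "\<dots> \<le> ennreal M"
  proof (rule SUP_least)
    show "integral\<^sup>N lborel (f n) \<le> ennreal M" for n
      unfolding f_def using nn_integral_G[OF a, of "a + real n"] M[of "a + real n"] by (simp add: ennreal_leI)
  qed
  finally show False using inf by (simp add: top_unique)
qed

end

theorem theorem7p4:
  fixes R :: "'a::euclidean_space set"
    and k :: "'a \<Rightarrow> real"
    and \<phi> :: "real \<Rightarrow> real"
    and r :: real
  assumes "root_system R"
    and "positive_multiplicity R k"
    and "real DIM('a) + (\<Sum>\<alpha>\<in>R. k \<alpha>) > 2"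
    and "\<forall>t\<ge>0. \<phi> t \<ge> 0"
    and "locally_lipschitz_on {0..} \<phi>"
    and "mono_on {0..} \<phi>"
    and "\<phi> 0 = 0"
    and "\<exists>t\<ge>0. \<phi> t \<noteq> 0"
    and "r > 0"
  shows "(\<exists>u. positive_blowup_solution R k \<phi> r u) \<longleftrightarrow>
         (\<exists>a>0. keller_osserman_integral \<phi> a < \<infinity>)"
proof -
  interpret D: dunkl R k by unfold_locales (rule assms)+
  have cont: "continuous_on {0..} \<phi>" by (rule locally_lipschitz_continuous[OF assms(5)])
  interpret ode: radial_ode D.hom_dim \<phi>
    using assms(3,4,6) cont by unfold_locales (auto simp: D.hom_dim_def)
  obtain t where t: "t > 0" "\<phi> t > 0"
    using assms(4,7,8) by (metis less_eq_real_def)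
  \<comment> \<open>At the doubled argument positivity of the primitive is immediate from
    \<open>Phi_twice_ge\<close>.\<close>
  have Phi_t: "ode.Phi (2 * t) > 0"
    using ode.Phi_twice_ge[OF t(1)] ode.Phi_nonneg[of t] mult_pos_pos[OF t] by linarith
  show ?thesis
  proof
    assume "\<exists>u. positive_blowup_solution R k \<phi> r u"
    then obtain u where u: "continuous_on (ball 0 r) u" "\<And>x. x \<in> ball 0 r \<Longrightarrow> u x > 0"
      "\<And>\<psi>. test_function (ball 0 r) \<psi> \<Longrightarrow>
        (LINT x:ball 0 r|lborel. u x * dunkl_laplacian R k \<psi> x * dunkl_weight R k x)
          = (LINT x:ball 0 r|lborel. \<phi> (u x) * \<psi> x * dunkl_weight R k x)"
      "\<And>z. z \<in> sphere 0 r \<Longrightarrow> filterlim u at_top (at z within ball 0 r)"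
      unfolding positive_blowup_solution_def by blast
    show "\<exists>a>0. keller_osserman_integral \<phi> a < \<infinity>"
    proof (rule ccontr)
      assume "\<not> ?thesis"
      \<comment> \<open>Divergence from every starting point is used at one where \<open>Phi\<close>
        is positive.\<close>
      then have "keller_osserman_integral \<phi> (2 * t) = \<infinity>"
        using t(1) by (auto simp: less_top[symmetric])
      then have unb: "\<exists>s\<ge>2 * t. M < ode.G (2 * t) s" for M
        using ode.keller_osserman_unbounded[OF _ Phi_t] t(1) by simp
      \<comment> \<open>Above \<open>2 * t\<close>, as \<open>bounded_solution\<close> requires, and
        above \<open>u 0\<close>, so that the comparison at the origin is violated.\<close>
      define c where "c = max (2 * t) (u 0) + 1"
      have c: "2 * t < c" "u 0 < c" "c > 0" using t(1) by (auto simp: c_def)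
      obtain v N where v: "ode.is_sol c r v" "\<And>s. s \<in> {0..<r} \<Longrightarrow> v s \<le> N"
        using ode.bounded_solution[OF _ Phi_t unb c(1) assms(9)] t(1) by auto
      have "v 0 \<le> u 0"
        by (rule D.comparison_at_origin[OF assms(9) u assms(6) cont ode.Q_cont[OF v(1) c(3)]
              ode.sol_nonneg[OF v(1) c(3)] v(2) ode.sol_deriv[OF v(1) c(3)] ode.Q_deriv[OF v(1) c(3)] ode.Q_at_0[OF v(1) c(3)]])
      moreover have "v 0 = c" using ode.sol_eq[OF v(1) c(3), of 0] assms(9) by (simp add: ode.T_at_0)
      ultimately show False using c(2) by simp
    qed
  next
    assume "\<exists>a>0. keller_osserman_integral \<phi> a < \<infinity>"
    then obtain a where a: "a > 0" "keller_osserman_integral \<phi> a < \<infinity>" by blast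
    \<comment> \<open>Raising the lower limit keeps the integral finite and reaches a point where
      \<open>Phi\<close> is positive.\<close>
    define b where "b = max a (2 * t)"
    have b: "b > 0" "ode.Phi b > 0"
      using a(1) Phi_t ode.Phi_mono[of "2 * t" b] t(1) by (auto simp: b_def)
    have "keller_osserman_integral \<phi> b \<le> keller_osserman_integral \<phi> a"
      unfolding keller_osserman_integral_def by (intro nn_integral_mono) (auto simp: b_def indicator_def)
    then have fin: "keller_osserman_integral \<phi> b < \<infinity>" using a(2) by simp
    obtain c v where c: "c > 0" and v: "ode.is_sol c r v" and inf: "\<And>B. \<exists>s\<in>{0..<r}. B < v s"
      using ode.explosive_solution[OF assms(5,7) b ode.keller_osserman_bounded[OF less_imp_le[OF b(1)] b(2) fin] assms(9)] by blast
    have "positive_blowup_solution R k \<phi> r (\<lambda>x. v (norm x))"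
      unfolding positive_blowup_solution_def
    proof (intro conjI ballI allI impI)
      show "continuous_on (ball 0 r) (\<lambda>x::'a. v (norm x))"
        by (rule continuous_on_compose2[OF ode.sol_cont[OF v c]]) (auto intro: continuous_intros)
      show "0 < v (norm x)" if "x \<in> ball 0 r" for x :: 'a
        using ode.sol_ge[OF v c, of "norm x"] that c by simp
      show "(LINT x:ball 0 r|lborel. v (norm x) * dunkl_laplacian R k \<psi> x * dunkl_weight R k x)
          = (LINT x:ball 0 r|lborel. \<phi> (v (norm x)) * \<psi> x * dunkl_weight R k x)"
        if "test_function (ball 0 r) \<psi>" for \<psi>
        by (rule D.green_radial[OF that assms(9) ode.Q_cont[OF v c] ode.sol_phi_cont[OF v c]
              ode.sol_deriv[OF v c] ode.Q_deriv[OF v c] ode.Q_at_0[OF v c]])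
      fix z :: 'a assume z: "z \<in> sphere 0 r"
      show "filterlim (\<lambda>x. v (norm x)) at_top (at z within ball 0 r)"
        unfolding filterlim_at_top
      proof
        fix B
        \<comment> \<open>Since \<open>v\<close> is nondecreasing, one value above \<open>B\<close>
          bounds it below on the whole annulus between \<open>s\<close> and
          \<open>r\<close>.\<close>
        obtain s where s: "s \<in> {0..<r}" "B < v s" using inf by blast
        have "((\<lambda>x. norm x) \<longlongrightarrow> norm z) (at z within ball 0 r)" by (intro tendsto_intros)
        moreover have "s < norm z" using s z by simp
        ultimately have "\<forall>\<^sub>F x in at z within ball 0 r. s < norm x" by (rule order_tendstoD(1))
        moreover have "\<forall>\<^sub>F x in at z within ball 0 r. x \<in> ball 0 r" by (simp add: eventually_at_filter)
        ultimately show "\<forall>\<^sub>F x in at z within ball 0 r. B \<le> v (norm x)"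
        proof eventually_elim
          case (elim x)
          then have "v s \<le> v (norm x)" using s by (intro ode.sol_mono[OF v c]) auto
          then show ?case using s(2) by simp
        qed
      qed
    qed
    then show "\<exists>u. positive_blowup_solution R k \<phi> r u" by blast
  qed
qed

end
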